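(* Let $n\ge 1$, let $H$ be a group, let $h\in H\setminus\{1\}$, let $G=H_1*\dots*H_n$ be the free product of $n$ copies of $H$, and let $\rho:B_n\to\mathrm{Aut}(G)$ be the Artin type representation associated to $(H,h)$. Assume that $H$ is the group of fractions of a Garside monoid $M$ and that $h$ is a Garside element (of $M$). Let $\widetilde G=G\rtimes_\rho B_n$, and let $\widetilde M$ be the submonoid of $\widetilde G$ generated by $M_1=\phi_1(M)$ and the monoid $B_n^+$ of positive braids. Then $\widetilde M$ is a Garside monoid, $\Delta=(h_1\sigma_1\sigma_2\cdots\sigma_{n-1})^n$ is a Garside element of $\widetilde M$, and $\widetilde G$ is the group of fractions of $\widetilde M$.
   Context: **Artin type representation.** $B_n$ is the braid group on $n$ strands with standard generators $\sigma_1,\dots,\sigma_{n-1}$; $B_n^+$ is the submonoid of $B_n$ generated by $\sigma_1,\dots,\sigma_{n-1}$. Let $\phi_i:H\to H_i$ be the natural isomorphisms onto the $n$ copies of $H$ and $h_i=\phi_i(h)$. For $k=1,\dots,n-1$ let $\tau_k\in\mathrm{Aut}(G)$ be determined, for all $y\in H$, by $\tau_k(\phi_k(y))=h_k^{-1}\phi_{k+1}(y)h_k$, $\tau_k(\phi_{k+1}(y))=h_k\phi_k(y)h_k^{-1}$, and $\tau_k(\phi_j(y))=\phi_j(y)$ for $j\neq k,k+1$. The Artin type representation associated to $(H,h)$ is the homomorphism $\rho:B_n\to\mathrm{Aut}(G)$ with $\rho(\sigma_k)=\tau_k$. In $G\rtimes_\rho B_n$ one has $\beta g\beta^{-1}=\rho(\beta)(g)$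 for $\beta\in B_n$, $g\in G$; $G$ and $B_n$ are regarded as subgroups. **Garside monoids.** A monoid $M$ is atomic if there is a function (norm) $\nu:M\to\mathbb{N}=\{0,1,2,\dots\}$ with $\nu(a)=0$ if and only if $a=1$, and $\nu(ab)\ge\nu(a)+\nu(b)$ for all $a,b\in M$. On an atomic monoid put $a\le_L b$ if $ac=b$ for some $c\in M$, and $a\le_R b$ if $ca=b$ for some $c\in M$; when $M$ is cancellative and atomic these are partial orders. A Garside monoid is a monoid $M$ such that: (i) $M$ is atomic and finitely generated; (ii) $M$ is (left and right) cancellative; (iii) $(M,\le_L)$ and $(M,\le_R)$ are lattices; (iv) there exists an element $\Delta\in M$, called a Garside element, such that (a) the set $L(\Delta)=\{x\in M: x\le_L\Delta\}$ generates $M$, and (b) $L(\Delta)=R(\Delta)$, where $R(\Delta)=\{x\in M: x\le_R\Delta\}$. Any element $\Delta$ satisfying (a) and (b) is called a Garside element of $M$. **Group of fractions.** For a monoid $M$, its group of fractions $G(M)$ is the group presented by the generating set $M$ and the relations $ab=c$ whenever $ab=c$ in $M$. For a Garside monoid the canonical homomorphism $M\to G(M)$ is injective, and $M$ is regarded as a submonoid of $G(M)$. Saying that $\widetilde G$ is the group of fractions of the submonoid $\widetilde M$ means that the homomorphism $G(\widetilde M)\to\widetilde G$ induced by inclusion is an isomorphism. *)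

theory Defs
  imports "HOL-Algebra.Divisibility" "HOL-Algebra.Bij"
begin

section \<open>Groups given by generators and relations\<close>

text \<open>Words are lists of signed letters: \<open>(True, x)\<close> stands for the generator \<open>x\<close> and
  \<open>(False, x)\<close> for its formal inverse. A relation is a pair of words.\<close>

definition words :: "'g set \<Rightarrow> (bool \<times> 'g) list set"
  where "words S = lists (UNIV \<times> S)"

inductive_set word_cong ::
    "'g set \<Rightarrow> ((bool \<times> 'g) list \<times> (bool \<times> 'g) list) set
      \<Rightarrow> ((bool \<times> 'g) list \<times> (bool \<times> 'g) list) set"
  for S R where
    refl: "w \<in> words S \<Longrightarrow> (w, w) \<in> word_cong S R"
  | sym: "(u, v) \<in> word_cong S R \<Longrightarrow> (v, u) \<in> word_cong S R"
  | trans: "(u, v) \<in> word_cong S R \<Longrightarrow> (v, w) \<in> word_cong S R \<Longrightarrow> (u, w) \<in> word_cong S R"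
  | cancel: "u \<in> words S \<Longrightarrow> v \<in> words S \<Longrightarrow> x \<in> S
      \<Longrightarrow> (u @ [(s, x), (\<not> s, x)] @ v, u @ v) \<in> word_cong S R"
  | rel: "u \<in> words S \<Longrightarrow> v \<in> words S \<Longrightarrow> l \<in> words S \<Longrightarrow> r \<in> words S \<Longrightarrow> (l, r) \<in> R
      \<Longrightarrow> (u @ l @ v, u @ r @ v) \<in> word_cong S R"

definition presented_group ::
    "'g set \<Rightarrow> ((bool \<times> 'g) list \<times> (bool \<times> 'g) list) set \<Rightarrow> (bool \<times> 'g) list set monoid"
  where "presented_group S R =
    \<lparr>carrier = words S // word_cong S R,
     monoid.mult = (\<lambda>A B. (\<Union>u\<in>A. \<Union>v\<in>B. word_cong S R `` {u @ v})),
     one = word_cong S R `` {[]}\<rparr>"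

definition pres_gen ::
    "'g set \<Rightarrow> ((bool \<times> 'g) list \<times> (bool \<times> 'g) list) set \<Rightarrow> 'g \<Rightarrow> (bool \<times> 'g) list set"
  where "pres_gen S R x = word_cong S R `` {[(True, x)]}"

fun word_eval :: "('k, 'm) monoid_scheme \<Rightarrow> ('g \<Rightarrow> 'k) \<Rightarrow> (bool \<times> 'g) list \<Rightarrow> 'k" where
  "word_eval K f [] = \<one>\<^bsub>K\<^esub>"
| "word_eval K f ((s, x) # w) = (if s then f x else inv\<^bsub>K\<^esub> (f x)) \<otimes>\<^bsub>K\<^esub> word_eval K f w"

text \<open>The homomorphism to \<open>K\<close> induced by an assignment \<open>f\<close> of the generators. It is meaningful when
  \<open>f\<close> respects the relations, since then \<open>word_eval K f\<close> is constant on each class; see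
  \<open>pres_lift_hom\<close>, \<open>pres_lift_gen\<close> and \<open>pres_hom_unique\<close> below.\<close>

definition pres_lift ::
    "'g set \<Rightarrow> ((bool \<times> 'g) list \<times> (bool \<times> 'g) list) set \<Rightarrow> ('k, 'm) monoid_scheme
      \<Rightarrow> ('g \<Rightarrow> 'k) \<Rightarrow> (bool \<times> 'g) list set \<Rightarrow> 'k"
  where "pres_lift S R K f =
    (\<lambda>A\<in>carrier (presented_group S R). the_elem (word_eval K f ` A))"


section \<open>Garside monoids and groups of fractions\<close>

inductive_set mgenerate :: "('a, 'b) monoid_scheme \<Rightarrow> 'a set \<Rightarrow> 'a set"
  for G and S where
    one: "\<one>\<^bsub>G\<^esub> \<in> mgenerate G S"
  | incl: "x \<in> S \<Longrightarrow> x \<in> mgenerate G S"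
  | mult: "x \<in> mgenerate G S \<Longrightarrow> y \<in> mgenerate G S \<Longrightarrow> x \<otimes>\<^bsub>G\<^esub> y \<in> mgenerate G S"

definition atomic_monoid :: "('a, 'b) monoid_scheme \<Rightarrow> bool"
  where "atomic_monoid M \<longleftrightarrow> monoid M \<and>
    (\<exists>\<nu> :: 'a \<Rightarrow> nat. (\<forall>a\<in>carrier M. \<nu> a = 0 \<longleftrightarrow> a = \<one>\<^bsub>M\<^esub>) \<and>
      (\<forall>a\<in>carrier M. \<forall>b\<in>carrier M. \<nu> (a \<otimes>\<^bsub>M\<^esub> b) \<ge> \<nu> a + \<nu> b))"

definition finitely_generated_monoid :: "('a, 'b) monoid_scheme \<Rightarrow> bool"
  where "finitely_generated_monoid M \<longleftrightarrow> monoid M \<and>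
    (\<exists>S. finite S \<and> S \<subseteq> carrier M \<and> mgenerate M S = carrier M)"

text \<open>The library relation \<open>a divides\<^bsub>M\<^esub> b\<close> says \<open>b = a \<otimes>\<^bsub>M\<^esub> c\<close> for some \<open>c\<close> also when \<open>M\<close> is not
  commutative, so it is left divisibility.\<close>

definition left_le :: "('a, 'b) monoid_scheme \<Rightarrow> 'a \<Rightarrow> 'a \<Rightarrow> bool"
  where "left_le M a b \<longleftrightarrow> a divides\<^bsub>M\<^esub> b"

definition right_le :: "('a, 'b) monoid_scheme \<Rightarrow> 'a \<Rightarrow> 'a \<Rightarrow> bool"
  where "right_le M a b \<longleftrightarrow> (\<exists>c\<in>carrier M. b = c \<otimes>\<^bsub>M\<^esub> a)"

definition garside_element :: "('a, 'b) monoid_scheme \<Rightarrow> 'a \<Rightarrow> bool"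
  where "garside_element M \<Delta> \<longleftrightarrow> \<Delta> \<in> carrier M \<and>
    mgenerate M {x \<in> carrier M. left_le M x \<Delta>} = carrier M \<and>
    {x \<in> carrier M. left_le M x \<Delta>} = {x \<in> carrier M. right_le M x \<Delta>}"

definition garside_monoid :: "('a, 'b) monoid_scheme \<Rightarrow> bool"
  where "garside_monoid M \<longleftrightarrow>
    atomic_monoid M \<and> finitely_generated_monoid M \<and>
    monoid_cancel M \<and>
    lattice \<lparr>carrier = carrier M, eq = (=), le = left_le M\<rparr> \<and>
    lattice \<lparr>carrier = carrier M, eq = (=), le = right_le M\<rparr> \<and>
    (\<exists>\<Delta>. garside_element M \<Delta>)"

definition frac_rels ::
    "('a, 'b) monoid_scheme \<Rightarrow> ((bool \<times> 'a) list \<times> (bool \<times> 'a) list) set"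
  where "frac_rels M = {([(True, a), (True, b)], [(True, a \<otimes>\<^bsub>M\<^esub> b)]) | a b.
    a \<in> carrier M \<and> b \<in> carrier M}"

definition group_of_fractions :: "('a, 'b) monoid_scheme \<Rightarrow> (bool \<times> 'a) list set monoid"
  where "group_of_fractions M = presented_group (carrier M) (frac_rels M)"

text \<open>\<open>G\<close> is the group of fractions of its submonoid \<open>N\<close>: the homomorphism from the abstract group
  of fractions of \<open>N\<close> to \<open>G\<close> induced by the inclusion is an isomorphism.\<close>

definition is_group_of_fractions_of :: "('a, 'b) monoid_scheme \<Rightarrow> 'a set \<Rightarrow> bool"
  where "is_group_of_fractions_of G N \<longleftrightarrow> group G \<and> submonoid N G \<and>
    pres_lift N (frac_rels (G\<lparr>carrier := N\<rparr>)) G (\<lambda>x. x)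
      \<in> iso (group_of_fractions (G\<lparr>carrier := N\<rparr>)) G"


section \<open>Braid groups\<close>

definition braid_rels :: "nat \<Rightarrow> ((bool \<times> nat) list \<times> (bool \<times> nat) list) set"
  where "braid_rels n =
    {([(True, i), (True, j)], [(True, j), (True, i)]) | i j.
      i \<in> {1..<n} \<and> j \<in> {1..<n} \<and> i + 2 \<le> j} \<union>
    {([(True, i), (True, i + 1), (True, i)], [(True, i + 1), (True, i), (True, i + 1)]) | i.
      i \<in> {1..<n} \<and> i + 1 \<in> {1..<n}}"

definition braid_group :: "nat \<Rightarrow> (bool \<times> nat) list set monoid"
  where "braid_group n = presented_group {1..<n} (braid_rels n)"

definition braid_gen :: "nat \<Rightarrow> nat \<Rightarrow> (bool \<times> nat) list set"
  where "braid_gen n k = pres_gen {1..<n} (braid_rels n) k"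

definition positive_braids :: "nat \<Rightarrow> (bool \<times> nat) list set set"
  where "positive_braids n = mgenerate (braid_group n) (braid_gen n ` {1..<n})"


section \<open>Free products of copies of a group\<close>

text \<open>The free product of copies of \<open>H\<close> indexed by \<open>1, \<dots>, n\<close>: a generator \<open>(i, x)\<close> for each
  \<open>i\<close> and each \<open>x\<close> in \<open>H\<close>, subject to the multiplication table of \<open>H\<close> in each copy.\<close>

definition free_power_gens :: "nat \<Rightarrow> ('a, 'b) monoid_scheme \<Rightarrow> (nat \<times> 'a) set"
  where "free_power_gens n H = {1..n} \<times> carrier H"

definition free_power_rels :: "nat \<Rightarrow> ('a, 'b) monoid_scheme
    \<Rightarrow> ((bool \<times> nat \<times> 'a) list \<times> (bool \<times> nat \<times> 'a) list) set"
  where "free_power_rels n H =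
    {([(True, i, x), (True, i, y)], [(True, i, x \<otimes>\<^bsub>H\<^esub> y)]) | i x y.
      i \<in> {1..n} \<and> x \<in> carrier H \<and> y \<in> carrier H}"

definition free_power :: "nat \<Rightarrow> ('a, 'b) monoid_scheme \<Rightarrow> (bool \<times> nat \<times> 'a) list set monoid"
  where "free_power n H = presented_group (free_power_gens n H) (free_power_rels n H)"

definition free_power_inj :: "nat \<Rightarrow> ('a, 'b) monoid_scheme \<Rightarrow> nat \<Rightarrow> 'a
    \<Rightarrow> (bool \<times> nat \<times> 'a) list set"
  where "free_power_inj n H i x = pres_gen (free_power_gens n H) (free_power_rels n H) (i, x)"


section \<open>Artin type representations\<close>

definition artin_tau :: "nat \<Rightarrow> ('a, 'b) monoid_scheme \<Rightarrow> 'a \<Rightarrow> nat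
    \<Rightarrow> (bool \<times> nat \<times> 'a) list set \<Rightarrow> (bool \<times> nat \<times> 'a) list set"
  where "artin_tau n H h k =
    (let G = free_power n H; \<phi> = free_power_inj n H; hk = \<phi> k h in
      pres_lift (free_power_gens n H) (free_power_rels n H) G
        (\<lambda>(j, y). if j = k then inv\<^bsub>G\<^esub> hk \<otimes>\<^bsub>G\<^esub> \<phi> (k + 1) y \<otimes>\<^bsub>G\<^esub> hk
          else if j = k + 1 then hk \<otimes>\<^bsub>G\<^esub> \<phi> k y \<otimes>\<^bsub>G\<^esub> inv\<^bsub>G\<^esub> hk
          else \<phi> j y))"

definition artin_rep :: "nat \<Rightarrow> ('a, 'b) monoid_scheme \<Rightarrow> 'a \<Rightarrow> (bool \<times> nat) list set
    \<Rightarrow> (bool \<times> nat \<times> 'a) list set \<Rightarrow> (bool \<times> nat \<times> 'a) list set"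
  where "artin_rep n H h =
    pres_lift {1..<n} (braid_rels n) (AutoGroup (free_power n H)) (artin_tau n H h)"


section \<open>The semidirect product and its submonoid\<close>

definition semidirect_product :: "('g, 'c) monoid_scheme \<Rightarrow> ('b, 'd) monoid_scheme
    \<Rightarrow> ('b \<Rightarrow> 'g \<Rightarrow> 'g) \<Rightarrow> ('g \<times> 'b) monoid"
  where "semidirect_product G B \<rho> =
    \<lparr>carrier = carrier G \<times> carrier B,
     monoid.mult = (\<lambda>(g, b) (g', b'). (g \<otimes>\<^bsub>G\<^esub> \<rho> b g', b \<otimes>\<^bsub>B\<^esub> b')),
     one = (\<one>\<^bsub>G\<^esub>, \<one>\<^bsub>B\<^esub>)\<rparr>"

type_synonym 'a artin_elt = "(bool \<times> nat \<times> 'a) list set \<times> (bool \<times> nat) list set"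

definition artin_group :: "nat \<Rightarrow> ('a, 'b) monoid_scheme \<Rightarrow> 'a \<Rightarrow> 'a artin_elt monoid"
  where "artin_group n H h =
    semidirect_product (free_power n H) (braid_group n) (artin_rep n H h)"

definition of_free :: "nat \<Rightarrow> (bool \<times> nat \<times> 'a) list set \<Rightarrow> 'a artin_elt"
  where "of_free n g = (g, \<one>\<^bsub>braid_group n\<^esub>)"

definition of_braid :: "nat \<Rightarrow> ('a, 'b) monoid_scheme \<Rightarrow> (bool \<times> nat) list set \<Rightarrow> 'a artin_elt"
  where "of_braid n H b = (\<one>\<^bsub>free_power n H\<^esub>, b)"

definition artin_submonoid ::
    "nat \<Rightarrow> ('a, 'b) monoid_scheme \<Rightarrow> 'a \<Rightarrow> 'a set \<Rightarrow> 'a artin_elt set"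
  where "artin_submonoid n H h M = mgenerate (artin_group n H h)
    (of_free n ` free_power_inj n H 1 ` M \<union> of_braid n H ` positive_braids n)"

definition artin_Delta :: "nat \<Rightarrow> ('a, 'b) monoid_scheme \<Rightarrow> 'a \<Rightarrow> 'a artin_elt"
  where "artin_Delta n H h =
    (of_free n (free_power_inj n H 1 h) \<otimes>\<^bsub>artin_group n H h\<^esub>
      foldr (\<lambda>k x. of_braid n H (braid_gen n k) \<otimes>\<^bsub>artin_group n H h\<^esub> x) [1..<n]
        \<one>\<^bsub>artin_group n H h\<^esub>) [^]\<^bsub>artin_group n H h\<^esub> n"

section \<open>Consistency of the definitions\<close>

text \<open>Presented groups are groups with the expected universal property; \<open>artin_rep\<close> is a
  homomorphism into the automorphism group of the free product, sends the standard generators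
  to \<open>artin_tau\<close>, and \<open>artin_tau\<close> has the prescribed values on the free factors.\<close>

lemma words_simps [simp]:
  "[] \<in> words S" "((s, x) # w) \<in> words S \<longleftrightarrow> x \<in> S \<and> w \<in> words S"
  "u @ v \<in> words S \<longleftrightarrow> u \<in> words S \<and> v \<in> words S"
  by (auto simp: words_def)

lemma word_cong_in_words: "(u, v) \<in> word_cong S R \<Longrightarrow> u \<in> words S \<and> v \<in> words S"
  by (induction rule: word_cong.induct) auto

lemma equiv_word_cong: "equiv (words S) (word_cong S R)"
proof (rule equivI)
  show "refl_on (words S) (word_cong S R)"
    by (auto intro!: refl_onI word_cong.refl)
  show "word_cong S R \<subseteq> words S \<times> words S" using word_cong_in_words by fastforce
  show "Relation.sym (word_cong S R)" by (auto intro!: symI word_cong.sym)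
  show "Relation.trans (word_cong S R)" by (auto intro!: transI intro: word_cong.trans)
qed

lemma word_cong_context:
  assumes "(u, v) \<in> word_cong S R" "p \<in> words S" "q \<in> words S"
  shows "(p @ u @ q, p @ v @ q) \<in> word_cong S R"
  using assms
proof (induction arbitrary: p q rule: word_cong.induct)
  case (cancel u v x s)
  then show ?case using word_cong.cancel[of "p @ u" S "v @ q" x s R] by simp
next
  case (rel u v l r)
  then show ?case using word_cong.rel[of "p @ u" S "v @ q" l r R] by simp
next
  case (trans u v w)
  then show ?case by (meson word_cong.trans)
qed (auto intro: word_cong.refl word_cong.sym)

lemma word_cong_append:
  assumes "(u, u') \<in> word_cong S R" "(v, v') \<in> word_cong S R"
  shows "(u @ v, u' @ v') \<in> word_cong S R"
  using word_cong_context[OF assms(1), of "[]" v] word_cong_context[OF assms(2), of u' "[]"]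
    word_cong_in_words[OF assms(1)] word_cong_in_words[OF assms(2)]
  by (auto intro: word_cong.trans)

abbreviation word_class :: "'g set \<Rightarrow> ((bool \<times> 'g) list \<times> (bool \<times> 'g) list) set
    \<Rightarrow> (bool \<times> 'g) list \<Rightarrow> (bool \<times> 'g) list set"
  where "word_class S R w \<equiv> word_cong S R `` {w}"

lemma presented_group_one: "\<one>\<^bsub>presented_group S R\<^esub> = word_class S R []"
  by (simp add: presented_group_def)

lemma presented_group_carrier:
  "a \<in> carrier (presented_group S R) \<longleftrightarrow> (\<exists>w\<in>words S. a = word_class S R w)"
  by (auto simp: presented_group_def quotient_def)

lemma presented_group_mult:
  assumes "u \<in> words S" "v \<in> words S"
  shows "word_class S R u \<otimes>\<^bsub>presented_group S R\<^esub> word_class S R v = word_class S R (u @ v)"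
proof -
  have "(\<lambda>u v. word_class S R (u @ v)) respects2 (word_cong S R)"
    by (rule congruent2I') (meson equiv_word_cong equiv_class_eq_iff word_cong_append)
  then show ?thesis
    using assms by (simp add: presented_group_def UN_equiv_class2[OF equiv_word_cong equiv_word_cong])
qed

definition word_inv :: "(bool \<times> 'g) list \<Rightarrow> (bool \<times> 'g) list"
  where "word_inv w = rev (map (\<lambda>(s, x). (\<not> s, x)) w)"

lemma word_inv_simps [simp]:
  "word_inv [] = []" "word_inv ((s, x) # w) = word_inv w @ [(\<not> s, x)]"
  by (auto simp: word_inv_def)

lemma word_inv_in_words: "w \<in> words S \<Longrightarrow> word_inv w \<in> words S"
  by (induction w) auto

lemma word_inv_cong: "w \<in> words S \<Longrightarrow> (word_inv w @ w, []) \<in> word_cong S R"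
proof (induction w)
  case Nil then show ?case by (simp add: word_cong.refl)
next
  case (Cons a w)
  obtain s x where a: "a = (s, x)" by fastforce
  have "(word_inv w @ [(\<not> s, x), (\<not> \<not> s, x)] @ w, word_inv w @ w) \<in> word_cong S R"
    using Cons a by (intro word_cong.cancel) (auto simp: word_inv_in_words)
  with Cons a show ?case by (auto intro: word_cong.trans)
qed

lemma group_presented_group: "group (presented_group S R)"
proof (rule groupI)
  show "\<one>\<^bsub>presented_group S R\<^esub> \<in> carrier (presented_group S R)"
    by (auto simp: presented_group_carrier presented_group_one intro!: bexI[of _ "[]"])
next
  fix a assume a: "a \<in> carrier (presented_group S R)"
  then obtain w where w: "w \<in> words S" "a = word_class S R w" by (auto simp: presented_group_carrier)
  have eq: "word_class S R (word_inv w) \<otimes>\<^bsub>presented_group S R\<^esub> a = \<one>\<^bsub>presented_group S R\<^esub>"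
    using w word_inv_cong[OF w(1)]
    by (simp add: presented_group_mult word_inv_in_words presented_group_one
        equiv_class_eq[OF equiv_word_cong])
  show "\<exists>b\<in>carrier (presented_group S R). b \<otimes>\<^bsub>presented_group S R\<^esub> a = \<one>\<^bsub>presented_group S R\<^esub>"
    using eq w(1) by (intro bexI[of _ "word_class S R (word_inv w)"])
      (auto simp: presented_group_carrier intro!: word_inv_in_words)
qed (fastforce simp: presented_group_carrier presented_group_mult presented_group_one)+

lemma pres_gen_closed: "x \<in> S \<Longrightarrow> pres_gen S R x \<in> carrier (presented_group S R)"
  by (auto simp: pres_gen_def presented_group_carrier intro!: bexI[of _ "[(True, x)]"])

lemma pres_gen_relation:
  assumes "(l, r) \<in> R" "l \<in> words S" "r \<in> words S"
  shows "word_class S R l = word_class S R r"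
  using word_cong.rel[of "[]" S "[]" l r R] assms
  by (intro equiv_class_eq[OF equiv_word_cong]) auto

lemma word_eval_closed:
  assumes "group K" "f \<in> S \<rightarrow> carrier K" "w \<in> words S"
  shows "word_eval K f w \<in> carrier K"
proof -
  interpret K: group K by fact
  show ?thesis using assms(2,3) by (induction w) (auto simp: Pi_iff)
qed

lemma word_eval_append:
  assumes "group K" "f \<in> S \<rightarrow> carrier K" "u \<in> words S" "v \<in> words S"
  shows "word_eval K f (u @ v) = word_eval K f u \<otimes>\<^bsub>K\<^esub> word_eval K f v"
proof -
  interpret K: group K by fact
  show ?thesis using assms(2-)
  proof (induction u)
    case (Cons a u)
    obtain s x where "a = (s, x)" by fastforce
    then show ?case
      using Cons word_eval_closed[OF assms(1,2)] by (auto simp: K.m_assoc Pi_iff)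
  qed (simp add: word_eval_closed[OF assms(1)])
qed

definition respects_rels ::
    "'g set \<Rightarrow> ((bool \<times> 'g) list \<times> (bool \<times> 'g) list) set \<Rightarrow> ('k, 'm) monoid_scheme
      \<Rightarrow> ('g \<Rightarrow> 'k) \<Rightarrow> bool"
  where "respects_rels S R K f \<longleftrightarrow> f \<in> S \<rightarrow> carrier K \<and>
    (\<forall>(l, r)\<in>R. l \<in> words S \<longrightarrow> r \<in> words S \<longrightarrow> word_eval K f l = word_eval K f r)"

lemma word_eval_cong:
  assumes "group K" "respects_rels S R K f" "(u, v) \<in> word_cong S R"
  shows "word_eval K f u = word_eval K f v"
proof -
  interpret K: group K by fact
  have f: "f \<in> S \<rightarrow> carrier K" using assms by (auto simp: respects_rels_def)
  show ?thesis using assms(3)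
  proof (induction rule: word_cong.induct)
    case (cancel u v x s)
    have "f x \<in> carrier K" using f cancel by auto
    then have "word_eval K f [(s, x), (\<not> s, x)] = \<one>\<^bsub>K\<^esub>" by auto
    moreover have "[(s, x), (\<not> s, x)] \<in> words S" using cancel by simp
    ultimately show ?case
      using cancel by (simp add: word_eval_append[OF assms(1) f] word_eval_closed[OF assms(1) f]
          del: word_eval.simps append_Cons)
  next
    case (rel u v l r)
    have "word_eval K f l = word_eval K f r" using assms(2) rel by (auto simp: respects_rels_def)
    with rel show ?case by (simp add: word_eval_append[OF assms(1) f])
  qed auto
qed

lemma pres_lift_class:
  assumes "group K" "respects_rels S R K f" "w \<in> words S"
  shows "pres_lift S R K f (word_class S R w) = word_eval K f w"
proof -
  have "word_eval K f v = word_eval K f w" if "v \<in> word_class S R w" for v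
    using word_eval_cong[OF assms(1,2), of w v] that by simp
  moreover have "w \<in> word_class S R w" using word_cong.refl[OF assms(3), of R] by simp
  ultimately have "word_eval K f ` word_class S R w = {word_eval K f w}" by blast
  moreover have "word_class S R w \<in> carrier (presented_group S R)"
    using assms(3) by (auto simp: presented_group_carrier)
  ultimately show ?thesis by (simp add: pres_lift_def)
qed

lemma pres_lift_hom:
  assumes "group K" "respects_rels S R K f"
  shows "pres_lift S R K f \<in> hom (presented_group S R) K"
proof -
  have f: "f \<in> S \<rightarrow> carrier K" using assms by (auto simp: respects_rels_def)
  show ?thesis
    by (rule homI) (auto simp: presented_group_carrier presented_group_mult
        pres_lift_class[OF assms] word_eval_closed[OF assms(1) f] word_eval_append[OF assms(1) f])
qed

lemma pres_lift_gen:
  assumes "group K" "respects_rels S R K f" "x \<in> S"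
  shows "pres_lift S R K f (pres_gen S R x) = f x"
proof -
  interpret K: group K by fact
  have "f x \<in> carrier K" using assms by (auto simp: respects_rels_def)
  then show ?thesis using assms(3) by (simp add: pres_gen_def pres_lift_class[OF assms(1,2)])
qed

lemma word_class_eval:
  assumes "w \<in> words S"
  shows "word_class S R w = word_eval (presented_group S R) (pres_gen S R) w"
  using assms
proof (induction w)
  case Nil then show ?case by (simp add: presented_group_one)
next
  case (Cons a w)
  interpret P: group "presented_group S R" by (rule group_presented_group)
  obtain s x where a: "a = (s, x)" by fastforce
  have x: "x \<in> S" "w \<in> words S" using Cons a by auto
  have "word_class S R [(False, x)] \<otimes>\<^bsub>presented_group S R\<^esub> pres_gen S R x = \<one>\<^bsub>presented_group S R\<^esub>"
    using x word_cong.cancel[of "[]" S "[]" x False R]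
    by (simp add: pres_gen_def presented_group_mult presented_group_one
        equiv_class_eq[OF equiv_word_cong])
  then have "inv\<^bsub>presented_group S R\<^esub> (pres_gen S R x) = word_class S R [(False, x)]"
    using x by (intro P.inv_equality pres_gen_closed)
      (auto simp: presented_group_carrier intro!: bexI[of _ "[(False, x)]"])
  then have "(if s then pres_gen S R x else inv\<^bsub>presented_group S R\<^esub> (pres_gen S R x))
      = word_class S R [(s, x)]" by (auto simp: pres_gen_def)
  then show ?case using Cons x a by (simp flip: Cons.IH add: presented_group_mult)
qed

lemma hom_word_eval:
  assumes "group K" "group L" "F \<in> hom K L" "f \<in> S \<rightarrow> carrier K" "w \<in> words S"
  shows "F (word_eval K f w) = word_eval L (\<lambda>x. F (f x)) w"
proof -
  interpret F: group_hom K L F using assms by (simp add: group_hom_def group_hom_axioms_def)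
  show ?thesis using assms(4,5)
    by (induction w) (auto simp: Pi_iff word_eval_closed[OF assms(1,4)])
qed

lemma pres_hom_unique:
  assumes "group K" "F \<in> hom (presented_group S R) K" "F' \<in> hom (presented_group S R) K"
    "\<And>x. x \<in> S \<Longrightarrow> F (pres_gen S R x) = F' (pres_gen S R x)"
    "a \<in> carrier (presented_group S R)"
  shows "F a = F' a"
proof -
  obtain w where w: "w \<in> words S" "a = word_class S R w" using assms by (auto simp: presented_group_carrier)
  have g: "pres_gen S R \<in> S \<rightarrow> carrier (presented_group S R)" by (auto simp: pres_gen_closed)
  have "word_eval K (\<lambda>x. F (pres_gen S R x)) w = word_eval K (\<lambda>x. F' (pres_gen S R x)) w"
    using w(1) assms(4) by (induction w) auto
  then show ?thesis using w
    by (simp add: word_class_eval hom_word_eval[OF group_presented_group assms(1) _ g] assms(2,3))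
qed

lemma group_braid_group: "group (braid_group n)"
  by (simp add: braid_group_def group_presented_group)

lemma group_free_power: "group (free_power n H)"
  by (simp add: free_power_def group_presented_group)

lemma free_power_inj_closed:
  "i \<in> {1..n} \<Longrightarrow> x \<in> carrier H \<Longrightarrow> free_power_inj n H i x \<in> carrier (free_power n H)"
  by (simp add: free_power_inj_def free_power_def pres_gen_closed free_power_gens_def)

lemma free_power_inj_mult:
  assumes "group H" "i \<in> {1..n}" "x \<in> carrier H" "y \<in> carrier H"
  shows "free_power_inj n H i (x \<otimes>\<^bsub>H\<^esub> y) =
    free_power_inj n H i x \<otimes>\<^bsub>free_power n H\<^esub> free_power_inj n H i y"
proof -
  interpret H: group H by fact
  let ?S = "free_power_gens n H" and ?R = "free_power_rels n H"
  have "word_class ?S ?R [(True, i, x), (True, i, y)] = word_class ?S ?R [(True, i, x \<otimes>\<^bsub>H\<^esub> y)]"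
    using assms by (intro pres_gen_relation) (auto simp: free_power_rels_def free_power_gens_def)
  then show ?thesis using assms
    by (simp add: free_power_inj_def pres_gen_def free_power_def presented_group_mult free_power_gens_def)
qed

lemma free_power_inj_hom:
  "group H \<Longrightarrow> i \<in> {1..n} \<Longrightarrow> free_power_inj n H i \<in> hom H (free_power n H)"
  by (auto intro!: homI simp: free_power_inj_closed free_power_inj_mult)

lemma respects_free_power_rels:
  assumes "group K" "\<And>i. i \<in> {1..n} \<Longrightarrow> (\<lambda>x. f (i, x)) \<in> hom H K"
  shows "respects_rels (free_power_gens n H) (free_power_rels n H) K f"
proof -
  interpret K: group K by fact
  have "f (i, x) \<in> carrier K" if "i \<in> {1..n}" "x \<in> carrier H" for i x
    using assms(2)[OF that(1)] that(2) by (auto simp: hom_def)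
  moreover have "f (i, x \<otimes>\<^bsub>H\<^esub> y) = f (i, x) \<otimes>\<^bsub>K\<^esub> f (i, y)"
    if "i \<in> {1..n}" "x \<in> carrier H" "y \<in> carrier H" for i x y
    using assms(2)[OF that(1)] that(2-) by (auto simp: hom_def)
  ultimately show ?thesis
    by (auto simp: respects_rels_def free_power_gens_def free_power_rels_def)
qed

lemma free_power_hom_unique:
  assumes "group K" "F \<in> hom (free_power n H) K" "F' \<in> hom (free_power n H) K"
    "\<And>i x. i \<in> {1..n} \<Longrightarrow> x \<in> carrier H \<Longrightarrow>
      F (free_power_inj n H i x) = F' (free_power_inj n H i x)"
    "a \<in> carrier (free_power n H)"
  shows "F a = F' a"
proof (rule pres_hom_unique[OF assms(1)])
  show "F \<in> hom (presented_group (free_power_gens n H) (free_power_rels n H)) K"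
    "F' \<in> hom (presented_group (free_power_gens n H) (free_power_rels n H)) K"
    "a \<in> carrier (presented_group (free_power_gens n H) (free_power_rels n H))"
    using assms(2,3,5) by (simp_all add: free_power_def)
  fix p assume "p \<in> free_power_gens n H"
  then show "F (pres_gen (free_power_gens n H) (free_power_rels n H) p) =
      F' (pres_gen (free_power_gens n H) (free_power_rels n H) p)"
    using assms(4) by (auto simp: free_power_inj_def free_power_gens_def)
qed

lemma conj_hom:
  assumes "group K" "f \<in> hom H K" "c \<in> carrier K"
  shows "(\<lambda>x. inv\<^bsub>K\<^esub> c \<otimes>\<^bsub>K\<^esub> f x \<otimes>\<^bsub>K\<^esub> c) \<in> hom H K"
    and "(\<lambda>x. c \<otimes>\<^bsub>K\<^esub> f x \<otimes>\<^bsub>K\<^esub> inv\<^bsub>K\<^esub> c) \<in> hom H K"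
proof -
  interpret K: group K by fact
  have f: "f x \<in> carrier K" if "x \<in> carrier H" for x using assms(2) that by (auto simp: hom_def)
  have [simp]: "c \<otimes>\<^bsub>K\<^esub> (inv\<^bsub>K\<^esub> c \<otimes>\<^bsub>K\<^esub> x) = x" "inv\<^bsub>K\<^esub> c \<otimes>\<^bsub>K\<^esub> (c \<otimes>\<^bsub>K\<^esub> x) = x"
    if "x \<in> carrier K" for x using assms(3) that by (simp_all flip: K.m_assoc)
  show "(\<lambda>x. inv\<^bsub>K\<^esub> c \<otimes>\<^bsub>K\<^esub> f x \<otimes>\<^bsub>K\<^esub> c) \<in> hom H K"
    and "(\<lambda>x. c \<otimes>\<^bsub>K\<^esub> f x \<otimes>\<^bsub>K\<^esub> inv\<^bsub>K\<^esub> c) \<in> hom H K"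
    using assms(2,3) f by (auto intro!: homI simp: K.m_assoc hom_mult)
qed

context
  fixes n :: nat and H :: "('a, 'b) monoid_scheme" and h :: 'a
  assumes H: "group H" and h: "h \<in> carrier H"
begin

private abbreviation "GG \<equiv> free_power n H"
private abbreviation "pp \<equiv> free_power_inj n H"

interpretation H: group H by (rule H)
interpretation G: group GG by (rule group_free_power)

lemmas pp_simps = free_power_inj_closed free_power_inj_mult[OF H]

lemma pp_inv: "i \<in> {1..n} \<Longrightarrow> x \<in> carrier H \<Longrightarrow> pp i (inv\<^bsub>H\<^esub> x) = inv\<^bsub>GG\<^esub> (pp i x)"
  using free_power_inj_hom[OF H, of i n] H G.is_group
  by (intro group_hom.hom_inv) (auto simp: group_hom_def group_hom_axioms_def)

lemma respects_artin_tau: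
  assumes "k \<in> {1..<n}"
  shows "respects_rels (free_power_gens n H) (free_power_rels n H) GG
    (\<lambda>(j, y). if j = k then inv\<^bsub>GG\<^esub> (pp k h) \<otimes>\<^bsub>GG\<^esub> pp (k + 1) y \<otimes>\<^bsub>GG\<^esub> pp k h
          else if j = k + 1 then pp k h \<otimes>\<^bsub>GG\<^esub> pp k y \<otimes>\<^bsub>GG\<^esub> inv\<^bsub>GG\<^esub> (pp k h)
          else pp j y)"
proof (rule respects_free_power_rels[OF G.is_group])
  fix i assume i: "i \<in> {1..n}"
  have k: "k \<in> {1..n}" "Suc k \<in> {1..n}" using assms by auto
  show "(\<lambda>y. case (i, y) of (j, y) \<Rightarrow>
      if j = k then inv\<^bsub>GG\<^esub> (pp k h) \<otimes>\<^bsub>GG\<^esub> pp (k + 1) y \<otimes>\<^bsub>GG\<^esub> pp k h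
          else if j = k + 1 then pp k h \<otimes>\<^bsub>GG\<^esub> pp k y \<otimes>\<^bsub>GG\<^esub> inv\<^bsub>GG\<^esub> (pp k h)
          else pp j y) \<in> hom H GG"
    using conj_hom[OF G.is_group free_power_inj_hom[OF H k(2)] free_power_inj_closed[OF k(1) h]]
      conj_hom[OF G.is_group free_power_inj_hom[OF H k(1)] free_power_inj_closed[OF k(1) h]]
      free_power_inj_hom[OF H i]
    by (cases "i = k"; cases "i = k + 1") simp_all
qed

lemma artin_tau_hom: "k \<in> {1..<n} \<Longrightarrow> artin_tau n H h k \<in> hom GG GG"
  using pres_lift_hom[OF G.is_group respects_artin_tau, folded free_power_def]
  by (simp add: artin_tau_def Let_def)

lemma artin_tau_gen:
  assumes "k \<in> {1..<n}" "j \<in> {1..n}" "y \<in> carrier H"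
  shows "artin_tau n H h k (pp j y) =
    (if j = k then inv\<^bsub>GG\<^esub> (pp k h) \<otimes>\<^bsub>GG\<^esub> pp (k + 1) y \<otimes>\<^bsub>GG\<^esub> pp k h
     else if j = k + 1 then pp k h \<otimes>\<^bsub>GG\<^esub> pp k y \<otimes>\<^bsub>GG\<^esub> inv\<^bsub>GG\<^esub> (pp k h)
     else pp j y)"
proof -
  have "(j, y) \<in> free_power_gens n H" using assms by (simp add: free_power_gens_def)
  from pres_lift_gen[OF G.is_group respects_artin_tau[OF assms(1)] this] show ?thesis
    unfolding artin_tau_def Let_def free_power_inj_def by simp
qed

lemma G_cancel:
  "x \<in> carrier GG \<Longrightarrow> y \<in> carrier GG \<Longrightarrow> x \<otimes>\<^bsub>GG\<^esub> (inv\<^bsub>GG\<^esub> x \<otimes>\<^bsub>GG\<^esub> y) = y"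
  "x \<in> carrier GG \<Longrightarrow> y \<in> carrier GG \<Longrightarrow> inv\<^bsub>GG\<^esub> x \<otimes>\<^bsub>GG\<^esub> (x \<otimes>\<^bsub>GG\<^esub> y) = y"
  by (simp_all flip: G.m_assoc)

lemma tau_simps:
  assumes "k \<in> {1..<n}"
  shows "x \<in> carrier GG \<Longrightarrow> artin_tau n H h k x \<in> carrier GG"
    "x \<in> carrier GG \<Longrightarrow> y \<in> carrier GG \<Longrightarrow>
      artin_tau n H h k (x \<otimes>\<^bsub>GG\<^esub> y) = artin_tau n H h k x \<otimes>\<^bsub>GG\<^esub> artin_tau n H h k y"
    "x \<in> carrier GG \<Longrightarrow> artin_tau n H h k (inv\<^bsub>GG\<^esub> x) = inv\<^bsub>GG\<^esub> (artin_tau n H h k x)"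
proof -
  interpret t: group_hom GG GG "artin_tau n H h k"
    using artin_tau_hom[OF assms] G.is_group by (simp add: group_hom_def group_hom_axioms_def)
  show "x \<in> carrier GG \<Longrightarrow> artin_tau n H h k x \<in> carrier GG"
    "x \<in> carrier GG \<Longrightarrow> y \<in> carrier GG \<Longrightarrow>
      artin_tau n H h k (x \<otimes>\<^bsub>GG\<^esub> y) = artin_tau n H h k x \<otimes>\<^bsub>GG\<^esub> artin_tau n H h k y"
    "x \<in> carrier GG \<Longrightarrow> artin_tau n H h k (inv\<^bsub>GG\<^esub> x) = inv\<^bsub>GG\<^esub> (artin_tau n H h k x)"
    by simp_all
qed

lemma artin_tau_bij:
  assumes k: "k \<in> {1..<n}"
  shows "bij_betw (artin_tau n H h k) (carrier GG) (carrier GG)"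
proof -
  let ?t = "artin_tau n H h k" and ?c = "pp (k + 1) h"
  define f where "f = (\<lambda>(j, y). if j = k + 1 then ?c \<otimes>\<^bsub>GG\<^esub> pp k y \<otimes>\<^bsub>GG\<^esub> inv\<^bsub>GG\<^esub> ?c
    else if j = k then inv\<^bsub>GG\<^esub> ?c \<otimes>\<^bsub>GG\<^esub> pp (k + 1) y \<otimes>\<^bsub>GG\<^esub> ?c else pp j y)"
  define t' where "t' = pres_lift (free_power_gens n H) (free_power_rels n H) GG f"
  have k': "k \<in> {1..n}" "Suc k \<in> {1..n}" using k by auto
  have res: "respects_rels (free_power_gens n H) (free_power_rels n H) GG f"
  proof (rule respects_free_power_rels[OF G.is_group])
    fix i assume i: "i \<in> {1..n}"
    show "(\<lambda>y. f (i, y)) \<in> hom H GG"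
      using conj_hom[OF G.is_group free_power_inj_hom[OF H k'(2)] free_power_inj_closed[OF k'(2) h]]
        conj_hom[OF G.is_group free_power_inj_hom[OF H k'(1)] free_power_inj_closed[OF k'(2) h]]
        free_power_inj_hom[OF H i]
      by (cases "i = k"; cases "i = k + 1") (simp_all add: f_def)
  qed
  have hom': "t' \<in> hom GG GG"
    using pres_lift_hom[OF G.is_group res] by (simp add: t'_def free_power_def)
  have gen': "t' (pp j y) = f (j, y)" if "j \<in> {1..n}" "y \<in> carrier H" for j y
    using pres_lift_gen[OF G.is_group res, of "(j, y)"] that
    by (simp add: t'_def free_power_inj_def free_power_gens_def)
  interpret t: group_hom GG GG ?t
    using artin_tau_hom[OF k] G.is_group by (simp add: group_hom_def group_hom_axioms_def)
  interpret t': group_hom GG GG t'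
    using hom' G.is_group by (simp add: group_hom_def group_hom_axioms_def)
  note s = artin_tau_gen[OF k] gen' f_def free_power_inj_closed G.m_assoc G_cancel
    G.inv_mult_group h
  have 1: "t' (?t x) = x" if "x \<in> carrier GG" for x
  proof -
    have "(t' \<circ> ?t) x = id x"
    proof (rule free_power_hom_unique[OF G.is_group _ _ _ that])
      show "t' \<circ> ?t \<in> hom GG GG" by (auto intro!: homI)
      show "id \<in> hom GG GG" by (auto intro!: homI)
      fix i x assume ix: "i \<in> {1..n}" "x \<in> carrier H"
      consider "i = k" | "i = Suc k" | "i \<noteq> k" "i \<noteq> Suc k" by blast
      then show "(t' \<circ> ?t) (pp i x) = id (pp i x)"
        using ix k' by cases (simp_all add: s del: atLeastAtMost_iff)
    qed
    then show ?thesis by simp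
  qed
  have 2: "?t (t' x) = x" if "x \<in> carrier GG" for x
  proof -
    have "(?t \<circ> t') x = id x"
    proof (rule free_power_hom_unique[OF G.is_group _ _ _ that])
      show "?t \<circ> t' \<in> hom GG GG" by (auto intro!: homI)
      show "id \<in> hom GG GG" by (auto intro!: homI)
      fix i x assume ix: "i \<in> {1..n}" "x \<in> carrier H"
      consider "i = k" | "i = Suc k" | "i \<noteq> k" "i \<noteq> Suc k" by blast
      then show "(?t \<circ> t') (pp i x) = id (pp i x)"
        using ix k' by cases (simp_all add: s del: atLeastAtMost_iff)
    qed
    then show ?thesis by simp
  qed
  show ?thesis
  proof (rule bij_betwI[where g = t'])
    show "?t \<in> carrier GG \<rightarrow> carrier GG" "t' \<in> carrier GG \<rightarrow> carrier GG" by auto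
  qed (rule 1 2, assumption)+
qed

lemma artin_tau_auto:
  assumes "k \<in> {1..<n}"
  shows "artin_tau n H h k \<in> auto GG"
proof -
  have "artin_tau n H h k \<in> extensional (carrier GG)"
    unfolding artin_tau_def Let_def pres_lift_def free_power_def by (rule restrict_extensional)
  then show ?thesis
    using artin_tau_hom[OF assms] artin_tau_bij[OF assms] by (simp add: auto_def Bij_def)
qed

lemma group_AutoGroup_free_power: "group (AutoGroup GG)"
  by (rule G.AutoGroup)

lemma AutoGroup_mult:
  assumes "f \<in> auto GG" "g \<in> auto GG"
  shows "f \<otimes>\<^bsub>AutoGroup GG\<^esub> g = compose (carrier GG) f g"
  using assms by (auto simp: AutoGroup_def BijGroup_def auto_def)

lemma auto_eqI:
  assumes "f \<in> auto GG" "g \<in> auto GG"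
    "\<And>i x. i \<in> {1..n} \<Longrightarrow> x \<in> carrier H \<Longrightarrow> f (pp i x) = g (pp i x)"
  shows "f = g"
proof (rule extensionalityI)
  show "f \<in> extensional (carrier GG)" "g \<in> extensional (carrier GG)"
    using assms by (auto simp: auto_def Bij_def)
  fix x assume x: "x \<in> carrier GG"
  have "f \<in> hom GG GG" "g \<in> hom GG GG" using assms(1,2) by (simp_all add: auto_def)
  from free_power_hom_unique[OF G.is_group this assms(3) x] show "f x = g x" by simp
qed

lemma respects_braid_rels:
  "respects_rels {1..<n} (braid_rels n) (AutoGroup GG) (artin_tau n H h)"
proof -
  let ?A = "AutoGroup GG" and ?t = "artin_tau n H h"
  interpret A: group ?A by (rule group_AutoGroup_free_power)
  have car: "carrier ?A = auto GG" by (simp add: AutoGroup_def)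
  have tc: "?t k \<in> carrier ?A" if "k \<in> {1..<n}" for k
    using artin_tau_auto[OF that] by (simp add: car)
  have m: "(f \<otimes>\<^bsub>?A\<^esub> g) x = f (g x)"
    if "f \<in> carrier ?A" "g \<in> carrier ?A" "x \<in> carrier GG" for f g x
    using AutoGroup_mult that by (simp add: car compose_def)
  note s = m A.m_closed tc artin_tau_gen tau_simps free_power_inj_closed
    G.m_assoc G_cancel G.inv_mult_group h
  have far: "?t i \<otimes>\<^bsub>?A\<^esub> ?t j = ?t j \<otimes>\<^bsub>?A\<^esub> ?t i"
    if "i \<in> {1..<n}" "j \<in> {1..<n}" "i + 2 \<le> j" for i j
  proof (rule auto_eqI)
    show "?t i \<otimes>\<^bsub>?A\<^esub> ?t j \<in> auto GG" "?t j \<otimes>\<^bsub>?A\<^esub> ?t i \<in> auto GG"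
      using A.m_closed tc that by (auto simp: car)
    fix l x assume lx: "l \<in> {1..n}" "x \<in> carrier H"
    have ij: "i \<in> {1..n}" "Suc i \<in> {1..n}" "j \<in> {1..n}" "Suc j \<in> {1..n}"
      "j \<noteq> i" "j \<noteq> Suc i" "i \<noteq> j" "i \<noteq> Suc j" using that by auto
    consider "l = i" | "l = Suc i" | "l = j" | "l = Suc j"
      | "l \<noteq> i" "l \<noteq> Suc i" "l \<noteq> j" "l \<noteq> Suc j" by blast
    then show "(?t i \<otimes>\<^bsub>?A\<^esub> ?t j) (pp l x) = (?t j \<otimes>\<^bsub>?A\<^esub> ?t i) (pp l x)"
      using that(1,2) lx ij by cases (simp_all add: s del: atLeastAtMost_iff atLeastLessThan_iff)
  qed
  have near: "?t i \<otimes>\<^bsub>?A\<^esub> (?t (i + 1) \<otimes>\<^bsub>?A\<^esub> ?t i) = ?t (i + 1) \<otimes>\<^bsub>?A\<^esub> (?t i \<otimes>\<^bsub>?A\<^esub> ?t (i + 1))"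
    if "i \<in> {1..<n}" "i + 1 \<in> {1..<n}" for i
  proof (rule auto_eqI)
    show "?t i \<otimes>\<^bsub>?A\<^esub> (?t (i + 1) \<otimes>\<^bsub>?A\<^esub> ?t i) \<in> auto GG"
      "?t (i + 1) \<otimes>\<^bsub>?A\<^esub> (?t i \<otimes>\<^bsub>?A\<^esub> ?t (i + 1)) \<in> auto GG"
      using A.m_closed tc that by (auto simp: car)
    fix l x assume lx: "l \<in> {1..n}" "x \<in> carrier H"
    have i: "i \<in> {1..n}" "Suc i \<in> {1..n}" "Suc (Suc i) \<in> {1..n}" "Suc i \<in> {1..<n}"
      using that by auto
    consider "l = i" | "l = Suc i" | "l = Suc (Suc i)"
      | "l \<noteq> i" "l \<noteq> Suc i" "l \<noteq> Suc (Suc i)" by blast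
    then show "(?t i \<otimes>\<^bsub>?A\<^esub> (?t (i + 1) \<otimes>\<^bsub>?A\<^esub> ?t i)) (pp l x) =
        (?t (i + 1) \<otimes>\<^bsub>?A\<^esub> (?t i \<otimes>\<^bsub>?A\<^esub> ?t (i + 1))) (pp l x)"
      using that(1) lx i by cases (simp_all add: s del: atLeastAtMost_iff atLeastLessThan_iff)
  qed
  show ?thesis unfolding respects_rels_def braid_rels_def
    using far near tc by auto
qed

lemma artin_rep_hom: "artin_rep n H h \<in> hom (braid_group n) (AutoGroup (free_power n H))"
  using pres_lift_hom[OF group_AutoGroup_free_power respects_braid_rels]
  by (simp add: artin_rep_def braid_group_def)

lemma artin_rep_gen: "k \<in> {1..<n} \<Longrightarrow> artin_rep n H h (braid_gen n k) = artin_tau n H h k"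
  using pres_lift_gen[OF group_AutoGroup_free_power respects_braid_rels]
  by (simp add: artin_rep_def braid_gen_def)

end

lemma group_semidirect_product:
  assumes "group G" "group B" "\<rho> \<in> hom B (AutoGroup G)"
  shows "group (semidirect_product G B \<rho>)"
proof -
  interpret G: group G by fact
  interpret B: group B by fact
  interpret r: group_hom B "AutoGroup G" \<rho>
    using assms G.AutoGroup by (simp add: group_hom_def group_hom_axioms_def)
  have car: "\<rho> b \<in> auto G" if "b \<in> carrier B" for b
    using r.hom_closed[OF that] by (simp add: AutoGroup_def)
  have c: "\<rho> b x \<in> carrier G" if "b \<in> carrier B" "x \<in> carrier G" for b x
    using car[OF that(1)] that(2) by (auto simp: auto_def hom_def)
  have m: "\<rho> b (x \<otimes>\<^bsub>G\<^esub> y) = \<rho> b x \<otimes>\<^bsub>G\<^esub> \<rho> b y"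
    if "b \<in> carrier B" "x \<in> carrier G" "y \<in> carrier G" for b x y
    using car[OF that(1)] that(2-) by (auto simp: auto_def hom_def)
  have bb: "\<rho> (b \<otimes>\<^bsub>B\<^esub> b') x = \<rho> b (\<rho> b' x)"
    if "b \<in> carrier B" "b' \<in> carrier B" "x \<in> carrier G" for b b' x
    using r.hom_mult[OF that(1,2)] car[OF that(1)] car[OF that(2)] that(3)
    by (simp add: AutoGroup_def BijGroup_def auto_def compose_def)
  have one: "\<rho> \<one>\<^bsub>B\<^esub> x = x" if "x \<in> carrier G" for x
    using r.hom_one that by (simp add: AutoGroup_def BijGroup_def)
  have one': "\<rho> b \<one>\<^bsub>G\<^esub> = \<one>\<^bsub>G\<^esub>" if "b \<in> carrier B" for b
    using m[OF that, of "\<one>\<^bsub>G\<^esub>" "\<one>\<^bsub>G\<^esub>"] c[OF that, of "\<one>\<^bsub>G\<^esub>"] by simp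
  show ?thesis
  proof (rule groupI)
    fix a assume "a \<in> carrier (semidirect_product G B \<rho>)"
    then obtain g b where a: "a = (g, b)" "g \<in> carrier G" "b \<in> carrier B"
      by (auto simp: semidirect_product_def)
    then show "\<exists>y\<in>carrier (semidirect_product G B \<rho>).
        y \<otimes>\<^bsub>semidirect_product G B \<rho>\<^esub> a = \<one>\<^bsub>semidirect_product G B \<rho>\<^esub>"
      by (intro bexI[of _ "(\<rho> (inv\<^bsub>B\<^esub> b) (inv\<^bsub>G\<^esub> g), inv\<^bsub>B\<^esub> b)"])
        (auto simp: semidirect_product_def c one one' simp flip: m simp del: r.hom_inv)
  qed (auto simp: semidirect_product_def c m bb one G.m_assoc B.m_assoc simp del: r.hom_mult r.hom_one)
qed

lemma group_artin_group:
  "group H \<Longrightarrow> h \<in> carrier H \<Longrightarrow> group (artin_group n H h)"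
  unfolding artin_group_def
  by (intro group_semidirect_product group_free_power group_braid_group artin_rep_hom)

end

(*
  Present the submonoid by a word monoid whose letters are the nontrivial elements of M and the
  sigma_i, with one relation s (s^-1 lcm(s,t)) = t (t^-1 lcm(s,t)) for each pair of letters; the
  characteristic relation is a sigma_1 h sigma_1 = sigma_1 h sigma_1 (h^-1 a h). Garside's induction
  needs only a norm and the cube condition on triples of letters, and it gives left cancellation and
  least common multiples. With c = h sigma_1 ... sigma_{n-1} one has c sigma_i = sigma_{i+1} c and
  c^2 sigma_{n-1} = sigma_1 c^2, and c^n is a product of Jucys-Murphy elements, so Delta = c^n
  normalizes the word monoid and every word divides one of its powers. Hence the word monoid acts
  faithfully by bijections on the fractions w Delta^-k. This action extends to the semidirect product
  because its i-th free factor can be sent to the conjugate by c^{i-1} of the first one; therefore the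
  word monoid embeds in the semidirect product. Right divisibility is reduced to left divisibility by
  taking complements in powers of Delta.
*)
theory Submission
  imports Defs
begin

section \<open>Complemented presentations\<close>

text \<open>The obstacle is injectivity of the map from words to the semidirect product, since
  equality there involves a free product. It is settled from outside: an action that separates words
  and extends to the semidirect product forbids \<open>elt\<close> to identify inequivalent words.
  The relation with \<open>sigma_1\<close> is what remains when the second free factor is
  eliminated. The action of \<open>tau_1\<close> on the first factor gives
  \<open>phi_2 a = h sigma_1 a sigma_1^-1 h^-1\<close>; substituted in
  \<open>tau_1 (phi_2 a) = h a h^-1\<close> it says that \<open>sigma_1 h sigma_1\<close> conjugates
  \<open>a\<close> to \<open>h a h^-1\<close>. For \<open>M\<close> free on \<open>h\<close> this is
  the Artin monoid of type B. Letters are all nontrivial elements of \<open>M\<close> and not its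
  atoms, because then the complement of two of them is at most one letter and their cube condition
  is associativity of the lcm in \<open>M\<close>. The norm on words comes from letting the free
  factors commute; there \<open>sigma_k\<close> permutes coordinates up to conjugation by
  \<open>h\<close>. This asks for a norm on \<open>M\<close> invariant under that conjugation, and
  maximal factorization length is one.\<close>

locale complemented =
  fixes S :: "'g set" and f :: "'g \<Rightarrow> 'g \<Rightarrow> 'g list"
  assumes comp_closed: "s \<in> S \<Longrightarrow> t \<in> S \<Longrightarrow> set (f s t) \<subseteq> S"
    and comp_self: "f s s = []"
begin

section \<open>The congruence generated by the relations\<close>

inductive step :: "'g list \<Rightarrow> 'g list \<Rightarrow> bool" where
  step: "s \<in> S \<Longrightarrow> t \<in> S \<Longrightarrow> step (u @ (s # f s t) @ v) (u @ (t # f t s) @ v)"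

definition eqv :: "'g list \<Rightarrow> 'g list \<Rightarrow> bool" (infix "\<approx>" 50)
  where "eqv = step\<^sup>*\<^sup>*"

lemma step_sym: "step u v \<Longrightarrow> step v u"
  by (auto elim!: step.cases intro: step.step)

lemma eqv_refl [simp]: "u \<approx> u"
  by (simp add: eqv_def)

lemma eqv_sym: "u \<approx> v \<Longrightarrow> v \<approx> u"
  unfolding eqv_def
  by (induction rule: rtranclp_induct) (auto intro: step_sym converse_rtranclp_into_rtranclp)

lemma eqv_trans [trans]: "u \<approx> v \<Longrightarrow> v \<approx> w \<Longrightarrow> u \<approx> w"
  unfolding eqv_def by (rule rtranclp_trans)

lemma step_context: "step u v \<Longrightarrow> step (p @ u @ q) (p @ v @ q)"
proof (induction rule: step.induct)
  case (step s t u v)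
  then show ?case using step.step[of s t "p @ u" "v @ q"] by simp
qed

lemma eqv_context: "u \<approx> v \<Longrightarrow> p @ u @ q \<approx> p @ v @ q"
  unfolding eqv_def
  by (induction rule: rtranclp_induct) (auto intro: rtranclp.rtrancl_into_rtrancl step_context)

lemma eqv_append: "u \<approx> u' \<Longrightarrow> v \<approx> v' \<Longrightarrow> u @ v \<approx> u' @ v'"
  using eqv_context[of u u' "[]" v] eqv_context[of v v' u' "[]"] by (auto intro: eqv_trans)

lemma eqv_prepend: "v \<approx> v' \<Longrightarrow> u @ v \<approx> u @ v'"
  and eqv_postpend: "v \<approx> v' \<Longrightarrow> v @ u \<approx> v' @ u"
  by (simp_all add: eqv_append)

lemma eqv_Cons: "v \<approx> v' \<Longrightarrow> s # v \<approx> s # v'"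
  using eqv_prepend[of v v' "[s]"] by simp

lemma eqv_comp: "s \<in> S \<Longrightarrow> t \<in> S \<Longrightarrow> s # f s t \<approx> t # f t s"
  using step.step[of s t "[]" "[]"] by (auto simp: eqv_def)

text \<open>Contexts in \<open>step\<close> are arbitrary words of the letter type; the alphabet is
  recovered along a chain because both sides of each relation use only letters of
  \<open>S\<close>.\<close>

lemma eqv_letters: "u \<approx> v \<Longrightarrow> set u \<subseteq> S \<longleftrightarrow> set v \<subseteq> S"
  unfolding eqv_def
proof (induction rule: rtranclp_induct)
  case (step v w)
  from step(2) have "set v \<subseteq> S \<longleftrightarrow> set w \<subseteq> S"
    by cases (use comp_closed in auto)
  with step.IH show ?case by simp
qed simp

lemma step_not_Nil: "step u v \<Longrightarrow> u \<noteq> [] \<and> v \<noteq> []"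
  by (auto elim!: step.cases)

text \<open>A van Kampen diagram: \<open>u\<close> and \<open>v\<close> leave one corner,
  \<open>a\<close> continues \<open>u\<close> and \<open>b\<close> continues \<open>v\<close> to the
  opposite corner. Closure under \<open>\<approx>\<close> on all sides makes it depend on classes
  only, whereas plain reversing acts on words.\<close>

inductive grid :: "'g list \<Rightarrow> 'g list \<Rightarrow> 'g list \<Rightarrow> 'g list \<Rightarrow> bool" where
  grid_Nil1: "grid [] v v []"
| grid_Nil2: "grid u [] [] u"
| grid_letter: "s \<in> S \<Longrightarrow> t \<in> S \<Longrightarrow> grid [s] [t] (f s t) (f t s)"
| grid_left: "grid u v a b \<Longrightarrow> grid u' a a' b' \<Longrightarrow> grid (u @ u') v a' (b @ b')"
| grid_right: "grid u v a b \<Longrightarrow> grid b v' a' b' \<Longrightarrow> grid u (v @ v') (a @ a') b'"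
| grid_cong: "grid u v a b \<Longrightarrow> u \<approx> u' \<Longrightarrow> v \<approx> v' \<Longrightarrow> a \<approx> a' \<Longrightarrow> b \<approx> b' \<Longrightarrow> grid u' v' a' b'"

lemma grid_eqv: "grid u v a b \<Longrightarrow> u @ a \<approx> v @ b"
proof (induction rule: grid.induct)
  case (grid_letter s t)
  then show ?case using eqv_comp by simp
next
  case (grid_left u v a b u' a' b')
  have "u @ u' @ a' \<approx> u @ a @ b'" by (rule eqv_prepend) fact
  also have "u @ a @ b' \<approx> v @ b @ b'" using eqv_postpend[OF grid_left.IH(1), of b'] by simp
  finally show ?case by simp
next
  case (grid_right u v a b v' a' b')
  have "u @ a @ a' \<approx> v @ b @ a'" using eqv_postpend[OF grid_right.IH(1), of a'] by simp
  also have "v @ b @ a' \<approx> v @ v' @ b'" by (rule eqv_prepend) fact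
  finally show ?case by simp
next
  case (grid_cong u v a b u' v' a' b')
  then show ?case by (meson eqv_append eqv_sym eqv_trans)
qed simp_all

lemma grid_sym: "grid u v a b \<Longrightarrow> grid v u b a"
proof (induction rule: grid.induct)
  case (grid_left u v a b u' a' b')
  then show ?case by (meson grid.grid_right)
next
  case (grid_right u v a b v' a' b')
  then show ?case by (meson grid.grid_left)
qed (auto intro: grid.intros)

text \<open>Four cells: the head letters meet in the corner cell and three smaller diagrams close
  the square. This is the recursion of word reversing.\<close>

lemma grid_Cons:
  assumes "s \<in> S" "t \<in> S" "grid u (f s t) c1 d1" "grid (f t s) v c2 d2" "grid d1 c2 c3 d3"
  shows "grid (s # u) (t # v) (c1 @ c3) (d2 @ d3)"
proof -
  have "grid (s # u) [t] c1 (f t s @ d1)"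
    using grid_left[OF grid_letter[OF assms(1,2)] assms(3)] by simp
  moreover have "grid (f t s @ d1) v c3 (d2 @ d3)"
    by (rule grid_left[OF assms(4,5)])
  ultimately show ?thesis using grid_right by fastforce
qed

lemma grid_letters:
  "grid u v a b \<Longrightarrow> set u \<subseteq> S \<Longrightarrow> set v \<subseteq> S \<Longrightarrow> set a \<subseteq> S \<and> set b \<subseteq> S"
proof (induction rule: grid.induct)
  case (grid_letter s t)
  then show ?case using comp_closed by simp
next
  case (grid_cong u v a b u' v' a' b')
  then show ?case by (simp add: eqv_letters)
qed auto

lemma grid_refl: "set u \<subseteq> S \<Longrightarrow> grid u u [] []"
proof (induction u)
  case (Cons s u)
  have "grid [s] [s] [] []" using grid_letter[of s s] Cons.prems comp_self by simp
  from grid_Cons[of s s u "[]" u u u "[]" "[]"] Cons show ?case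
    by (simp add: comp_self grid_Nil1 grid_Nil2)
qed (rule grid_Nil1)

text \<open>Word reversing with fuel, so that concrete grids are found by rewriting.\<close>

fun rev_words :: "nat \<Rightarrow> 'g list \<Rightarrow> 'g list \<Rightarrow> ('g list \<times> 'g list) option" where
  "rev_words k [] v = Some (v, [])"
| "rev_words k (s # u) [] = Some ([], s # u)"
| "rev_words 0 (s # u) (t # v) = None"
| "rev_words (Suc k) (s # u) (t # v) =
    (case rev_words k u (f s t) of None \<Rightarrow> None | Some (c1, d1) \<Rightarrow>
     (case rev_words k (f t s) v of None \<Rightarrow> None | Some (c2, d2) \<Rightarrow>
      (case rev_words k d1 c2 of None \<Rightarrow> None | Some (c3, d3) \<Rightarrow> Some (c1 @ c3, d2 @ d3))))"

lemma rev_words_grid: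
  "rev_words k u v = Some (a, b) \<Longrightarrow> set u \<subseteq> S \<Longrightarrow> set v \<subseteq> S \<Longrightarrow> grid u v a b"
proof (induction k u v arbitrary: a b rule: rev_words.induct)
  case (4 k s u t v)
  from "4.prems"(1) obtain c1 d1 c2 d2 c3 d3 where
    e: "rev_words k u (f s t) = Some (c1, d1)" "rev_words k (f t s) v = Some (c2, d2)" "rev_words k d1 c2 = Some (c3, d3)"
    "a = c1 @ c3" "b = d2 @ d3"
    by (auto split: option.splits)
  have st: "s \<in> S" "t \<in> S" "set u \<subseteq> S" "set v \<subseteq> S" using 4 by auto
  have 1: "grid u (f s t) c1 d1" using 4(1)[OF e(1)] st comp_closed by simp
  have 2: "grid (f t s) v c2 d2" using 4(2)[OF e(1) HOL.refl e(2)] st comp_closed by simp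
  have 3: "grid d1 c2 c3 d3" using 4(3)[OF e(1) HOL.refl e(2) HOL.refl e(3)]
    grid_letters[OF 1] grid_letters[OF 2] st comp_closed by simp
  show ?case unfolding e by (rule grid_Cons) (use 1 2 3 st in auto)
qed (auto intro: grid.intros)

text \<open>Empty complements mean that the diagram closes, so reversing also certifies
  equivalences.\<close>

lemma rev_words_eqv: "rev_words k u v = Some ([], []) \<Longrightarrow> set u \<subseteq> S \<Longrightarrow> set v \<subseteq> S \<Longrightarrow> u \<approx> v"
  using grid_eqv[OF rev_words_grid] by fastforce

text \<open>The cube condition at \<open>r\<close>: the least common multiple of \<open>r\<close>, \<open>s\<close>, \<open>t\<close> computed by reversing
  inside \<open>r\<close> also factors through the least common multiple of \<open>s\<close> and \<open>t\<close>.\<close>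

definition cube :: "'g \<Rightarrow> 'g \<Rightarrow> 'g \<Rightarrow> bool" where
  "cube r s t \<longleftrightarrow> (\<exists>a b c. grid (f r s) (f r t) a b \<and>
    f s r @ a \<approx> f s t @ c \<and> f t r @ b \<approx> f t s @ c)"

lemma cube_sym: "cube r s t \<Longrightarrow> cube r t s"
  unfolding cube_def by (blast intro: grid_sym)

lemma cubeI:
  "grid (f r s) (f r t) a b \<Longrightarrow> f s r @ a \<approx> f s t @ c \<Longrightarrow> f t r @ b \<approx> f t s @ c \<Longrightarrow> cube r s t"
  unfolding cube_def by blast

text \<open>Two equal letters have an empty complement and one side of the cube collapses, which
  leaves only triples of distinct letters to be checked.\<close>

lemma cube_degenerate:
  assumes "r \<in> S" "s \<in> S" "t \<in> S" "r = s \<or> r = t \<or> s = t"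
  shows "cube r s t"
proof -
  have 1: "cube r r t" for t
    by (rule cubeI[where c = "[]", OF grid_Nil1[of "f r t", folded comp_self[of r]]])
      (simp_all add: comp_self)
  have 2: "cube r s s"
    by (rule cubeI[OF grid_refl[OF comp_closed[OF assms(1,2)]], where c = "f s r"]) (simp_all add: comp_self)
  show ?thesis using assms(4) 1 2 cube_sym by blast
qed

end

section \<open>Garside's induction: cancellation and common multiples\<close>

locale garside_presentation = complemented S f
  for S :: "'g set" and f :: "'g \<Rightarrow> 'g \<Rightarrow> 'g list" +
  fixes \<nu> :: "'g list \<Rightarrow> nat"
  assumes norm_rel: "s \<in> S \<Longrightarrow> t \<in> S \<Longrightarrow> set u \<subseteq> S \<Longrightarrow> set v \<subseteq> S
      \<Longrightarrow> \<nu> (u @ (s # f s t) @ v) = \<nu> (u @ (t # f t s) @ v)"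
    and norm_Cons: "s \<in> S \<Longrightarrow> set u \<subseteq> S \<Longrightarrow> \<nu> u < \<nu> (s # u)"
    and cube: "r \<in> S \<Longrightarrow> s \<in> S \<Longrightarrow> t \<in> S \<Longrightarrow> cube r s t"
begin

lemma norm_eqv: "u \<approx> v \<Longrightarrow> set u \<subseteq> S \<Longrightarrow> \<nu> u = \<nu> v"
  unfolding eqv_def
proof (induction rule: rtranclp_induct)
  case (step v w)
  from step have "set v \<subseteq> S" using eqv_letters eqv_def by metis
  with step(2) have "\<nu> v = \<nu> w" by cases (auto intro!: norm_rel[simplified])
  with step show ?case by simp
qed simp

lemma norm_append: "set u \<subseteq> S \<Longrightarrow> set v \<subseteq> S \<Longrightarrow> length u + \<nu> v \<le> \<nu> (u @ v)"
proof (induction u)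
  case (Cons s u)
  have "\<nu> (u @ v) < \<nu> (s # u @ v)" using Cons by (intro norm_Cons) auto
  with Cons show ?case by simp
qed simp

text \<open>Pasting cells preserves the lcm property, so it passes from letters to diagrams. The
  bound \<open>N\<close> allows the assumption on letters to be an induction hypothesis in the proof
  of \<open>reduce\<close>.\<close>

lemma grid_lcm_bounded:
  assumes "grid u v a b"
    "\<And>s t x y. s \<in> S \<Longrightarrow> t \<in> S \<Longrightarrow> set x \<subseteq> S \<Longrightarrow> \<nu> (s # x) < N \<Longrightarrow> s # x \<approx> t # y
      \<Longrightarrow> \<exists>w. x \<approx> f s t @ w \<and> y \<approx> f t s @ w"
    "u @ w \<approx> v @ w'" "set (u @ w) \<subseteq> S" "\<nu> (u @ w) < N"
  shows "\<exists>z. w \<approx> a @ z \<and> w' \<approx> b @ z"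
  using assms(1,3-)
proof (induction arbitrary: w w' rule: grid.induct)
  case (grid_Nil1 v)
  then show ?case by (intro exI[of _ w']) simp
next
  case (grid_Nil2 u)
  then show ?case by (intro exI[of _ w]) (simp add: eqv_sym)
next
  case (grid_letter s t)
  then show ?case using assms(2)[of s t w w'] by simp
next
  case (grid_left u v a b u' a' b')
  have "\<exists>z. u' @ w \<approx> a @ z \<and> w' \<approx> b @ z" using grid_left.prems by (intro grid_left.IH(1)) auto
  then obtain z where z: "u' @ w \<approx> a @ z" "w' \<approx> b @ z" by blast
  have "\<nu> (u' @ w) < N" using norm_append[of u "u' @ w"] grid_left.prems by simp
  then obtain z' where "w \<approx> a' @ z'" "z \<approx> b' @ z'"
    using grid_left.IH(2)[OF z(1)] grid_left.prems by auto
  then show ?case using z by (auto intro!: exI[of _ z'] intro: eqv_trans eqv_prepend)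
next
  case (grid_right u v a b v' a' b')
  have "\<exists>z. w \<approx> a @ z \<and> v' @ w' \<approx> b @ z" using grid_right.prems by (intro grid_right.IH(1)) auto
  then obtain z where z: "w \<approx> a @ z" "v' @ w' \<approx> b @ z" by blast
  have S: "set (v @ v' @ w') \<subseteq> S" using eqv_letters[OF grid_right.prems(1)] grid_right.prems by simp
  have "\<nu> (v' @ w') < N"
    using norm_append[of v "v' @ w'"] norm_eqv[OF grid_right.prems(1,2)] grid_right.prems S by simp
  moreover have "\<nu> (v' @ w') = \<nu> (b @ z)" using norm_eqv[OF z(2)] S by simp
  moreover have "set (b @ z) \<subseteq> S" using eqv_letters[OF z(2)] S by auto
  ultimately obtain z' where "z \<approx> a' @ z'" "w' \<approx> b' @ z'"
    using grid_right.IH(2)[OF eqv_sym[OF z(2)]] by auto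
  then show ?case using z by (auto intro!: exI[of _ z'] intro: eqv_trans eqv_prepend)
next
  case (grid_cong u v a b u' v' a' b')
  have e: "u @ w \<approx> u' @ w" "v @ w' \<approx> v' @ w'" using grid_cong by (auto intro: eqv_postpend)
  then have "u @ w \<approx> v @ w'" using grid_cong.prems by (meson eqv_sym eqv_trans)
  moreover have S: "set (u @ w) \<subseteq> S" using eqv_letters[OF e(1)] grid_cong.prems by simp
  moreover have "\<nu> (u @ w) < N" using norm_eqv[OF e(1) S] grid_cong.prems by simp
  ultimately obtain z where "w \<approx> a @ z" "w' \<approx> b @ z" using grid_cong.IH by blast
  then show ?case using grid_cong.hyps by (meson eqv_trans eqv_postpend)
qed

text \<open>Garside's induction: first on the norm, then on the number of relations applied. Two
  consecutive chains with a common middle letter \<open>r\<close> are merged by the cube condition.\<close>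

lemma reduce:
  assumes "s \<in> S" "t \<in> S" "set x \<subseteq> S" "s # x \<approx> t # y"
  shows "\<exists>w. x \<approx> f s t @ w \<and> y \<approx> f t s @ w"
  using assms
proof (induction "\<nu> (s # x)" arbitrary: s t x y rule: less_induct)
  case less
  \<comment> \<open>The last letter \<open>t\<close> must vary along the chain: the preceding word
    starts with some \<open>r\<close>, and the inner induction hypothesis is used with
    \<open>r\<close> in place of \<open>t\<close>.\<close>
  have "\<exists>w. x \<approx> f s t @ w \<and> y \<approx> f t s @ w"
    if "step\<^sup>*\<^sup>* (s # x) w'" "w' = t # y" "t \<in> S" for w' t y
    using that
  proof (induction arbitrary: t y rule: rtranclp_induct)
    case base
    then show ?case by (auto simp: comp_self intro: eqv_refl)
  next
    case (step v w')
    obtain r z where v: "v = r # z" using step_not_Nil[OF step(2)] by (cases v) auto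
    have sv: "s # x \<approx> r # z" using step(1) v by (simp add: eqv_def)
    then have rS: "r \<in> S" "set z \<subseteq> S" using eqv_letters[OF sv] less.prems by auto
    obtain w1 where w1: "x \<approx> f s r @ w1" "z \<approx> f r s @ w1" using step.IH[OF v rS(1)] by blast
    from step(2) show ?case
    proof cases
      case (step s' t' u q)
      show ?thesis
      proof (cases u)
        \<comment> \<open>The relation exchanges the first letter \<open>r\<close> for
          \<open>t\<close>, so the tail \<open>z\<close> is a multiple of both \<open>f r s\<close>
          and \<open>f r t\<close>; the cube at \<open>r\<close> compares them.\<close>
        case Nil
        then have *: "s' = r" "t' = t" "z = f r t @ q" "y = f t r @ q"
          using step v \<open>w' = t # y\<close> by auto
        obtain a b c where abc: "grid (f r s) (f r t) a b" "f s r @ a \<approx> f s t @ c"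
          "f t r @ b \<approx> f t s @ c"
          using cube[OF rS(1) less.prems(1) \<open>t \<in> S\<close>] unfolding cube_def by blast
        have e: "f r s @ w1 \<approx> f r t @ q" using w1(2) * by (simp add: eqv_sym)
        have S1: "set (f r s @ w1) \<subseteq> S" using eqv_letters[OF w1(2)] rS by simp
        \<comment> \<open>\<open>z\<close> stands behind \<open>r\<close> in a word of the same norm
          as \<open>s # x\<close>, hence the outer induction hypothesis applies to common multiples
          within \<open>z\<close>.\<close>
        have "\<nu> z < \<nu> (s # x)"
          using norm_Cons[OF rS] norm_eqv[OF sv] less.prems by simp
        then have N: "\<nu> (f r s @ w1) < \<nu> (s # x)" using norm_eqv[OF w1(2) rS(2)] by simp
        obtain p where p: "w1 \<approx> a @ p" "q \<approx> b @ p"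
          using grid_lcm_bounded[OF abc(1) less.hyps e S1 N] by blast
        have "x \<approx> f s t @ c @ p"
          using w1(1) p(1) eqv_postpend[OF abc(2), of p]
          by (metis append.assoc eqv_trans eqv_prepend)
        moreover have "y \<approx> f t s @ c @ p"
          using p(2) eqv_postpend[OF abc(3), of p] *
          by (metis append.assoc eqv_trans eqv_prepend)
        ultimately show ?thesis by blast
      next
        \<comment> \<open>The relation is applied behind the first letter and changes only the
          tail.\<close>
        case (Cons a u')
        then have *: "a = r" "r = t" "z = u' @ (s' # f s' t') @ q" "y = u' @ (t' # f t' s') @ q"
          using step v \<open>w' = t # y\<close> by auto
        have "step z y" using * step step.step by blast
        then have "y \<approx> z" by (simp add: eqv_def step_sym r_into_rtranclp)
        then show ?thesis using w1 * eqv_trans by blast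
      qed
    qed
  qed
  from this[OF less.prems(4)[unfolded eqv_def] HOL.refl less.prems(2)] show ?case .
qed

text \<open>The case \<open>s = t\<close> of \<open>reduce\<close>, where both complements are
  empty.\<close>

lemma left_cancel_letter: "s \<in> S \<Longrightarrow> set x \<subseteq> S \<Longrightarrow> s # x \<approx> s # y \<Longrightarrow> x \<approx> y"
  using reduce[of s s x y] by (auto simp: comp_self intro: eqv_sym eqv_trans)

lemma left_cancel: "u @ x \<approx> u @ y \<Longrightarrow> set u \<subseteq> S \<Longrightarrow> set x \<subseteq> S \<Longrightarrow> x \<approx> y"
proof (induction u)
  case (Cons s u)
  then show ?case using left_cancel_letter[of s "u @ x" "u @ y"] by simp
qed simp

lemma grid_lcm:
  assumes "grid u v a b" "u @ w \<approx> v @ w'" "set u \<subseteq> S" "set w \<subseteq> S"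
  shows "\<exists>z. w \<approx> a @ z \<and> w' \<approx> b @ z"
  using grid_lcm_bounded[OF assms(1) reduce assms(2), of "Suc (\<nu> (u @ w))"] assms(3,4) by simp

text \<open>A common multiple makes reversing terminate: each of the three cells beyond the corner
  lies under a common multiple of smaller norm.\<close>

lemma grid_exists:
  assumes "u @ w \<approx> v @ w'" "set u \<subseteq> S" "set w \<subseteq> S"
  shows "\<exists>a b. grid u v a b"
  using assms
proof (induction "\<nu> (u @ w)" arbitrary: u v w w' rule: less_induct)
  case less
  show ?case
  proof (cases "u = [] \<or> v = []")
    case True
    then show ?thesis using grid_Nil1 grid_Nil2 by blast
  next
    case False
    then obtain s u1 t v1 where uv: "u = s # u1" "v = t # v1" by (meson neq_Nil_conv)
    have S2: "set v \<subseteq> S" "set w' \<subseteq> S" using eqv_letters[OF less.prems(1)] less.prems by auto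
    have st: "s \<in> S" "t \<in> S" using uv less.prems S2 by auto
    have lv: "\<nu> (v1 @ w') < \<nu> (u @ w)"
      using norm_Cons[of t "v1 @ w'"] norm_eqv[OF less.prems(1)] uv S2 less.prems by simp
    have lu: "\<nu> (u1 @ w) < \<nu> (u @ w)"
      using norm_Cons[of s "u1 @ w"] uv less.prems by simp
    obtain w1 where w1: "u1 @ w \<approx> f s t @ w1" "v1 @ w' \<approx> f t s @ w1"
      using reduce[of s t "u1 @ w" "v1 @ w'"] st less.prems uv by auto
    have Sw1: "set (f t s @ w1) \<subseteq> S" using eqv_letters[OF w1(2)] S2 uv by simp
    obtain c1 d1 where g1: "grid u1 (f s t) c1 d1"
      using less.hyps[OF lu w1(1)] less.prems uv by auto
    obtain c2 d2 where g2: "grid (f t s) v1 c2 d2"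
      using less.hyps[OF _ eqv_sym[OF w1(2)]] lv norm_eqv[OF w1(2)] Sw1 S2 uv by auto
    obtain z1 where z1: "w1 \<approx> d1 @ z1"
      using grid_lcm[OF g1 w1(1)] less.prems uv by auto
    obtain z2 where z2: "w1 \<approx> c2 @ z2"
      using grid_lcm[OF g2 eqv_sym[OF w1(2)]] Sw1 by auto
    \<comment> \<open>The last cell exists because \<open>w1\<close> is a common multiple of
      \<open>d1\<close> and \<open>c2\<close>.\<close>
    have "\<nu> w1 \<le> \<nu> (f t s @ w1)" using norm_append[of "f t s" w1] Sw1 by simp
    then have "\<nu> (d1 @ z1) < \<nu> (u @ w)"
      using norm_eqv[OF z1] Sw1 lv norm_eqv[OF w1(2)] S2 uv by simp
    moreover have "set (d1 @ z1) \<subseteq> S" using eqv_letters[OF z1] Sw1 by simp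
    ultimately obtain c3 d3 where "grid d1 c2 c3 d3"
      using less.hyps[of d1 z1 c2 z2] z1 z2 eqv_sym eqv_trans by (metis le_sup_iff set_append)
    from grid_Cons[OF st g1 g2 this] show ?thesis using uv by blast
  qed
qed

end

section \<open>The presentation of the Artin type monoid\<close>

context complemented
begin

text \<open>A common prefix reverses to nothing. It removes the block \<open>[Mon h, Sig 1]\<close>
  with which \<open>compl (Sig 1) (Mon a)\<close> starts for every \<open>a\<close>.\<close>

lemma grid_prefix: "grid u v a b \<Longrightarrow> set p \<subseteq> S \<Longrightarrow> grid (p @ u) (p @ v) a b"
  using grid_left[OF grid_right[OF grid_refl[of p] grid_Nil1[of v]], of u a b] by simp

text \<open>A sufficient test by computation. The witness \<open>c\<close> of \<open>cube\<close> is
  found as the quotient of \<open>f s r @ a\<close> by \<open>f s t\<close>; the condition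
  \<open>d = []\<close> says that this division leaves no remainder.\<close>

definition cube_check :: "nat \<Rightarrow> 'g \<Rightarrow> 'g \<Rightarrow> 'g \<Rightarrow> bool" where
  "cube_check k r s t \<longleftrightarrow>
    (case rev_words k (f r s) (f r t) of None \<Rightarrow> False | Some (a, b) \<Rightarrow>
      (case rev_words k (f s t) (f s r @ a) of None \<Rightarrow> False | Some (c, d) \<Rightarrow>
        d = [] \<and> rev_words k (f t r @ b) (f t s @ c) = Some ([], [])))"

lemma cube_checkD:
  assumes "cube_check k r s t" "r \<in> S" "s \<in> S" "t \<in> S"
  shows "cube r s t"
proof -
  obtain a b c where r: "rev_words k (f r s) (f r t) = Some (a, b)" "rev_words k (f s t) (f s r @ a) = Some (c, [])"
    "rev_words k (f t r @ b) (f t s @ c) = Some ([], [])"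
    using assms(1) by (auto simp: cube_check_def split: option.splits)
  note S = comp_closed[OF assms(2,3)] comp_closed[OF assms(2,4)] comp_closed[OF assms(3,2)]
    comp_closed[OF assms(3,4)] comp_closed[OF assms(4,2)] comp_closed[OF assms(4,3)]
  have 1: "grid (f r s) (f r t) a b" using r S by (intro rev_words_grid)
  have 2: "grid (f s t) (f s r @ a) c []" using r S grid_letters[OF 1] by (intro rev_words_grid) auto
  have 3: "f t r @ b \<approx> f t s @ c" using r S grid_letters[OF 1] grid_letters[OF 2]
    by (intro rev_words_eqv) auto
  show ?thesis using cubeI[OF 1 _ 3] grid_eqv[OF 2] by (simp add: eqv_sym)
qed

end

datatype 'a letter = Mon 'a | Sig nat

text \<open>Divisibility is expressed inside the group: \<open>inv a \<otimes> c \<in> M\<close>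
  says that \<open>a\<close> left divides \<open>c\<close>. Invariance of \<open>\<mu>\<close> is
  required because braid letters carry conjugates by \<open>h\<close> from one coordinate to
  another.\<close>

locale garside_datum = group H for H :: "('a, 'b) monoid_scheme" (structure) +
  fixes M :: "'a set" and h :: 'a and \<mu> :: "'a \<Rightarrow> nat" and n :: nat
  assumes M_submonoid: "submonoid M H"
    and h_in_M: "h \<in> M" and h_not_one: "h \<noteq> \<one>"
    and conj_closed: "a \<in> M \<Longrightarrow> h \<otimes> a \<otimes> inv h \<in> M" "a \<in> M \<Longrightarrow> inv h \<otimes> a \<otimes> h \<in> M"
    and mu_pos: "a \<in> M \<Longrightarrow> a \<noteq> \<one> \<Longrightarrow> 0 < \<mu> a"
    and mu_mult: "a \<in> M \<Longrightarrow> b \<in> M \<Longrightarrow> \<mu> a + \<mu> b \<le> \<mu> (a \<otimes> b)"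
    and mu_conj: "a \<in> M \<Longrightarrow> \<mu> (h \<otimes> a \<otimes> inv h) = \<mu> a"
    and M_lcm: "a \<in> M \<Longrightarrow> b \<in> M \<Longrightarrow> \<exists>c\<in>M. inv a \<otimes> c \<in> M \<and> inv b \<otimes> c \<in> M \<and>
      (\<forall>d\<in>M. inv a \<otimes> d \<in> M \<longrightarrow> inv b \<otimes> d \<in> M \<longrightarrow> inv c \<otimes> d \<in> M)"
    and M_generated: "mgenerate H {x \<in> M. inv x \<otimes> h \<in> M} = M"
    and n_pos: "1 \<le> n"
begin

section \<open>Least common multiples and complements in M\<close>

lemma M_carrier [simp, intro]: "a \<in> M \<Longrightarrow> a \<in> carrier H"
  using submonoid.subset[OF M_submonoid] by blast

lemma M_mult [simp, intro]: "a \<in> M \<Longrightarrow> b \<in> M \<Longrightarrow> a \<otimes> b \<in> M"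
  using submonoid.m_closed[OF M_submonoid] by blast

lemma M_one [simp, intro]: "\<one> \<in> M"
  using submonoid.one_closed[OF M_submonoid] by blast

declare h_in_M [simp, intro] h_not_one [simp]

lemma inv_cancel [simp]:
  "a \<in> carrier H \<Longrightarrow> b \<in> carrier H \<Longrightarrow> inv a \<otimes> (a \<otimes> b) = b"
  "a \<in> carrier H \<Longrightarrow> b \<in> carrier H \<Longrightarrow> a \<otimes> (inv a \<otimes> b) = b"
  by (simp_all flip: m_assoc)

text \<open>Superadditivity at \<open>\<one>\<close> gives \<open>\<mu> \<one> = 0\<close>, so both
  factors have norm 0.\<close>

lemma M_no_units: "a \<in> M \<Longrightarrow> b \<in> M \<Longrightarrow> a \<otimes> b = \<one> \<Longrightarrow> a = \<one> \<and> b = \<one>"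
  using mu_mult[of a b] mu_mult[of \<one> \<one>] mu_pos[of a] mu_pos[of b] by fastforce

definition lcmM :: "'a \<Rightarrow> 'a \<Rightarrow> 'a" where
  "lcmM a b = (SOME c. c \<in> M \<and> inv a \<otimes> c \<in> M \<and> inv b \<otimes> c \<in> M \<and>
    (\<forall>d\<in>M. inv a \<otimes> d \<in> M \<longrightarrow> inv b \<otimes> d \<in> M \<longrightarrow> inv c \<otimes> d \<in> M))"

lemma lcmM:
  assumes "a \<in> M" "b \<in> M"
  shows "lcmM a b \<in> M" "inv a \<otimes> lcmM a b \<in> M" "inv b \<otimes> lcmM a b \<in> M"
    "d \<in> M \<Longrightarrow> inv a \<otimes> d \<in> M \<Longrightarrow> inv b \<otimes> d \<in> M \<Longrightarrow> inv (lcmM a b) \<otimes> d \<in> M"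
proof -
  have "\<exists>c. c \<in> M \<and> inv a \<otimes> c \<in> M \<and> inv b \<otimes> c \<in> M \<and>
    (\<forall>d\<in>M. inv a \<otimes> d \<in> M \<longrightarrow> inv b \<otimes> d \<in> M \<longrightarrow> inv c \<otimes> d \<in> M)"
    using M_lcm[OF assms] by blast
  from someI_ex[OF this] show "lcmM a b \<in> M" "inv a \<otimes> lcmM a b \<in> M" "inv b \<otimes> lcmM a b \<in> M"
    "d \<in> M \<Longrightarrow> inv a \<otimes> d \<in> M \<Longrightarrow> inv b \<otimes> d \<in> M \<Longrightarrow> inv (lcmM a b) \<otimes> d \<in> M"
    unfolding lcmM_def by blast+
qed

lemma M_antisym:
  assumes "a \<in> M" "b \<in> M" "inv a \<otimes> b \<in> M" "inv b \<otimes> a \<in> M"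
  shows "a = b"
proof -
  have "(inv a \<otimes> b) \<otimes> (inv b \<otimes> a) = \<one>" using assms(1,2) by (simp add: m_assoc)
  then have "inv a \<otimes> b = \<one>" using M_no_units assms by blast
  then show ?thesis using assms by (metis M_carrier inv_cancel(2) r_one)
qed

text \<open>Without nontrivial units divisibility is antisymmetric, so the multiple selected by
  \<open>SOME\<close> is the only one.\<close>

lemma lcmM_eqI:
  assumes "a \<in> M" "b \<in> M" "c \<in> M" "inv a \<otimes> c \<in> M" "inv b \<otimes> c \<in> M"
    "\<And>d. d \<in> M \<Longrightarrow> inv a \<otimes> d \<in> M \<Longrightarrow> inv b \<otimes> d \<in> M \<Longrightarrow> inv c \<otimes> d \<in> M"
  shows "lcmM a b = c"
proof (rule M_antisym)
  show "inv (lcmM a b) \<otimes> c \<in> M" using assms(3-5) by (intro lcmM(4)[OF assms(1,2)])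
  show "inv c \<otimes> lcmM a b \<in> M" using lcmM[OF assms(1,2)] by (intro assms(6))
qed (use assms lcmM in auto)

definition quot :: "'a \<Rightarrow> 'a \<Rightarrow> 'a" where "quot a b = inv a \<otimes> lcmM a b"

definition hconj_inv :: "'a \<Rightarrow> 'a" where "hconj_inv a = inv h \<otimes> a \<otimes> h"

lemma quot_closed [simp, intro]: "a \<in> M \<Longrightarrow> b \<in> M \<Longrightarrow> quot a b \<in> M"
  by (simp add: quot_def lcmM)

lemma lcmM_sym: "a \<in> M \<Longrightarrow> b \<in> M \<Longrightarrow> lcmM a b = lcmM b a"
  using lcmM[of b a] by (intro lcmM_eqI) auto

lemma mult_quot: "a \<in> M \<Longrightarrow> b \<in> M \<Longrightarrow> a \<otimes> quot a b = lcmM a b"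
  by (simp add: quot_def lcmM)

lemma hconj_inv_closed [simp, intro]: "a \<in> M \<Longrightarrow> hconj_inv a \<in> M"
  by (simp add: hconj_inv_def conj_closed)

lemma hconj_inv_h [simp]: "hconj_inv h = h"
  by (simp add: hconj_inv_def m_assoc)

lemma hconj_inv_one [simp]: "hconj_inv \<one> = \<one>"
  by (simp add: hconj_inv_def)

lemma hconj_inv_mult: "a \<in> M \<Longrightarrow> b \<in> M \<Longrightarrow> hconj_inv (a \<otimes> b) = hconj_inv a \<otimes> hconj_inv b"
  by (simp add: hconj_inv_def m_assoc)

lemma conj_hconj_inv: "a \<in> M \<Longrightarrow> h \<otimes> hconj_inv a \<otimes> inv h = a"
  by (simp add: hconj_inv_def m_assoc)

lemma hconj_inv_surj:
  assumes "a \<in> M"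
  obtains b where "b \<in> M" "hconj_inv b = a"
proof
  show "h \<otimes> a \<otimes> inv h \<in> M" using assms by (rule conj_closed)
  show "hconj_inv (h \<otimes> a \<otimes> inv h) = a" using assms by (simp add: hconj_inv_def m_assoc)
qed

lemma hconj_inv_inj: "a \<in> M \<Longrightarrow> b \<in> M \<Longrightarrow> hconj_inv a = hconj_inv b \<longleftrightarrow> a = b"
  by (metis conj_hconj_inv)

lemma hconj_inv_eq_one [simp]: "a \<in> M \<Longrightarrow> hconj_inv a = \<one> \<longleftrightarrow> a = \<one>"
  using hconj_inv_inj[of a \<one>] by simp

lemma inv_hconj_inv_mult: "a \<in> M \<Longrightarrow> b \<in> M \<Longrightarrow> inv (hconj_inv a) \<otimes> hconj_inv b = inv h \<otimes> (inv a \<otimes> b) \<otimes> h"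
  by (simp add: hconj_inv_def m_assoc inv_mult_group)

lemma conj_in_M_iff: "a \<in> carrier H \<Longrightarrow> inv h \<otimes> a \<otimes> h \<in> M \<longleftrightarrow> a \<in> M"
  using conj_closed(1)[of "inv h \<otimes> a \<otimes> h"] conj_closed(2)[of a] by (auto simp: m_assoc)

text \<open>Conjugation by \<open>h\<close> and its inverse both preserve \<open>M\<close>, hence it
  is an automorphism of the divisibility order.\<close>

lemma lcmM_hconj_inv:
  assumes "a \<in> M" "b \<in> M"
  shows "lcmM (hconj_inv a) (hconj_inv b) = hconj_inv (lcmM a b)"
proof (rule lcmM_eqI)
  fix d assume d: "d \<in> M" "inv (hconj_inv a) \<otimes> d \<in> M" "inv (hconj_inv b) \<otimes> d \<in> M"
  then obtain e where "e \<in> M" "d = hconj_inv e" by (metis hconj_inv_surj)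
  with d assms lcmM[OF assms] show "inv (hconj_inv (lcmM a b)) \<otimes> d \<in> M"
    by (simp add: inv_hconj_inv_mult conj_in_M_iff)
qed (use assms lcmM in \<open>auto simp: inv_hconj_inv_mult conj_in_M_iff\<close>)

lemma quot_hconj_inv: "a \<in> M \<Longrightarrow> b \<in> M \<Longrightarrow> quot (hconj_inv a) (hconj_inv b) = hconj_inv (quot a b)"
  by (simp add: quot_def lcmM_hconj_inv lcmM inv_hconj_inv_mult) (simp add: hconj_inv_def)

lemma lcmM_left_mult:
  assumes "r \<in> M" "a \<in> M" "b \<in> M"
  shows "lcmM (r \<otimes> a) (r \<otimes> b) = r \<otimes> lcmM a b"
proof (rule lcmM_eqI)
  fix d assume d: "d \<in> M" "inv (r \<otimes> a) \<otimes> d \<in> M" "inv (r \<otimes> b) \<otimes> d \<in> M"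
  have "inv r \<otimes> d = a \<otimes> (inv (r \<otimes> a) \<otimes> d)" using assms d(1) by (simp add: inv_mult_group m_assoc)
  then have "inv r \<otimes> d \<in> M" using assms d by simp
  then have "inv (lcmM a b) \<otimes> (inv r \<otimes> d) \<in> M"
    using lcmM(4)[OF assms(2,3), of "inv r \<otimes> d"] d assms by (simp add: inv_mult_group m_assoc)
  then show "inv (r \<otimes> lcmM a b) \<otimes> d \<in> M" using assms d lcmM by (simp add: inv_mult_group m_assoc)
qed (use assms lcmM in \<open>auto simp: inv_mult_group m_assoc\<close>)

lemma lcmM_assoc:
  assumes "r \<in> M" "s \<in> M" "t \<in> M"
  shows "lcmM (lcmM r s) (lcmM r t) = lcmM (lcmM r s) t"
proof (rule lcmM_eqI)
  let ?c = "lcmM (lcmM r s) t"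
  have M: "lcmM r s \<in> M" "lcmM r t \<in> M" "?c \<in> M" using assms lcmM by auto
  show "lcmM r s \<in> M" "lcmM r t \<in> M" "?c \<in> M" by fact+
  show "inv (lcmM r s) \<otimes> ?c \<in> M" using lcmM M assms by simp
  have "inv r \<otimes> ?c = (inv r \<otimes> lcmM r s) \<otimes> (inv (lcmM r s) \<otimes> ?c)" using M assms by (simp add: m_assoc)
  also have "\<dots> \<in> M" using M_mult[OF lcmM(2)[OF assms(1,2)] lcmM(2)[OF M(1) assms(3)]] .
  finally show "inv (lcmM r t) \<otimes> ?c \<in> M" using M assms by (intro lcmM(4)) (auto intro: lcmM)
  fix d assume d: "d \<in> M" "inv (lcmM r s) \<otimes> d \<in> M" "inv (lcmM r t) \<otimes> d \<in> M"
  have "inv t \<otimes> d = (inv t \<otimes> lcmM r t) \<otimes> (inv (lcmM r t) \<otimes> d)" using M assms d by (simp add: m_assoc)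
  also have "\<dots> \<in> M" using M_mult[OF lcmM(3)[OF assms(1,3)] d(3)] .
  finally show "inv ?c \<otimes> d \<in> M" by (rule lcmM(4)[OF M(1) assms(3) d(1,2)])
qed

lemma lcmM_left_comm:
  assumes "r \<in> M" "s \<in> M" "t \<in> M"
  shows "lcmM (lcmM r s) t = lcmM (lcmM s t) r"
proof -
  have M: "lcmM r s \<in> M" "lcmM s t \<in> M" using assms lcmM by auto
  have "lcmM (lcmM s r) (lcmM s t) = lcmM (lcmM s r) t" "lcmM (lcmM s t) (lcmM s r) = lcmM (lcmM s t) r"
    using assms by (auto intro: lcmM_assoc)
  then show ?thesis using lcmM_sym M assms by metis
qed

text \<open>Computing with complements of \<open>r\<close> gives the lcm of all three elements
  divided by \<open>r\<close>, a value in which \<open>s\<close> and \<open>t\<close> can be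
  exchanged. This is the source of the cube condition in \<open>M\<close>.\<close>

lemma quot_quot:
  assumes "r \<in> M" "s \<in> M" "t \<in> M"
  shows "quot r s \<otimes> quot (quot r s) (quot r t) = inv r \<otimes> lcmM (lcmM r s) t"
proof -
  have "lcmM (quot r s) (quot r t) = inv r \<otimes> (r \<otimes> lcmM (quot r s) (quot r t))"
    using assms lcmM by simp
  also have "r \<otimes> lcmM (quot r s) (quot r t) = lcmM (lcmM r s) (lcmM r t)"
    using lcmM_left_mult[OF assms(1), of "quot r s" "quot r t"] assms by (simp add: mult_quot)
  finally show ?thesis using assms by (simp add: mult_quot lcmM_assoc)
qed

lemma quot_mult_right: "a \<in> M \<Longrightarrow> b \<in> M \<Longrightarrow> quot a (a \<otimes> b) = b" "a \<in> M \<Longrightarrow> b \<in> M \<Longrightarrow> quot (a \<otimes> b) a = \<one>"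
proof -
  assume ab: "a \<in> M" "b \<in> M"
  then have "lcmM a (a \<otimes> b) = a \<otimes> b" by (intro lcmM_eqI) auto
  then show "quot a (a \<otimes> b) = b" "quot (a \<otimes> b) a = \<one>"
    using ab lcmM_sym[of "a \<otimes> b" a] by (simp_all add: quot_def)
qed

lemma quot_one [simp]: "a \<in> M \<Longrightarrow> quot \<one> a = a" "a \<in> M \<Longrightarrow> quot a \<one> = \<one>" "a \<in> M \<Longrightarrow> quot a a = \<one>"
  using quot_mult_right[of \<one> a] quot_mult_right[of a \<one>] by auto

text \<open>The neutral element has to be the empty word, since a letter \<open>Mon \<one>\<close>
  would not raise the norm.\<close>

definition mword :: "'a \<Rightarrow> 'a letter list" where "mword a = (if a = \<one> then [] else [Mon a])"

definition adj :: "nat \<Rightarrow> nat \<Rightarrow> bool" where "adj i j \<longleftrightarrow> Suc i = j \<or> Suc j = i"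

text \<open>\<open>s # compl s t \<approx> t # compl t s\<close> are the defining relations: the least common multiples of \<open>M\<close>,
  the braid relations, commutation of \<open>M\<close> with \<open>\<sigma>\<^sub>i\<close> for \<open>i \<ge> 2\<close>, and
  \<open>a \<sigma>\<^sub>1 h \<sigma>\<^sub>1 = \<sigma>\<^sub>1 h \<sigma>\<^sub>1 (h\<^sup>-\<^sup>1 a h)\<close>.\<close>

fun compl :: "'a letter \<Rightarrow> 'a letter \<Rightarrow> 'a letter list" where
  "compl (Mon a) (Mon b) = (if a = b then [] else mword (quot a b))"
| "compl (Mon a) (Sig i) = (if i = Suc 0 then [Sig (Suc 0), Mon h, Sig (Suc 0)] else [Sig i])"
| "compl (Sig i) (Mon a) = (if i = Suc 0 then [Mon h, Sig (Suc 0), Mon (hconj_inv a)] else [Mon a])"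
| "compl (Sig i) (Sig j) = (if i = j then [] else if adj i j then [Sig j, Sig i] else [Sig j])"

definition letters :: "'a letter set" where
  "letters = Mon ` (M - {\<one>}) \<union> Sig ` {1..<n}"

abbreviation "valid w \<equiv> set w \<subseteq> letters"

lemma letters_simps [simp]:
  "Mon a \<in> letters \<longleftrightarrow> a \<in> M \<and> a \<noteq> \<one>" "Sig i \<in> letters \<longleftrightarrow> 1 \<le> i \<and> i < n"
  by (auto simp: letters_def)

lemma mon_letters [simp]: "a \<in> M \<Longrightarrow> valid (mword a)"
  by (simp add: mword_def)

lemma letters_cases:
  assumes "s \<in> letters"
  obtains a where "s = Mon a" "a \<in> M" "a \<noteq> \<one>" | i where "s = Sig i" "1 \<le> i" "i < n"
  using assms by (auto simp: letters_def)

sublocale complemented letters compl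
proof
  fix s t assume "s \<in> letters" "t \<in> letters"
  then show "valid (compl s t)"
    by (auto elim!: letters_cases simp: mword_def split: if_splits)
next
  fix s show "compl s s = []" by (cases s) auto
qed

notation eqv (infix "\<approx>" 50)

section \<open>The norm on words\<close>

text \<open>The norm comes from the quotient \<open>M\<^sup>n \<rtimes> B\<^sub>n\<^sup>+\<close> in which the free factors commute: \<open>act\<close> is left
  multiplication on its \<open>M\<^sup>n\<close>-coordinates.\<close>

fun act :: "'a letter \<Rightarrow> (nat \<Rightarrow> 'a) \<Rightarrow> nat \<Rightarrow> 'a" where
  "act (Mon a) v = v(Suc 0 := a \<otimes> v (Suc 0))"
| "act (Sig k) v = v(k := h \<otimes> v (Suc k) \<otimes> inv h, Suc k := v k)"

text \<open>Braid letters leave the sum of the \<open>\<mu>\<close> values unchanged, so they are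
  counted separately. The defining relations preserve both summands.\<close>

definition norm :: "'a letter list \<Rightarrow> nat" where
  "norm w = (\<Sum>i = 1..n. \<mu> (foldr act w (\<lambda>_. \<one>) i)) + length (filter (\<lambda>s. \<exists>i. s = Sig i) w)"

lemma act_closed: "s \<in> letters \<Longrightarrow> range v \<subseteq> M \<Longrightarrow> range (act s v) \<subseteq> M"
  by (auto elim!: letters_cases simp: image_subset_iff conj_closed)

lemma foldr_act_closed: "valid w \<Longrightarrow> range v \<subseteq> M \<Longrightarrow> range (foldr act w v) \<subseteq> M"
  by (induction w) (auto simp: act_closed simp del: act.simps)

lemma foldr_act_mon: "range v \<subseteq> M \<Longrightarrow> foldr act (mword a) v = v(Suc 0 := a \<otimes> v (Suc 0))"
  by (auto simp: mword_def fun_eq_iff image_subset_iff)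

lemma act_rel:
  assumes "s \<in> letters" "t \<in> letters" "range v \<subseteq> M"
  shows "foldr act (s # compl s t) v = foldr act (t # compl t s) v"
proof -
  have v: "v i \<in> M" for i using assms(3) by auto
  show ?thesis
    using assms(1,2)
  proof (elim letters_cases)
    fix a b assume "s = Mon a" "t = Mon b" "a \<in> M" "b \<in> M"
    moreover have "a \<otimes> quot a b = b \<otimes> quot b a"
      using calculation by (simp add: mult_quot lcmM_sym)
    ultimately show ?thesis using v
      by (auto simp: foldr_act_mon[OF assms(3)] simp flip: m_assoc)
  next
    fix i j assume "s = Sig i" "t = Sig j"
    then show ?thesis by (auto simp: fun_eq_iff adj_def)
  next
    fix a i assume "s = Mon a" "a \<in> M" "t = Sig i" "1 \<le> i"
    then show ?thesis using v by (auto simp: fun_eq_iff hconj_inv_def m_assoc)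
  next
    fix a i assume "t = Mon a" "a \<in> M" "s = Sig i" "1 \<le> i"
    then show ?thesis using v by (auto simp: fun_eq_iff hconj_inv_def m_assoc)
  qed
qed

lemma norm_Cons_less:
  assumes "s \<in> letters" "valid w"
  shows "norm w < norm (s # w)"
  using assms(1)
proof (cases rule: letters_cases)
  let ?v = "foldr act w (\<lambda>_. \<one>)"
  have v: "?v i \<in> M" for i using foldr_act_closed[OF assms(2), of "\<lambda>_. \<one>"] by auto
  {
    case (1 a)
    have "\<mu> (?v (Suc 0)) < \<mu> (a \<otimes> ?v (Suc 0))"
      using mu_mult[of a "?v (Suc 0)"] mu_pos 1 v by fastforce
    \<comment> \<open>The coordinate that grows is the first, and it is summed because
      \<open>1 \<le> n\<close>.\<close>
    then have "(\<Sum>i = 1..n. \<mu> (?v i)) < (\<Sum>i = 1..n. \<mu> (act s ?v i))"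
      using n_pos 1 by (intro sum_strict_mono_ex1) auto
    then show ?thesis using 1 by (simp add: norm_def)
  next
    case (2 k)
    \<comment> \<open>The letter exchanges two coordinates and conjugates one of them by
      \<open>h\<close>, which \<open>\<mu>\<close> does not see.\<close>
    have "(\<Sum>i = 1..n. \<mu> (act s ?v i)) = (\<Sum>i = 1..n. \<mu> (?v (Transposition.transpose k (Suc k) i)))"
      by (rule sum.cong) (use 2 v mu_conj in \<open>auto simp: Transposition.transpose_def\<close>)
    also have "\<dots> = (\<Sum>i = 1..n. \<mu> (?v i))"
      by (rule sum.reindex_bij_witness[where i = "Transposition.transpose k (Suc k)"
            and j = "Transposition.transpose k (Suc k)"])
        (use 2 in \<open>auto simp: Transposition.transpose_def split: if_splits\<close>)
    finally show ?thesis using 2 by (simp add: norm_def)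
  }
qed

lemma norm_relation:
  assumes "s \<in> letters" "t \<in> letters" "valid u" "valid v"
  shows "norm (u @ (s # compl s t) @ v) = norm (u @ (t # compl t s) @ v)"
proof -
  let ?sig = "\<lambda>s. \<exists>i. s = Sig i"
  have "range (foldr act v (\<lambda>_. \<one>)) \<subseteq> M" using assms(4) by (intro foldr_act_closed) auto
  from act_rel[OF assms(1,2) this]
  have "foldr act (u @ (s # compl s t) @ v) (\<lambda>_. \<one>) = foldr act (u @ (t # compl t s) @ v) (\<lambda>_. \<one>)"
    by simp
  moreover have "length (filter ?sig (s # compl s t)) = length (filter ?sig (t # compl t s))"
    using assms(1,2) by (elim letters_cases) (auto simp: mword_def adj_def)
  ultimately show ?thesis by (simp only: norm_def filter_append length_append)
qed

text \<open>The multiplication table of \<open>M\<close> is contained in the lcm relations: the lcm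
  of \<open>a\<close> and \<open>a \<otimes> b\<close> is \<open>a \<otimes> b\<close>, with
  complements \<open>b\<close> and \<open>\<one>\<close>.\<close>

lemma mon_append:
  assumes "a \<in> M" "b \<in> M"
  shows "mword a @ mword b \<approx> mword (a \<otimes> b)"
proof (cases "a = \<one> \<or> b = \<one>")
  case True
  then show ?thesis using assms by (auto simp: mword_def)
next
  case False
  then have ab: "a \<otimes> b \<noteq> \<one>" "a \<otimes> b \<noteq> a" "a \<noteq> a \<otimes> b"
    using M_no_units[OF assms] assms by (auto dest: sym)
  then have "Mon a # compl (Mon a) (Mon (a \<otimes> b)) \<approx> Mon (a \<otimes> b) # compl (Mon (a \<otimes> b)) (Mon a)"
    using assms False by (intro eqv_comp) auto
  then show ?thesis using False ab assms
    by (simp add: quot_mult_right) (simp add: mword_def)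
qed

text \<open>\<open>comp_self\<close> must hold on the whole letter type, hence the test
  \<open>a = b\<close> in \<open>compl\<close>; on \<open>M\<close> it agrees with the general
  clause because \<open>quot a a = \<one>\<close>.\<close>

lemma mon_comp_eq:
  assumes "Mon a \<in> letters" "Mon b \<in> letters"
  shows "compl (Mon a) (Mon b) = mword (quot a b)"
  using assms by (auto simp: mword_def)

lemma grid_mon:
  assumes "a \<in> M" "b \<in> M"
  shows "grid (mword a) (mword b) (mword (quot a b)) (mword (quot b a))"
proof -
  consider "a = \<one>" | "b = \<one>" | "a \<noteq> \<one>" "b \<noteq> \<one>" by blast
  then show ?thesis
  proof cases
    case 3
    then show ?thesis using grid_letter[of "Mon a" "Mon b"] mon_comp_eq[of a b] mon_comp_eq[of b a] assms
      by (simp add: mword_def[of a] mword_def[of b] del: compl.simps)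
  qed (use assms in \<open>auto simp: mword_def intro: grid_Nil1 grid_Nil2\<close>)
qed

section \<open>The cube condition for triples of letters\<close>

abbreviation "shs \<equiv> [Sig (Suc 0), Mon h, Sig (Suc 0)]"
abbreviation "sig_word i \<equiv> (if i = Suc 0 then shs else [Sig i])"

text \<open>Reversing carries \<open>a\<close> across the whole block \<open>sig_word i\<close>: the
  block returns unchanged, and for \<open>i = 1\<close> the element leaves conjugated.\<close>

lemma grid_mon_Sig:
  assumes "a \<in> M" "1 \<le> i" "i < n"
  shows "grid (mword a) (sig_word i)
    (sig_word i)
    (mword (if i = Suc 0 then hconj_inv a else a))"
proof (cases "a = \<one>")
  case True
  then show ?thesis using grid_Nil1 by (simp add: mword_def)
next
  case False
  \<comment> \<open>Depth three for \<open>i = 1\<close>: the head cell, then the cancellation of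
    the common letters \<open>Mon h\<close> and \<open>Sig 1\<close>.\<close>
  have "rev_words (Suc (Suc (Suc 0))) [Mon a] (sig_word i)
    = Some (if i = Suc 0 then [Sig (Suc 0), Mon h, Sig (Suc 0)] else [Sig i],
      [Mon (if i = Suc 0 then hconj_inv a else a)])"
    using False by auto
  from rev_words_grid[OF this] show ?thesis using False assms by (auto simp: mword_def)
qed

lemma mon_Sig_eqv:
  assumes "a \<in> M" "1 \<le> i" "i < n"
  shows "mword a @ (sig_word i)
    \<approx> (sig_word i)
      @ mword (if i = Suc 0 then hconj_inv a else a)"
  using grid_eqv[OF grid_mon_Sig[OF assms]] .

text \<open>Every path through the cube ends at the lcm \<open>?L\<close> of the three elements; the
  witness \<open>?c\<close> is the quotient of \<open>?L\<close> by the lcm of \<open>s\<close> and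
  \<open>t\<close>.\<close>

lemma cube_Mon_Mon_Mon:
  assumes "r \<in> M - {\<one>}" "s \<in> M - {\<one>}" "t \<in> M - {\<one>}"
  shows "cube (Mon r) (Mon s) (Mon t)"
proof -
  let ?L = "lcmM (lcmM r s) t"
  have M: "r \<in> M" "s \<in> M" "t \<in> M" and L: "?L \<in> M" "lcmM s t \<in> M" using assms lcmM by auto
  have e: "lcmM (lcmM r t) s = ?L" "lcmM (lcmM s t) r = ?L" "lcmM (lcmM s r) t = ?L"
    "lcmM (lcmM t s) r = ?L" "lcmM (lcmM t r) s = ?L"
    using lcmM_left_comm M lcmM_sym by metis+
  let ?a = "quot (quot r s) (quot r t)" and ?b = "quot (quot r t) (quot r s)"
  let ?c = "inv (lcmM s t) \<otimes> ?L"
  have c: "?c \<in> M" using lcmM(2)[OF L(2) M(1)] e by simp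
  have dv: "inv s \<otimes> ?L \<in> M" "inv t \<otimes> ?L \<in> M"
    using quot_quot[of s r t] quot_quot[of t r s] e M by (metis M_mult quot_closed)+
  have a: "quot s r \<otimes> ?a = inv s \<otimes> ?L"
  proof -
    have "r \<otimes> (quot r s \<otimes> ?a) = ?L" using quot_quot[OF M] M L by simp
    moreover have "r \<otimes> (quot r s \<otimes> ?a) = s \<otimes> (quot s r \<otimes> ?a)"
      using M mult_quot[of r s] mult_quot[of s r] lcmM_sym[of r s] by (simp flip: m_assoc)
    ultimately show ?thesis using M by (metis inv_cancel(1) M_carrier M_mult quot_closed)
  qed
  have b: "quot t r \<otimes> ?b = inv t \<otimes> ?L"
  proof -
    have "r \<otimes> (quot r t \<otimes> ?b) = ?L" using quot_quot[OF M(1,3,2)] M L e by simp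
    moreover have "r \<otimes> (quot r t \<otimes> ?b) = t \<otimes> (quot t r \<otimes> ?b)"
      using M mult_quot[of r t] mult_quot[of t r] lcmM_sym[of r t] by (simp flip: m_assoc)
    ultimately show ?thesis using M by (metis inv_cancel(1) M_carrier M_mult quot_closed)
  qed
  have c': "quot s t \<otimes> ?c = inv s \<otimes> ?L" "quot t s \<otimes> ?c = inv t \<otimes> ?L"
    using M L lcmM_sym[of t s] by (simp_all add: quot_def m_assoc)
  have st: "Mon r \<in> letters" "Mon s \<in> letters" "Mon t \<in> letters" using assms by auto
  have a': "mword (quot s r) @ mword ?a \<approx> mword (quot s t) @ mword ?c"
    using mon_append[of "quot s r" ?a] mon_append[of "quot s t" ?c] a c' M c
    by (metis eqv_sym eqv_trans quot_closed)
  have b': "mword (quot t r) @ mword ?b \<approx> mword (quot t s) @ mword ?c"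
    using mon_append[of "quot t r" ?b] mon_append[of "quot t s" ?c] b c' M c
    by (metis eqv_sym eqv_trans quot_closed)
  show ?thesis
    by (rule cubeI[where a = "mword ?a" and b = "mword ?b" and c = "mword ?c"])
      (use grid_mon[of "quot r s" "quot r t"] a' b' M in
        \<open>simp_all only: mon_comp_eq st quot_closed\<close>)
qed

text \<open>The prefix \<open>?p\<close> is common to both complements of \<open>Sig i\<close> and
  drops out. The witness is \<open>sig_word i\<close>, through which \<open>quot s t\<close> passes
  with the conjugation \<open>?d\<close>.\<close>

lemma cube_Sig_Mon_Mon:
  assumes "s \<in> M - {\<one>}" "t \<in> M - {\<one>}" "1 \<le> i" "i < n"
  shows "cube (Sig i) (Mon s) (Mon t)"
proof -
  have M: "s \<in> M" "t \<in> M" and st: "Mon s \<in> letters" "Mon t \<in> letters" using assms by auto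
  let ?d = "\<lambda>a. if i = Suc 0 then hconj_inv a else a"
  let ?w = "sig_word i"
  let ?p = "if i = Suc 0 then [Mon h, Sig (Suc 0)] else []"
  have f: "compl (Sig i) (Mon a) = ?p @ mword (?d a)" "compl (Mon a) (Sig i) = ?w"
    if "Mon a \<in> letters" for a
    using that by (auto simp: mword_def)
  have "grid (?p @ mword (?d s)) (?p @ mword (?d t)) (mword (quot (?d s) (?d t))) (mword (quot (?d t) (?d s)))"
    using assms by (intro grid_prefix grid_mon) auto
  moreover have "quot (?d s) (?d t) = ?d (quot s t)" "quot (?d t) (?d s) = ?d (quot t s)"
    using M by (simp_all add: quot_hconj_inv)
  ultimately have g: "grid (?p @ mword (?d s)) (?p @ mword (?d t)) (mword (?d (quot s t))) (mword (?d (quot t s)))"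
    by simp
  show ?thesis
    unfolding cube_def f[OF st(1)] f[OF st(2)] mon_comp_eq[OF st] mon_comp_eq[OF st(2,1)]
    using g eqv_sym[OF mon_Sig_eqv[OF quot_closed[OF M] assms(3,4)]]
      eqv_sym[OF mon_Sig_eqv[OF quot_closed[OF M(2,1)] assms(3,4)]] by blast
qed

text \<open>The witness is \<open>quot s r\<close> after crossing \<open>sig_word i\<close>; the
  second equation is \<open>r \<otimes> quot r s = s \<otimes> quot s r\<close> under the
  conjugation \<open>?d\<close>.\<close>

lemma cube_Mon_Mon_Sig:
  assumes "r \<in> M - {\<one>}" "s \<in> M - {\<one>}" "1 \<le> i" "i < n"
  shows "cube (Mon r) (Mon s) (Sig i)"
proof -
  have M: "r \<in> M" "s \<in> M" and rs: "Mon r \<in> letters" "Mon s \<in> letters" using assms by auto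
  let ?d = "\<lambda>a. if i = Suc 0 then hconj_inv a else a"
  let ?w = "sig_word i"
  let ?p = "if i = Suc 0 then [Mon h, Sig (Suc 0)] else []"
  have f: "compl (Sig i) (Mon a) = ?p @ mword (?d a)" "compl (Mon a) (Sig i) = ?w"
    if "Mon a \<in> letters" for a
    using that by (auto simp: mword_def)
  have d: "mword (?d a) @ mword (?d b) \<approx> mword (?d (a \<otimes> b))" if "a \<in> M" "b \<in> M" for a b
    using mon_append[of a b] mon_append[of "hconj_inv a" "hconj_inv b"] that by (simp add: hconj_inv_mult)
  have "r \<otimes> quot r s = s \<otimes> quot s r" using M by (simp add: mult_quot lcmM_sym)
  then have "mword (?d r) @ mword (?d (quot r s)) \<approx> mword (?d s) @ mword (?d (quot s r))"
    using d[of r "quot r s"] d[of s "quot s r"] M by (metis eqv_sym eqv_trans quot_closed)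
  then have 1: "(?p @ mword (?d r)) @ mword (?d (quot r s)) \<approx> (?p @ mword (?d s)) @ mword (?d (quot s r))"
    by (simp only: append.assoc eqv_prepend)
  show ?thesis
    unfolding cube_def f[OF rs(1)] f[OF rs(2)] mon_comp_eq[OF rs] mon_comp_eq[OF rs(2,1)]
    using grid_mon_Sig[OF quot_closed[OF M] assms(3,4)] 1
      mon_Sig_eqv[OF quot_closed[OF M(2,1)] assms(3,4)] by blast
qed


section \<open>Cubes with at least two braid letters\<close>

lemma adj_sym: "adj i j \<longleftrightarrow> adj j i"
  by (auto simp: adj_def)

lemma adj_irrefl [simp]: "\<not> adj i i"
  by (auto simp: adj_def)

lemma adj_triangle: "adj i j \<Longrightarrow> adj i k \<Longrightarrow> \<not> adj j k"
  by (auto simp: adj_def)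

text \<open>The indices form a path, which has no triangle. At most two of the three pairs therefore
  satisfy a braid relation, and reversing is run in each remaining pattern.\<close>

lemma cube_Sig_Sig_Sig:
  assumes "Sig i \<in> letters" "Sig j \<in> letters" "Sig k \<in> letters"
  shows "cube (Sig i) (Sig j) (Sig k)"
proof (cases "i = j \<or> i = k \<or> j = k")
  case True
  then show ?thesis using assms by (intro cube_degenerate) auto
next
  case False
  then have "cube_check 12 (Sig i) (Sig j) (Sig k)"
    using adj_triangle[of i j k] adj_triangle[of j i k] adj_triangle[of k i j]
      adj_sym[of j i] adj_sym[of k i] adj_sym[of k j]
    by (cases "adj i j"; cases "adj i k"; cases "adj j k")
      (simp_all add: cube_check_def numeral_eq_Suc)
  from cube_checkD[OF this assms] show ?thesis .
qed

text \<open>For \<open>a = h\<close> these are cubes of type B. The position of \<open>Mon a\<close>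
  as last letter follows from the second claim by \<open>cube_sym\<close>.\<close>

lemma cube_one_Mon:
  assumes "Mon a \<in> letters" "Sig i \<in> letters" "Sig j \<in> letters"
  shows "cube (Mon a) (Sig i) (Sig j)" "cube (Sig i) (Mon a) (Sig j)"
proof -
  have "cube_check 16 (Mon a) (Sig i) (Sig j) \<and> cube_check 16 (Sig i) (Mon a) (Sig j)" if "i \<noteq> j"
    using that adj_sym[of j i] adj_irrefl[of "Suc 0"]
    by (cases "adj i j"; cases "i = Suc 0"; cases "j = Suc 0")
      (simp_all add: cube_check_def numeral_eq_Suc)
  then show "cube (Mon a) (Sig i) (Sig j)" "cube (Sig i) (Mon a) (Sig j)"
    using cube_checkD assms cube_degenerate by (metis, metis)
qed

sublocale garside_presentation letters compl norm
proof
  fix r s t assume "r \<in> letters" "s \<in> letters" "t \<in> letters"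
  then show "cube r s t"
    by (elim letters_cases)
      (simp_all add: cube_Mon_Mon_Mon cube_Sig_Mon_Mon cube_Mon_Mon_Sig cube_one_Mon
        cube_Sig_Sig_Sig cube_sym[OF cube_Mon_Mon_Sig] cube_sym[OF cube_one_Mon(2)])
qed (use norm_Cons_less norm_relation in blast)+

end

section \<open>The Garside element\<close>

context complemented
begin

lemma eqv_map:
  assumes "u \<approx> v" "\<And>s t. s \<in> S \<Longrightarrow> t \<in> S \<Longrightarrow> f (g s) (g t) = map g (f s t)"
    "\<And>s. s \<in> S \<Longrightarrow> g s \<in> S"
  shows "map g u \<approx> map g v"
  using assms(1) unfolding eqv_def
proof (induction rule: rtranclp_induct)
  case (step v w)
  from step(2) have "step (map g v) (map g w)"
  proof cases
    case (step s t p q)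
    then show ?thesis
      using step.step[of "g s" "g t" "map g p" "map g q"] assms(2,3) by simp
  qed
  with step.IH show ?case by simp
qed simp

lemma commute_word:
  "(\<And>t. t \<in> set w \<Longrightarrow> [s, t] \<approx> [t, s]) \<Longrightarrow> s # w \<approx> w @ [s]"
proof (induction w)
  case (Cons t w)
  have "s # t # w \<approx> t # s # w" using eqv_postpend[of "[s, t]" "[t, s]" w] Cons.prems by simp
  also have "\<dots> \<approx> t # w @ [s]" using Cons by (intro eqv_Cons) auto
  finally show ?case by simp
qed simp

end

definition wpow :: "'b list \<Rightarrow> nat \<Rightarrow> 'b list" where "wpow w k = concat (replicate k w)"

lemma wpow_simps: "wpow w 0 = []" "wpow w (Suc k) = w @ wpow w k"
  by (simp_all add: wpow_def)

lemma wpow_add: "wpow w (k + l) = wpow w k @ wpow w l"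
  by (simp add: wpow_def replicate_add)

lemma wpow_Suc_right: "wpow w (Suc k) = wpow w k @ w"
  using wpow_add[of w k 1] by (simp add: wpow_def)

lemma wpow_letters: "set w \<subseteq> A \<Longrightarrow> set (wpow w k) \<subseteq> A"
  by (auto simp: wpow_def)

context garside_datum
begin

section \<open>The automorphism of words induced by conjugation with h\<close>

definition hconj :: "'a \<Rightarrow> 'a" where "hconj a = h \<otimes> a \<otimes> inv h"

lemma hconj_closed [simp, intro]: "a \<in> M \<Longrightarrow> hconj a \<in> M"
  by (simp add: hconj_def conj_closed)

lemma hconj_inv_hconj [simp]: "a \<in> M \<Longrightarrow> hconj_inv (hconj a) = a"
  by (simp add: hconj_def hconj_inv_def m_assoc)

lemma hconj_hconj_inv [simp]: "a \<in> M \<Longrightarrow> hconj (hconj_inv a) = a"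
  by (simp add: hconj_def conj_hconj_inv)

lemma hconj_h [simp]: "hconj h = h"
  using hconj_hconj_inv[of h] by simp

lemma hconj_pow_closed [simp, intro]: "a \<in> M \<Longrightarrow> (hconj ^^ k) a \<in> M"
  by (induction k) auto

lemma hconj_inj: "a \<in> M \<Longrightarrow> b \<in> M \<Longrightarrow> hconj a = hconj b \<longleftrightarrow> a = b"
  by (metis hconj_inv_hconj)

lemma hconj_eq_one [simp]: "a \<in> M \<Longrightarrow> hconj a = \<one> \<longleftrightarrow> a = \<one>"
  by (metis hconj_inv_hconj hconj_inv_eq_one hconj_closed)

lemma quot_hconj: "a \<in> M \<Longrightarrow> b \<in> M \<Longrightarrow> quot (hconj a) (hconj b) = hconj (quot a b)"
  using quot_hconj_inv[of "hconj a" "hconj b"] by (metis hconj_inv_hconj hconj_closed hconj_hconj_inv quot_closed)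

fun tw :: "'a letter \<Rightarrow> 'a letter" where
  "tw (Mon a) = Mon (hconj a)"
| "tw (Sig i) = Sig i"

lemma tw_letters: "s \<in> letters \<Longrightarrow> tw s \<in> letters"
  by (auto elim!: letters_cases)

lemma map_tw_mword: "a \<in> M \<Longrightarrow> map tw (mword a) = mword (hconj a)"
  by (simp add: mword_def)

lemma compl_tw: "s \<in> letters \<Longrightarrow> t \<in> letters \<Longrightarrow> compl (tw s) (tw t) = map tw (compl s t)"
  by (elim letters_cases) (simp_all add: hconj_inj quot_hconj map_tw_mword)

text \<open>Conjugation by \<open>Delta\<close> turns out to be \<open>twist n\<close>: each of its
  \<open>n\<close> Jucys-Murphy factors contributes one \<open>tw\<close> on the letters of
  \<open>M\<close>.\<close>

definition twist :: "nat \<Rightarrow> 'a letter list \<Rightarrow> 'a letter list" where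
  "twist k = (map tw) ^^ k"

lemma twist_eqv: "u \<approx> v \<Longrightarrow> twist k u \<approx> twist k v"
  unfolding twist_def by (induction k) (auto intro!: eqv_map compl_tw tw_letters)

lemma twist_append: "twist k (u @ v) = twist k u @ twist k v"
  unfolding twist_def by (induction k) auto

lemma twist_Nil [simp]: "twist k [] = []"
  unfolding twist_def by (induction k) auto

lemma twist_Sig [simp]: "twist k [Sig i] = [Sig i]"
  unfolding twist_def by (induction k) auto

lemma twist_Mon: "twist k [Mon a] = [Mon ((hconj ^^ k) a)]"
  unfolding twist_def by (induction k) auto

lemma twist_letters: "valid w \<Longrightarrow> valid (twist k w)"
  unfolding twist_def by (induction k) (auto dest: tw_letters)

text \<open>\<open>hconj_inv\<close> inverts \<open>hconj\<close> on \<open>M\<close>. Surjectivity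
  is what allows a given word to the left of \<open>Delta\<close> to be moved to its right.\<close>

lemma twist_surj:
  assumes "valid w"
  shows "\<exists>w'. valid w' \<and> twist k w' = w"
proof -
  have 1: "\<exists>w'. valid w' \<and> map tw w' = w" if "valid w" for w
    using that
  proof (induction w)
    case (Cons s w)
    then obtain w' where w': "valid w'" "map tw w' = w" by auto
    have "\<exists>s'\<in>letters. tw s' = s"
    proof -
      have "s \<in> letters" using Cons by simp
      then show ?thesis
      proof (cases rule: letters_cases)
        case (1 a)
        then show ?thesis by (intro bexI[of _ "Mon (hconj_inv a)"]) auto
      next
        case (2 i)
        then show ?thesis by (intro bexI[of _ "Sig i"]) auto
      qed
    qed
    then obtain s' where "s' \<in> letters" "tw s' = s" by blast
    with w' show ?case by (intro exI[of _ "s' # w'"]) simp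
  qed simp
  show ?thesis unfolding twist_def
    using assms by (induction k arbitrary: w) (auto, metis 1)
qed

section \<open>Powers of the element h sigma_1 ... sigma_(m-1)\<close>

abbreviation "sigs xs \<equiv> map Sig xs"

lemma Sig_far: "1 \<le> i \<Longrightarrow> i + 2 \<le> j \<Longrightarrow> j < n \<Longrightarrow> [Sig i, Sig j] \<approx> [Sig j, Sig i]"
  using eqv_comp[of "Sig i" "Sig j"] by (simp add: adj_def)

lemma Sig_braid:
  "1 \<le> i \<Longrightarrow> Suc i < n \<Longrightarrow> [Sig i, Sig (Suc i), Sig i] \<approx> [Sig (Suc i), Sig i, Sig (Suc i)]"
  using eqv_comp[of "Sig i" "Sig (Suc i)"] by (simp add: adj_def)

lemma Mon_Sig_comm: "a \<in> M \<Longrightarrow> 2 \<le> i \<Longrightarrow> i < n \<Longrightarrow> mword a @ [Sig i] \<approx> [Sig i] @ mword a"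
  using mon_Sig_eqv[of a i] by simp

lemma h_Sig_comm: "2 \<le> i \<Longrightarrow> i < n \<Longrightarrow> [Mon h, Sig i] \<approx> [Sig i, Mon h]"
  using Mon_Sig_comm[of h i] by (simp add: mword_def)

lemma mword_h: "mword h = [Mon h]"
  by (simp add: mword_def)

lemma Mon_Sig1:
  "a \<in> M \<Longrightarrow> 1 < n \<Longrightarrow> mword (hconj a) @ shs
    \<approx> shs @ mword a"
  using mon_Sig_eqv[of "hconj a" 1] by simp

text \<open>\<open>sigma_i\<close> slides left over the higher generators, a braid relation turns it
  into \<open>sigma_(i+1)\<close>, and this slides over the lower ones.\<close>

lemma sigs_shift:
  assumes "1 \<le> i" "Suc i < m" "m \<le> n"
  shows "sigs [1..<m] @ [Sig i] \<approx> [Sig (Suc i)] @ sigs [1..<m]"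
proof -
  let ?p = "sigs [1..<i]" and ?q = "sigs [Suc (Suc i)..<m]"
  have "[1..<m] = [1..<i] @ [i..<m]" using assms upt_add_eq_append[of 1 i "m - i"] by simp
  also have "[i..<m] = i # Suc i # [Suc (Suc i)..<m]" using assms by (simp add: upt_conv_Cons)
  finally have e: "sigs [1..<m] = ?p @ [Sig i, Sig (Suc i)] @ ?q" by simp
  have q: "Sig i # ?q \<approx> ?q @ [Sig i]"
    using assms by (intro commute_word) (auto intro!: Sig_far)
  have p: "Sig (Suc i) # ?p \<approx> ?p @ [Sig (Suc i)]"
    using assms by (intro commute_word) (auto intro!: eqv_sym[OF Sig_far])
  have "sigs [1..<m] @ [Sig i] = (?p @ [Sig i, Sig (Suc i)]) @ ?q @ [Sig i]" using e by simp
  also have "\<dots> \<approx> (?p @ [Sig i, Sig (Suc i)]) @ Sig i # ?q"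
    by (rule eqv_prepend[OF eqv_sym[OF q]])
  also have "\<dots> = ?p @ [Sig i, Sig (Suc i), Sig i] @ ?q" by simp
  also have "\<dots> \<approx> ?p @ [Sig (Suc i), Sig i, Sig (Suc i)] @ ?q"
    using assms by (intro eqv_context Sig_braid) auto
  also have "\<dots> = (?p @ [Sig (Suc i)]) @ [Sig i, Sig (Suc i)] @ ?q" by simp
  also have "\<dots> \<approx> (Sig (Suc i) # ?p) @ [Sig i, Sig (Suc i)] @ ?q"
    by (rule eqv_postpend[OF eqv_sym[OF p]])
  also have "\<dots> = [Sig (Suc i)] @ sigs [1..<m]" unfolding e by simp
  finally show ?thesis .
qed

text \<open>Named after a Coxeter element of type B, which it is for \<open>M\<close> free on
  \<open>h\<close>. The parameter \<open>m\<close> permits induction on the number of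
  strands.\<close>

definition cox :: "nat \<Rightarrow> 'a letter list" where "cox m = Mon h # sigs [1..<m]"

lemma cox_Suc: "1 \<le> m \<Longrightarrow> cox (Suc m) = cox m @ [Sig m]"
  by (simp add: cox_def)

lemma cox_shift:
  assumes "1 \<le> i" "Suc i < m" "m \<le> n"
  shows "cox m @ [Sig i] \<approx> [Sig (Suc i)] @ cox m"
proof -
  have "cox m @ [Sig i] \<approx> [Mon h] @ [Sig (Suc i)] @ sigs [1..<m]"
    using eqv_prepend[OF sigs_shift[OF assms], of "[Mon h]"] by (simp add: cox_def)
  also have "\<dots> \<approx> [Sig (Suc i), Mon h] @ sigs [1..<m]"
    using eqv_postpend[OF h_Sig_comm[of "Suc i"], of "sigs [1..<m]"] assms by simp
  finally show ?thesis by (simp add: cox_def)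
qed

lemma shift_word:
  assumes "\<And>i. i \<in> set xs \<Longrightarrow> w @ [Sig i] \<approx> [Sig (Suc i)] @ w"
  shows "w @ sigs xs \<approx> sigs (map Suc xs) @ w"
  using assms
proof (induction xs)
  case (Cons i xs)
  have "w @ sigs (i # xs) \<approx> ([Sig (Suc i)] @ w) @ sigs xs"
    using eqv_postpend[OF Cons.prems[of i], of "sigs xs"] by simp
  also have "\<dots> \<approx> [Sig (Suc i)] @ sigs (map Suc xs) @ w"
    using eqv_prepend[OF Cons.IH, of "[Sig (Suc i)]"] Cons.prems by simp
  finally show ?case by simp
qed simp

text \<open>The length-four relation \<open>hs\<close> brings \<open>sigma_1\<close> to the front of
  the square. The word in the second claim is the one in the first with \<open>sigma_(m-1)\<close>
  appended; the first claim alone shows that \<open>sigma_1\<close> divides the square.\<close>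

lemma cox_square_split:
  assumes "2 \<le> m" "m \<le> n"
  shows "cox m @ cox m \<approx> [Sig 1, Mon h, Sig 1, Mon h] @ sigs [2..<m] @ sigs [1..<m - 1]"
    and "[Sig 1, Mon h, Sig 1, Mon h] @ sigs [2..<m] @ sigs [1..<m] \<approx> [Sig 1] @ cox m @ cox m"
proof -
  let ?d = "sigs [2..<m]" and ?c = "sigs [1..<m]"
  have c: "?c = Sig 1 # ?d" using assms by (simp add: upt_conv_Cons numeral_2_eq_2)
  have hd: "Mon h # ?d \<approx> ?d @ [Mon h]"
    using assms by (intro commute_word) (auto intro!: h_Sig_comm)
  have "?c @ sigs [1..<m - 1] \<approx> sigs (map Suc [1..<m - 1]) @ ?c"
    using assms by (intro shift_word sigs_shift) auto
  moreover have "map Suc [1..<m - 1] = [2..<m]"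
    using assms map_Suc_upt[of 1 "m - 1"] by (simp add: numeral_2_eq_2)
  ultimately have dc: "?d @ ?c \<approx> ?c @ sigs [1..<m - 1]" by (metis eqv_sym)
  have hs: "[Mon h, Sig 1, Mon h, Sig 1] \<approx> [Sig 1, Mon h, Sig 1, Mon h]"
    using Mon_Sig1[of h] assms by (simp add: mword_h)
  have "cox m @ cox m = [Mon h, Sig 1] @ (?d @ [Mon h]) @ ?c"
    unfolding cox_def c by simp
  also have "\<dots> \<approx> [Mon h, Sig 1] @ (Mon h # ?d) @ ?c"
    by (rule eqv_context[OF eqv_sym[OF hd]])
  also have "\<dots> = [Mon h, Sig 1, Mon h] @ ?d @ ?c" by simp
  also have "\<dots> \<approx> [Mon h, Sig 1, Mon h] @ ?c @ sigs [1..<m - 1]" by (rule eqv_prepend[OF dc])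
  also have "\<dots> = [Mon h, Sig 1, Mon h, Sig 1] @ ?d @ sigs [1..<m - 1]"
    by (subst c) (simp only: append_Cons append_Nil)
  also have "\<dots> \<approx> [Sig 1, Mon h, Sig 1, Mon h] @ ?d @ sigs [1..<m - 1]"
    by (rule eqv_postpend[OF hs])
  finally show "cox m @ cox m \<approx> [Sig 1, Mon h, Sig 1, Mon h] @ ?d @ sigs [1..<m - 1]" .
  have "[Sig 1, Mon h, Sig 1, Mon h] @ ?d @ ?c = [Sig 1, Mon h, Sig 1] @ (Mon h # ?d) @ ?c" by simp
  also have "\<dots> \<approx> [Sig 1, Mon h, Sig 1] @ (?d @ [Mon h]) @ ?c" by (rule eqv_context[OF hd])
  also have "\<dots> = [Sig 1] @ cox m @ cox m" unfolding cox_def c by simp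
  finally show "[Sig 1, Mon h, Sig 1, Mon h] @ ?d @ ?c \<approx> [Sig 1] @ cox m @ cox m" .
qed

lemma cox_square:
  assumes "2 \<le> m" "m \<le> n"
  shows "cox m @ cox m @ [Sig (m - 1)] \<approx> [Sig 1] @ cox m @ cox m"
proof -
  have "sigs [1..<m] = sigs [1..<m - 1] @ [Sig (m - 1)]"
    using assms upt_Suc_append[of 1 "m - 1"] by simp
  then show ?thesis
    using eqv_trans[OF eqv_postpend[OF cox_square_split(1)[OF assms], of "[Sig (m - 1)]"]]
      cox_square_split(2)[OF assms] by (metis append.assoc)
qed

text \<open>A new factor \<open>cox m @ [Sig m]\<close> is moved left across the descending run
  collected so far; it lowers the run by one and adds the top letter. For \<open>k = m\<close> the
  run is \<open>sigma_m ... sigma_1\<close>.\<close>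

lemma wpow_cox_Suc:
  assumes "1 \<le> m" "Suc m \<le> n" "k \<le> m"
  shows "wpow (cox (Suc m)) k \<approx> wpow (cox m) k @ sigs (rev [Suc m - k..<Suc m])"
  using assms(3)
proof (induction k)
  case 0
  then show ?case by (simp add: wpow_simps)
next
  case (Suc k)
  let ?c = "cox (Suc m)"
  have e1: "map Suc (rev [m - k..<m]) = rev [Suc m - k..<Suc m]"
    using Suc.prems by (simp add: rev_map[symmetric] map_Suc_upt Suc_diff_le)
  have e2: "[Sig m] @ sigs (rev [m - k..<m]) = sigs (rev [Suc m - Suc k..<Suc m])"
    using Suc.prems by simp
  have sh: "?c @ sigs (rev [m - k..<m]) \<approx> sigs (rev [Suc m - k..<Suc m]) @ ?c"
    unfolding e1[symmetric] using assms Suc.prems by (intro shift_word cox_shift) auto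
  have "wpow ?c (Suc k) \<approx> (wpow (cox m) k @ sigs (rev [Suc m - k..<Suc m])) @ ?c"
    unfolding wpow_Suc_right using Suc by (intro eqv_postpend) auto
  also have "\<dots> \<approx> wpow (cox m) k @ ?c @ sigs (rev [m - k..<m])"
    using eqv_prepend[OF eqv_sym[OF sh]] by simp
  also have "\<dots> = wpow (cox m) (Suc k) @ [Sig m] @ sigs (rev [m - k..<m])"
    using assms by (simp add: cox_Suc wpow_Suc_right)
  finally show ?case unfolding e2 .
qed

lemma mword_sigs_comm:
  assumes "b \<in> M" "\<And>i. i \<in> set xs \<Longrightarrow> 2 \<le> i \<and> i < n"
  shows "mword b @ sigs xs \<approx> sigs xs @ mword b"
proof (cases "b = \<one>")
  case False
  have "Mon b # sigs xs \<approx> sigs xs @ [Mon b]"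
    using Mon_Sig_comm[of b] assms False by (intro commute_word) (auto simp: mword_def)
  then show ?thesis using False by (simp add: mword_def)
qed (simp add: mword_def)

text \<open>\<open>\<sigma>\<^sub>m\<dots>\<sigma>\<^sub>1 h \<sigma>\<^sub>1\<dots>\<sigma>\<^sub>m\<close> is a Jucys-Murphy element, and \<open>\<Delta>\<close> is the product of these.\<close>

lemma mword_J:
  assumes "a \<in> M" "1 \<le> m" "m < n"
  shows "mword (hconj a) @ sigs (rev [1..<Suc m]) @ cox (Suc m)
    \<approx> sigs (rev [1..<Suc m]) @ cox (Suc m) @ mword a"
proof -
  let ?r = "sigs (rev [2..<Suc m])" and ?d = "sigs [2..<Suc m]"
  have u: "[1..<Suc m] = 1 # [2..<Suc m]" using assms by (simp add: upt_conv_Cons numeral_2_eq_2 del: upt_Suc)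
  have e: "sigs (rev [1..<Suc m]) @ cox (Suc m) = ?r @ shs @ ?d"
    unfolding cox_def u by simp
  have "mword (hconj a) @ ?r @ shs @ ?d
      \<approx> ?r @ mword (hconj a) @ shs @ ?d"
    using eqv_postpend[OF mword_sigs_comm[of "hconj a" "rev [2..<Suc m]"]] assms by (simp del: upt_Suc)
  also have "\<dots> \<approx> ?r @ (shs @ mword a) @ ?d"
    using eqv_context[OF Mon_Sig1[OF assms(1)], of ?r ?d] assms by (simp del: upt_Suc)
  also have "\<dots> \<approx> ?r @ shs @ ?d @ mword a"
    using eqv_prepend[OF mword_sigs_comm[of a "[2..<Suc m]"], of "?r @ shs"] assms
    by (simp del: upt_Suc)
  finally show ?thesis using e by (metis append.assoc)
qed

text \<open>The word is a product of \<open>m\<close> Jucys-Murphy elements, the first being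
  \<open>h\<close> itself, and each conjugates by \<open>h\<close> once. This explains the exponent
  of \<open>hconj\<close>.\<close>

lemma mword_cox_power:
  assumes "a \<in> M" "1 \<le> m" "m \<le> n"
  shows "mword ((hconj ^^ m) a) @ wpow (cox m) m \<approx> wpow (cox m) m @ mword a"
  using assms(2,3,1)
proof (induction m arbitrary: a rule: dec_induct)
  case base
  have "mword (hconj a) @ mword h \<approx> mword (hconj a \<otimes> h)" using base by (intro mon_append) auto
  also have "hconj a \<otimes> h = h \<otimes> a" using base by (simp add: hconj_def m_assoc)
  also have "mword (h \<otimes> a) \<approx> mword h @ mword a" using base by (intro eqv_sym[OF mon_append]) auto
  finally show ?case by (simp add: cox_def wpow_def mword_h)
next
  case (step m)
  let ?J = "sigs (rev [1..<Suc m]) @ cox (Suc m)"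
  \<comment> \<open>The case \<open>k = m\<close> of \<open>wpow_cox_Suc\<close> together with the
    last factor splits off the new Jucys-Murphy element \<open>?J\<close>.\<close>
  have D: "wpow (cox (Suc m)) (Suc m) \<approx> wpow (cox m) m @ ?J"
    using eqv_postpend[OF wpow_cox_Suc[of m m], of "cox (Suc m)"] step
    by (simp add: wpow_Suc_right del: upt_Suc)
  have "mword ((hconj ^^ Suc m) a) @ wpow (cox (Suc m)) (Suc m)
      \<approx> mword ((hconj ^^ m) (hconj a)) @ wpow (cox m) m @ ?J"
    using eqv_prepend[OF D] by (simp add: funpow_swap1)
  also have "\<dots> \<approx> wpow (cox m) m @ mword (hconj a) @ ?J"
    using eqv_postpend[OF step.IH[of "hconj a"], of ?J] step.prems by simp
  also have "\<dots> \<approx> wpow (cox m) m @ ?J @ mword a"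
    using eqv_prepend[OF mword_J[of a m], of "wpow (cox m) m"] step by simp
  also have "\<dots> \<approx> wpow (cox (Suc m)) (Suc m) @ mword a"
    using eqv_postpend[OF eqv_sym[OF D], of "mword a"] by simp
  finally show ?case .
qed

definition Delta :: "'a letter list" where "Delta = wpow (cox n) n"

lemma cox_letters: "1 \<le> m \<Longrightarrow> m \<le> n \<Longrightarrow> valid (cox m)"
  by (auto simp: cox_def)

lemma Delta_letters: "valid Delta"
  unfolding Delta_def using n_pos by (intro wpow_letters cox_letters) auto

lemma cox_power_Sig:
  assumes "1 \<le> i" "i + k < n"
  shows "wpow (cox n) k @ [Sig i] \<approx> [Sig (i + k)] @ wpow (cox n) k"
  using assms(2)
proof (induction k)
  case 0
  then show ?case by (simp add: wpow_simps)
next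
  case (Suc k)
  have "wpow (cox n) (Suc k) @ [Sig i] \<approx> cox n @ [Sig (i + k)] @ wpow (cox n) k"
    using eqv_prepend[OF Suc.IH] Suc.prems by (simp add: wpow_simps)
  also have "\<dots> \<approx> ([Sig (Suc (i + k))] @ cox n) @ wpow (cox n) k"
    using eqv_postpend[OF cox_shift[of "i + k" n]] Suc.prems assms by simp
  finally show ?case by (simp add: wpow_simps)
qed

text \<open>A single factor cannot shift \<open>sigma_(n-1)\<close> further. Two factors wrap it
  round to \<open>sigma_1\<close>, and the other \<open>i - 1\<close> raise that to
  \<open>sigma_i\<close>.\<close>

lemma cox_power_Sig1:
  assumes "1 \<le> i" "i < n"
  shows "wpow (cox n) (Suc i) = wpow (cox n) (i - 1) @ cox n @ cox n"
    and "wpow (cox n) (Suc i) @ [Sig (n - 1)] \<approx> [Sig i] @ wpow (cox n) (Suc i)"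
proof -
  show e: "wpow (cox n) (Suc i) = wpow (cox n) (i - 1) @ cox n @ cox n"
    using wpow_add[of "cox n" "i - 1" 2] assms by (simp add: wpow_def numeral_2_eq_2)
  have "wpow (cox n) (Suc i) @ [Sig (n - 1)] \<approx> wpow (cox n) (i - 1) @ [Sig 1] @ cox n @ cox n"
    unfolding e using eqv_prepend[OF cox_square[of n]] assms by simp
  also have "\<dots> \<approx> ([Sig i] @ wpow (cox n) (i - 1)) @ cox n @ cox n"
    using eqv_postpend[OF cox_power_Sig[of 1 "i - 1"], of "cox n @ cox n"] assms by simp
  finally show "wpow (cox n) (Suc i) @ [Sig (n - 1)] \<approx> [Sig i] @ wpow (cox n) (Suc i)" by (simp add: e)
qed

text \<open>A full turn: \<open>n - 1 - i\<close> factors raise \<open>sigma_i\<close> to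
  \<open>sigma_(n-1)\<close>, and the remaining \<open>i + 1\<close> bring it back to
  \<open>sigma_i\<close>.\<close>

lemma Delta_Sig:
  assumes "1 \<le> i" "i < n"
  shows "Delta @ [Sig i] \<approx> [Sig i] @ Delta"
proof -
  have e: "Delta = wpow (cox n) (Suc i) @ wpow (cox n) (n - 1 - i)"
    unfolding Delta_def wpow_add[symmetric] using assms by simp
  have "Delta @ [Sig i] \<approx> wpow (cox n) (Suc i) @ [Sig (n - 1)] @ wpow (cox n) (n - 1 - i)"
    unfolding e using eqv_prepend[OF cox_power_Sig[of i "n - 1 - i"]] assms by simp
  also have "\<dots> \<approx> ([Sig i] @ wpow (cox n) (Suc i)) @ wpow (cox n) (n - 1 - i)"
    using eqv_postpend[OF cox_power_Sig1(2)[OF assms], of "wpow (cox n) (n - 1 - i)"] by simp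
  finally show ?thesis by (simp add: e)
qed

lemma Delta_twist:
  assumes "valid w"
  shows "twist n w @ Delta \<approx> Delta @ w"
  using assms
proof (induction w)
  case (Cons s w)
  have s: "twist n [s] @ Delta \<approx> Delta @ [s]"
  proof -
    have "s \<in> letters" using Cons by simp
    then show ?thesis
    proof (cases rule: letters_cases)
      case (1 a)
      \<comment> \<open>This keeps \<open>mword\<close> of the conjugate a single letter.\<close>
      moreover have "(hconj ^^ k) a = \<one> \<longleftrightarrow> a = \<one>" for k
        using 1 by (induction k) simp_all
      ultimately show ?thesis using mword_cox_power[of a n] n_pos
        by (simp add: Delta_def mword_def twist_Mon)
    next
      case (2 i)
      then show ?thesis using eqv_sym[OF Delta_Sig[of i]] by simp
    qed
  qed
  have "twist n (s # w) @ Delta = twist n [s] @ twist n w @ Delta"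
    using twist_append[of n "[s]" w] by simp
  also have "\<dots> \<approx> twist n [s] @ Delta @ w" using Cons by (intro eqv_prepend) auto
  also have "\<dots> \<approx> Delta @ s # w" using eqv_postpend[OF s, of w] by simp
  finally show ?case .
qed simp

text \<open>Garside's induction cancels on the left. Words can be carried across
  \<open>Delta\<close>, which turns this into cancellation of \<open>Delta\<close> on the
  right.\<close>

lemma Delta_right_cancel:
  assumes "u @ Delta \<approx> v @ Delta" "valid u" "valid v"
  shows "u \<approx> v"
proof -
  obtain u' where u': "valid u'" "twist n u' = u"
    using twist_surj[OF assms(2), of n] by blast
  obtain v' where v': "valid v'" "twist n v' = v"
    using twist_surj[OF assms(3), of n] by blast
  have "Delta @ u' \<approx> Delta @ v'"
    using eqv_trans[OF eqv_sym[OF Delta_twist[OF u'(1)]] eqv_trans[OF _ Delta_twist[OF v'(1)]]]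
      assms(1) u'(2) v'(2) by simp
  then have "u' \<approx> v'" using left_cancel Delta_letters u'(1) by blast
  from twist_eqv[OF this, of n] show ?thesis using u'(2) v'(2) by simp
qed

lemma Delta_normal:
  assumes "valid w"
  shows "\<exists>w'. valid w' \<and> w @ Delta \<approx> Delta @ w'"
  using twist_surj[OF assms, of n] Delta_twist by blast

lemma Delta_power_normal:
  assumes "valid w"
  shows "\<exists>w'. valid w' \<and> w @ wpow Delta k \<approx> wpow Delta k @ w'"
  using assms
proof (induction k arbitrary: w)
  case 0
  then show ?case by (auto simp: wpow_simps)
next
  case (Suc k)
  obtain w1 where w1: "valid w1" "w @ Delta \<approx> Delta @ w1"
    using Delta_normal[OF Suc.prems] by blast
  obtain w2 where w2: "valid w2" "w1 @ wpow Delta k \<approx> wpow Delta k @ w2"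
    using Suc.IH[OF w1(1)] by blast
  have "w @ wpow Delta (Suc k) \<approx> Delta @ w1 @ wpow Delta k"
    using eqv_postpend[OF w1(2), of "wpow Delta k"] by (simp add: wpow_simps)
  also have "\<dots> \<approx> wpow Delta (Suc k) @ w2"
    using eqv_prepend[OF w2(2), of Delta] by (simp add: wpow_simps)
  finally show ?case using w2 by blast
qed

lemma Delta_power_right_cancel:
  "u @ wpow Delta k \<approx> v @ wpow Delta k \<Longrightarrow> valid u \<Longrightarrow> valid v \<Longrightarrow> u \<approx> v"
proof (induction k)
  case (Suc k)
  show ?case
  proof (rule Suc.IH)
    show "u @ wpow Delta k \<approx> v @ wpow Delta k"
      by (rule Delta_right_cancel)
        (use Suc.prems wpow_letters[OF Delta_letters, of k] in \<open>simp_all add: wpow_Suc_right\<close>)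
  qed (use Suc.prems in auto)
qed (simp add: wpow_simps)

text \<open>The square of \<open>cox n\<close> starts with \<open>sigma_1\<close>, and the
  \<open>i - 1\<close> factors in front of it shift that letter to \<open>sigma_i\<close>.\<close>

lemma Sig_divides_Delta:
  assumes "1 \<le> i" "i < n"
  shows "\<exists>q. valid q \<and> [Sig i] @ q \<approx> Delta"
proof -
  have "valid (cox n)" using cox_letters n_pos by blast
  then have L: "valid (wpow (cox n) k)" for k by (rule wpow_letters)
  have e: "Delta = wpow (cox n) (Suc i) @ wpow (cox n) (n - 1 - i)"
    unfolding Delta_def wpow_add[symmetric] using assms by simp
  let ?r = "[Mon h, Sig 1, Mon h] @ sigs [2..<n] @ sigs [1..<n - 1]"
  have cc: "cox n @ cox n \<approx> [Sig 1] @ ?r" using cox_square_split(1)[of n] assms by simp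
  let ?x = "?r @ wpow (cox n) (n - 1 - i)"
  have "Delta \<approx> wpow (cox n) (i - 1) @ ([Sig 1] @ ?r) @ wpow (cox n) (n - 1 - i)"
    unfolding e cox_power_Sig1(1)[OF assms] using eqv_context[OF cc] by simp
  also have "\<dots> \<approx> [Sig i] @ wpow (cox n) (i - 1) @ ?x"
    using eqv_postpend[OF cox_power_Sig[of 1 "i - 1"], of ?x] assms by simp
  finally have "[Sig i] @ wpow (cox n) (i - 1) @ ?x \<approx> Delta" by (rule eqv_sym)
  moreover have "valid (wpow (cox n) (i - 1) @ ?x)" using L assms by auto
  ultimately show ?thesis by blast
qed

lemma mword_divides_Delta:
  assumes "x \<in> M" "inv x \<otimes> h \<in> M"
  shows "\<exists>q. valid q \<and> mword x @ q \<approx> Delta"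
proof -
  let ?q = "sigs [1..<n] @ wpow (cox n) (n - 1)"
  have e: "Delta = mword h @ ?q"
    using wpow_simps(2)[of "cox n" "n - 1"] n_pos by (simp add: Delta_def cox_def mword_h)
  have "mword x @ mword (inv x \<otimes> h) \<approx> mword h"
    using mon_append[OF assms] assms by simp
  from eqv_postpend[OF this, of ?q] have "mword x @ mword (inv x \<otimes> h) @ ?q \<approx> Delta"
    by (simp add: e)
  moreover have "valid (mword (inv x \<otimes> h) @ ?q)"
    using wpow_letters[OF cox_letters[of n], of "n - 1"] n_pos mon_letters[OF assms(2)] by auto
  ultimately show ?thesis by blast
qed

section \<open>Divisors of powers of Delta and lcms of words\<close>

definition dvd_Dpow :: "'a letter list \<Rightarrow> bool" where
  "dvd_Dpow w \<longleftrightarrow> (\<exists>q k. valid q \<and> w @ q \<approx> wpow Delta k)"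

text \<open>With \<open>u p = Delta^k\<close> and \<open>v q = Delta^l\<close>, moving
  \<open>p\<close> across \<open>Delta^l\<close> makes room for the multiple of \<open>v\<close>
  directly behind \<open>u\<close>.\<close>

lemma dvd_Dpow_append:
  assumes "dvd_Dpow u" "dvd_Dpow v"
  shows "dvd_Dpow (u @ v)"
proof -
  obtain p k where p: "valid p" "u @ p \<approx> wpow Delta k" using assms(1) by (auto simp: dvd_Dpow_def)
  obtain q l where q: "valid q" "v @ q \<approx> wpow Delta l" using assms(2) by (auto simp: dvd_Dpow_def)
  obtain p' where p': "valid p'" "p @ wpow Delta l \<approx> wpow Delta l @ p'"
    using Delta_power_normal[OF p(1)] by blast
  have "u @ v @ q @ p' \<approx> u @ wpow Delta l @ p'" using eqv_context[OF q(2), of u p'] by simp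
  also have "\<dots> \<approx> u @ p @ wpow Delta l" by (rule eqv_prepend[OF eqv_sym[OF p'(2)]])
  also have "\<dots> \<approx> wpow Delta (k + l)" using eqv_postpend[OF p(2), of "wpow Delta l"] by (simp add: wpow_add)
  finally show ?thesis unfolding dvd_Dpow_def using p' q
    by (intro exI[of _ "q @ p'"] exI[of _ "k + l"]) simp
qed

lemma dvd_Dpow_eqv: "dvd_Dpow u \<Longrightarrow> u \<approx> v \<Longrightarrow> dvd_Dpow v"
  unfolding dvd_Dpow_def by (meson eqv_postpend eqv_sym eqv_trans)

lemma dvd_Dpow_Delta: "valid q \<Longrightarrow> w @ q \<approx> Delta \<Longrightarrow> dvd_Dpow w"
  unfolding dvd_Dpow_def by (intro exI[of _ q] exI[of _ 1]) (simp add: wpow_def)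

text \<open>\<open>M\<close> is generated by the left divisors of \<open>h\<close>, and
  \<open>h\<close> is the first letter of \<open>Delta\<close>.\<close>

lemma dvd_Dpow_mword: "a \<in> M \<Longrightarrow> dvd_Dpow (mword a)"
proof -
  have "x \<in> mgenerate H {x \<in> M. inv x \<otimes> h \<in> M} \<Longrightarrow> x \<in> M \<and> dvd_Dpow (mword x)" for x
  proof (induction rule: mgenerate.induct)
    case one
    show ?case by (auto simp: mword_def dvd_Dpow_def intro!: exI[of _ "[]"] exI[of _ 0] simp: wpow_def)
  next
    case (incl x)
    then show ?case using mword_divides_Delta[of x] dvd_Dpow_Delta by blast
  next
    case (mult x y)
    then show ?case using dvd_Dpow_append[of "mword x" "mword y"] dvd_Dpow_eqv mon_append[of x y] by auto
  qed
  from this[of a] show "a \<in> M \<Longrightarrow> dvd_Dpow (mword a)" unfolding M_generated by blast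
qed

lemma word_divides_Delta_power: "valid w \<Longrightarrow> dvd_Dpow w"
proof (induction w)
  case Nil
  show ?case by (auto simp: dvd_Dpow_def wpow_def intro!: exI[of _ "[]"] exI[of _ 0])
next
  case (Cons s w)
  have "s \<in> letters" using Cons by simp
  then have "dvd_Dpow [s]"
  proof (cases rule: letters_cases)
    case (1 a)
    then show ?thesis using dvd_Dpow_mword[of a] by (simp add: mword_def)
  next
    case (2 i)
    then show ?thesis using Sig_divides_Delta[of i] dvd_Dpow_Delta by blast
  qed
  then show ?case using dvd_Dpow_append[of "[s]" w] Cons by simp
qed

lemma word_common_multiple:
  assumes "valid u" "valid v"
  shows "\<exists>p q. valid p \<and> valid q \<and> u @ p \<approx> v @ q"
proof -
  obtain p k where p: "valid p" "u @ p \<approx> wpow Delta k"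
    using word_divides_Delta_power[OF assms(1)] by (auto simp: dvd_Dpow_def)
  obtain q l where q: "valid q" "v @ q \<approx> wpow Delta l"
    using word_divides_Delta_power[OF assms(2)] by (auto simp: dvd_Dpow_def)
  have "u @ p @ wpow Delta l \<approx> wpow Delta (k + l)"
    using eqv_postpend[OF p(2), of "wpow Delta l"] by (simp add: wpow_add)
  moreover have "v @ q @ wpow Delta k \<approx> wpow Delta (k + l)"
    using eqv_postpend[OF q(2), of "wpow Delta k"] by (simp add: wpow_add[symmetric] add.commute)
  ultimately have "u @ p @ wpow Delta l \<approx> v @ q @ wpow Delta k" using eqv_sym eqv_trans by blast
  then show ?thesis using p q wpow_letters[OF Delta_letters]
    by (intro exI[of _ "p @ wpow Delta l"] exI[of _ "q @ wpow Delta k"]) auto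
qed

text \<open>A common power of \<open>Delta\<close> guarantees a diagram, and its opposite corner is
  the lcm.\<close>

lemma word_lcm:
  assumes "valid u" "valid v"
  shows "\<exists>a b. valid a \<and> valid b \<and> u @ a \<approx> v @ b \<and>
    (\<forall>w w'. valid w \<longrightarrow> u @ w \<approx> v @ w' \<longrightarrow> (\<exists>z. valid z \<and> w \<approx> a @ z))"
proof -
  obtain p q where "valid p" "u @ p \<approx> v @ q" using word_common_multiple[OF assms] by blast
  then obtain a b where g: "grid u v a b" using grid_exists assms by blast
  have "\<exists>z. valid z \<and> w \<approx> a @ z" if w: "valid w" "u @ w \<approx> v @ w'" for w w'
  proof -
    obtain z where z: "w \<approx> a @ z" using grid_lcm[OF g w(2) assms(1) w(1)] by blast
    then show ?thesis using eqv_letters[OF z] w by auto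
  qed
  then show ?thesis using grid_letters[OF g assms] grid_eqv[OF g] by blast
qed

end

section \<open>Fractions of words\<close>

lemma presented_group_induct [consumes 1, case_names one gen mult inv]:
  assumes "x \<in> carrier (presented_group S R)"
    and "P \<one>\<^bsub>presented_group S R\<^esub>"
    and "\<And>s. s \<in> S \<Longrightarrow> P (pres_gen S R s)"
    and "\<And>x y. x \<in> carrier (presented_group S R) \<Longrightarrow> y \<in> carrier (presented_group S R)
      \<Longrightarrow> P x \<Longrightarrow> P y \<Longrightarrow> P (x \<otimes>\<^bsub>presented_group S R\<^esub> y)"
    and "\<And>x. x \<in> carrier (presented_group S R) \<Longrightarrow> P x \<Longrightarrow> P (inv\<^bsub>presented_group S R\<^esub> x)"
  shows "P x"
proof -
  interpret K: group "presented_group S R" by (rule group_presented_group)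
  obtain w where w: "w \<in> words S" "x = word_class S R w"
    using assms(1) by (auto simp: presented_group_carrier)
  let ?e = "word_eval (presented_group S R) (pres_gen S R)"
  have gen: "pres_gen S R \<in> S \<rightarrow> carrier (presented_group S R)" by (auto simp: pres_gen_closed)
  have "P (?e w)" using w(1)
  proof (induction w)
    case Nil
    then show ?case using assms(2) by simp
  next
    case (Cons a w)
    obtain b s where a: "a = (b, s)" by fastforce
    have s: "s \<in> S" "w \<in> words S" using Cons.prems a by auto
    have "P (?e w)" using Cons s by simp
    moreover have "?e w \<in> carrier (presented_group S R)"
      by (rule word_eval_closed[OF K.is_group gen s(2)])
    ultimately show ?case using assms(3)[OF s(1)] assms(4,5) pres_gen_closed[OF s(1)]
      by (simp add: a)
  qed
  then show ?thesis using w word_class_eval by metis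
qed

lemma presented_hom_into_subgroup:
  assumes "group G" "F \<in> hom (presented_group S R) G" "subgroup K G"
    "\<And>s. s \<in> S \<Longrightarrow> F (pres_gen S R s) \<in> K" "x \<in> carrier (presented_group S R)"
  shows "F x \<in> K"
proof -
  interpret F: group_hom "presented_group S R" G F
    using assms(1,2) group_presented_group by (simp add: group_hom_def group_hom_axioms_def)
  interpret K: subgroup K G by fact
  show ?thesis using assms(5) by (induction rule: presented_group_induct) (simp_all add: assms(4))
qed

lemma frac_iso:
  assumes "is_group_of_fractions_of G N"
  obtains F where "F \<in> iso (group_of_fractions (G\<lparr>carrier := N\<rparr>)) G"
    "\<And>x. x \<in> N \<Longrightarrow> F (pres_gen N (frac_rels (G\<lparr>carrier := N\<rparr>)) x) = x"
proof
  let ?R = "frac_rels (G\<lparr>carrier := N\<rparr>)"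
  have G: "group G" and N: "submonoid N G" using assms by (auto simp: is_group_of_fractions_of_def)
  interpret G: group G by fact
  have sub: "N \<subseteq> carrier G" using N submonoid.subset by blast
  show "pres_lift N ?R G (\<lambda>x. x) \<in> iso (group_of_fractions (G\<lparr>carrier := N\<rparr>)) G"
    using assms by (simp add: is_group_of_fractions_of_def)
  have "respects_rels N ?R G (\<lambda>x. x)"
    using sub by (auto simp: respects_rels_def frac_rels_def subset_iff)
  from pres_lift_gen[OF G this]
  show "\<And>x. x \<in> N \<Longrightarrow> pres_lift N ?R G (\<lambda>x. x) (pres_gen N ?R x) = x" .
qed

text \<open>The abstract group of fractions has the extension by \<open>pres_lift\<close>; the
  inverse of the isomorphism transports it to \<open>G\<close>.\<close>

lemma frac_hom_extend:
  assumes "is_group_of_fractions_of G N" "group K" "\<And>x. x \<in> N \<Longrightarrow> f x \<in> carrier K"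
    "\<And>x y. x \<in> N \<Longrightarrow> y \<in> N \<Longrightarrow> f (x \<otimes>\<^bsub>G\<^esub> y) = f x \<otimes>\<^bsub>K\<^esub> f y"
  obtains F where "F \<in> hom G K" "\<And>x. x \<in> N \<Longrightarrow> F x = f x"
proof -
  let ?R = "frac_rels (G\<lparr>carrier := N\<rparr>)" and ?Q = "group_of_fractions (G\<lparr>carrier := N\<rparr>)"
  interpret K: group K by fact
  interpret Q: group ?Q unfolding group_of_fractions_def by (rule group_presented_group)
  obtain E where E: "E \<in> iso ?Q G" "\<And>x. x \<in> N \<Longrightarrow> E (pres_gen N ?R x) = x"
    using frac_iso[OF assms(1)] by blast
  have Q: "?Q = presented_group N ?R" by (simp add: group_of_fractions_def)
  have res: "respects_rels N ?R K f"
    using assms(3,4) by (auto simp: respects_rels_def frac_rels_def)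
  let ?L = "pres_lift N ?R K f" and ?I = "inv_into (carrier ?Q) E"
  have "?I \<in> hom G ?Q" using Q.iso_set_sym[OF E(1)] by (simp add: iso_def)
  moreover have "?L \<in> hom ?Q K" using pres_lift_hom[OF assms(2) res] Q by simp
  ultimately have "?L \<circ> ?I \<in> hom G K" by (rule hom_compose)
  moreover have "(?L \<circ> ?I) x = f x" if "x \<in> N" for x
  proof -
    have p: "pres_gen N ?R x \<in> carrier ?Q" using pres_gen_closed[OF that] Q by simp
    have "inj_on E (carrier ?Q)" using E(1) by (simp add: iso_def bij_betw_def)
    then have "?I x = pres_gen N ?R x" using inv_into_f_f[OF _ p] E(2)[OF that] by metis
    then show ?thesis using pres_lift_gen[OF assms(2) res that] by simp
  qed
  ultimately show thesis using that by blast
qed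

lemma frac_hom_unique:
  assumes "is_group_of_fractions_of G N" "group K" "F \<in> hom G K" "F' \<in> hom G K"
    "\<And>x. x \<in> N \<Longrightarrow> F x = F' x" "x \<in> carrier G"
  shows "F x = F' x"
proof -
  let ?R = "frac_rels (G\<lparr>carrier := N\<rparr>)" and ?Q = "group_of_fractions (G\<lparr>carrier := N\<rparr>)"
  obtain E where E: "E \<in> iso ?Q G" "\<And>x. x \<in> N \<Longrightarrow> E (pres_gen N ?R x) = x"
    using frac_iso[OF assms(1)] by blast
  have Q: "?Q = presented_group N ?R" by (simp add: group_of_fractions_def)
  have hom: "E \<in> hom ?Q G" using E(1) by (simp add: iso_def)
  have "x \<in> E ` carrier ?Q" using E(1) assms(6) by (simp add: iso_def bij_betw_def)
  then obtain q where q: "q \<in> carrier ?Q" "x = E q" by blast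
  have "(F \<circ> E) q = (F' \<circ> E) q"
  proof (rule pres_hom_unique[OF assms(2)])
    show "F \<circ> E \<in> hom (presented_group N ?R) K" "F' \<circ> E \<in> hom (presented_group N ?R) K"
      using hom_compose[OF hom] assms(3,4) Q by simp_all
    show "q \<in> carrier (presented_group N ?R)" using q Q by simp
    show "(F \<circ> E) (pres_gen N ?R x) = (F' \<circ> E) (pres_gen N ?R x)" if "x \<in> N" for x
      using E(2)[OF that] assms(5)[OF that] by simp
  qed
  then show ?thesis using q by simp
qed

context garside_datum
begin

section \<open>The faithful action of words on fractions\<close>

text \<open>\<open>frac_class w k\<close> is the formal fraction \<open>w \<Delta>\<^sup>-\<^sup>k\<close>. Left multiplication by words is a faithful action by
  bijections on these fractions, which embeds the word monoid into a group.\<close>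

definition frac_class :: "'a letter list \<Rightarrow> nat \<Rightarrow> ('a letter list \<times> nat) set" where
  "frac_class w k = {(v, l). valid v \<and> w @ wpow Delta l \<approx> v @ wpow Delta k}"

definition fractions :: "('a letter list \<times> nat) set set" where
  "fractions = {frac_class w k | w k. valid w}"

text \<open>A union over representatives whose summands are all equal. The restriction to
  \<open>fractions\<close> makes the map extensional, as \<open>Bij\<close> demands.\<close>

definition frac_act :: "'a letter list \<Rightarrow> ('a letter list \<times> nat) set \<Rightarrow> ('a letter list \<times> nat) set" where
  "frac_act w = (\<lambda>x\<in>fractions. \<Union>(v, k)\<in>x. frac_class (w @ v) k)"

lemma wpow_comm: "wpow w k @ wpow w l = wpow w l @ wpow w k"
  by (simp flip: wpow_add add: add.commute)

text \<open>Cross-multiplication is transitive because powers of \<open>Delta\<close> commute with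
  each other and can be cancelled on the right.\<close>

lemma frac_class_eq_iff:
  assumes "valid w" "valid v"
  shows "frac_class w k = frac_class v l \<longleftrightarrow> w @ wpow Delta l \<approx> v @ wpow Delta k"
proof
  assume "frac_class w k = frac_class v l"
  moreover have "(v, l) \<in> frac_class v l" using assms by (simp add: frac_class_def)
  ultimately show "w @ wpow Delta l \<approx> v @ wpow Delta k" by (auto simp: frac_class_def)
next
  have D: "valid (wpow Delta m)" for m by (rule wpow_letters[OF Delta_letters])
  have sub: "frac_class w k \<subseteq> frac_class v l" if e: "w @ wpow Delta l \<approx> v @ wpow Delta k" and w: "valid w"
    and v: "valid v" for v w k l
  proof clarify
    fix u m assume "(u, m) \<in> frac_class w k"
    then have u: "valid u" "w @ wpow Delta m \<approx> u @ wpow Delta k" by (auto simp: frac_class_def)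
    have "(v @ wpow Delta m) @ wpow Delta k = (v @ wpow Delta k) @ wpow Delta m"
      by (simp add: wpow_comm)
    also have "\<dots> \<approx> (w @ wpow Delta l) @ wpow Delta m" by (rule eqv_postpend[OF eqv_sym[OF e]])
    also have "\<dots> = (w @ wpow Delta m) @ wpow Delta l" by (simp add: wpow_comm)
    also have "\<dots> \<approx> (u @ wpow Delta k) @ wpow Delta l" by (rule eqv_postpend[OF u(2)])
    also have "\<dots> = (u @ wpow Delta l) @ wpow Delta k" by (simp add: wpow_comm)
    finally have "v @ wpow Delta m \<approx> u @ wpow Delta l"
      by (rule Delta_power_right_cancel) (use u v D in auto)
    then show "(u, m) \<in> frac_class v l" using u by (simp add: frac_class_def)
  qed
  assume e: "w @ wpow Delta l \<approx> v @ wpow Delta k"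
  show "frac_class w k = frac_class v l"
    using sub[OF e assms] sub[OF eqv_sym[OF e] assms(2,1)] by (rule equalityI)
qed

lemma frac_act_frac_class:
  assumes "valid w" "valid v"
  shows "frac_act w (frac_class v k) = frac_class (w @ v) k"
proof -
  have "frac_class v k \<in> fractions" using assms by (auto simp: fractions_def)
  then have b: "frac_act w (frac_class v k) = (\<Union>(v, k)\<in>frac_class v k. frac_class (w @ v) k)" by (simp add: frac_act_def)
  have e: "frac_class (w @ u) l = frac_class (w @ v) k" if "(u, l) \<in> frac_class v k" for u l
  proof -
    have u: "valid u" "v @ wpow Delta l \<approx> u @ wpow Delta k" using that by (auto simp: frac_class_def)
    have "(w @ u) @ wpow Delta k \<approx> (w @ v) @ wpow Delta l"
      using eqv_prepend[OF eqv_sym[OF u(2)], of w] by simp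
    then show ?thesis using frac_class_eq_iff[of "w @ u" "w @ v"] assms u by simp
  qed
  have "(v, k) \<in> frac_class v k" using assms by (simp add: frac_class_def)
  then show ?thesis unfolding b using e by blast
qed

lemma frac_act_Bij:
  assumes "valid w"
  shows "frac_act w \<in> Bij fractions"
proof -
  have D: "valid (wpow Delta m)" for m by (rule wpow_letters[OF Delta_letters])
  have "frac_act w ` fractions = fractions"
  proof (intro equalityI subsetI)
    fix x assume "x \<in> frac_act w ` fractions"
    then obtain v k where v: "valid v" "x = frac_act w (frac_class v k)" by (auto simp: fractions_def)
    then have "x = frac_class (w @ v) k" "valid (w @ v)" using frac_act_frac_class assms by auto
    then show "x \<in> fractions" unfolding fractions_def by blast
  next
    fix x assume "x \<in> fractions"
    then obtain y k where y: "valid y" "x = frac_class y k" by (auto simp: fractions_def)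
    \<comment> \<open>The preimage has numerator \<open>q y'\<close> and exponent
      \<open>k + m\<close>, since \<open>w q y' = Delta^m y' = y Delta^m\<close>.\<close>
    obtain q m where q: "valid q" "w @ q \<approx> wpow Delta m"
      using word_divides_Delta_power[OF assms] by (auto simp: dvd_Dpow_def)
    obtain y' where y': "valid y'" "y @ wpow Delta m \<approx> wpow Delta m @ y'"
      using Delta_power_normal[OF y(1)] by blast
    have S: "valid (q @ y')" using q y' by simp
    have "(w @ q @ y') @ wpow Delta k \<approx> (wpow Delta m @ y') @ wpow Delta k"
      using eqv_postpend[OF q(2), of "y' @ wpow Delta k"] by simp
    also have "\<dots> \<approx> (y @ wpow Delta m) @ wpow Delta k" by (rule eqv_postpend[OF eqv_sym[OF y'(2)]])
    also have "\<dots> = y @ wpow Delta (k + m)" by (simp add: wpow_add wpow_comm)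
    finally have "frac_class (w @ q @ y') (k + m) = frac_class y k"
      using frac_class_eq_iff[of "w @ q @ y'" y] assms S y(1) by simp
    then have "frac_act w (frac_class (q @ y') (k + m)) = x" using frac_act_frac_class[OF assms S] y by simp
    moreover have "frac_class (q @ y') (k + m) \<in> fractions" using S unfolding fractions_def by blast
    ultimately show "x \<in> frac_act w ` fractions" by blast
  qed
  moreover have "inj_on (frac_act w) fractions"
  proof (rule inj_onI)
    fix x y assume "x \<in> fractions" "y \<in> fractions" and e: "frac_act w x = frac_act w y"
    then obtain u k v l where u: "valid u" "x = frac_class u k" and v: "valid v" "y = frac_class v l"
      by (auto simp: fractions_def)
    have "w @ u @ wpow Delta l \<approx> w @ v @ wpow Delta k"
      using e u v frac_act_frac_class[OF assms] frac_class_eq_iff[of "w @ u" "w @ v"] assms by simp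
    then have "u @ wpow Delta l \<approx> v @ wpow Delta k"
      by (rule left_cancel) (use assms u D in auto)
    then show "x = y" using u v frac_class_eq_iff by simp
  qed
  ultimately show ?thesis by (simp add: Bij_def bij_betw_def frac_act_def)
qed

abbreviation "BG \<equiv> BijGroup fractions"
abbreviation BG_mult (infixl "\<bullet>" 70) where "x \<bullet> y \<equiv> x \<otimes>\<^bsub>BijGroup fractions\<^esub> y"

lemma group_BG: "group BG"
  by (rule group_BijGroup)

lemma frac_act_closed: "valid w \<Longrightarrow> frac_act w \<in> carrier BG"
  using frac_act_Bij by (simp add: BijGroup_def)

lemma frac_act_append:
  assumes "valid u" "valid v"
  shows "frac_act (u @ v) = frac_act u \<bullet> frac_act v"
proof -
  have "frac_act u \<bullet> frac_act v = compose fractions (frac_act u) (frac_act v)"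
    using frac_act_Bij assms by (simp add: BijGroup_def)
  also have "\<dots> = frac_act (u @ v)"
  proof (rule extensionalityI[where A = fractions])
    fix x assume "x \<in> fractions"
    then obtain w k where "valid w" "x = frac_class w k" by (auto simp: fractions_def)
    then show "compose fractions (frac_act u) (frac_act v) x = frac_act (u @ v) x"
      using assms \<open>x \<in> fractions\<close> frac_act_frac_class[of v w k] frac_act_frac_class[of u "v @ w" k] frac_act_frac_class[of "u @ v" w k]
      by (simp add: compose_def)
  qed (simp_all add: frac_act_def compose_extensional)
  finally show ?thesis by simp
qed

text \<open>The fraction with empty numerator and exponent 0 already separates words.\<close>

lemma frac_act_eq_iff:
  assumes "valid u" "valid v"
  shows "frac_act u = frac_act v \<longleftrightarrow> u \<approx> v"
proof
  assume "frac_act u = frac_act v"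
  then have "frac_class u 0 = frac_class v 0" using frac_act_frac_class[of u "[]" 0] frac_act_frac_class[of v "[]" 0] assms by simp
  then show "u \<approx> v" using frac_class_eq_iff[OF assms] by (simp add: wpow_simps)
next
  assume e: "u \<approx> v"
  show "frac_act u = frac_act v"
  proof (rule extensionalityI[where A = fractions])
    fix x assume "x \<in> fractions"
    then obtain w k where w: "valid w" "x = frac_class w k" by (auto simp: fractions_def)
    have "(u @ w) @ wpow Delta k \<approx> (v @ w) @ wpow Delta k"
      using eqv_postpend[OF e, of "w @ wpow Delta k"] by simp
    then show "frac_act u x = frac_act v x" using w assms frac_act_frac_class frac_class_eq_iff[of "u @ w" "v @ w" k k] by simp
  qed (simp_all add: frac_act_def)
qed

end

section \<open>Homomorphisms from the semidirect product\<close>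

locale artin_base = H: group H for H :: "('a, 'b) monoid_scheme" +
  fixes h :: 'a and n :: nat
  assumes h: "h \<in> carrier H"
begin

abbreviation "GG \<equiv> free_power n H"
abbreviation "BB \<equiv> braid_group n"
abbreviation "pp \<equiv> free_power_inj n H"
abbreviation "AG \<equiv> artin_group n H h"

interpretation G: group GG by (rule group_free_power)
interpretation B: group BB by (rule group_braid_group)

lemma rep_auto: "b \<in> carrier BB \<Longrightarrow> artin_rep n H h b \<in> auto GG"
  using artin_rep_hom[OF H.is_group h, of n] by (auto simp: hom_def AutoGroup_def)

lemma rep_closed [simp]: "b \<in> carrier BB \<Longrightarrow> g \<in> carrier GG \<Longrightarrow> artin_rep n H h b g \<in> carrier GG"
  using rep_auto[of b] by (auto simp: auto_def hom_def Pi_iff)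

lemma rep_mult:
  assumes "b \<in> carrier BB" "b' \<in> carrier BB" "g \<in> carrier GG"
  shows "artin_rep n H h (b \<otimes>\<^bsub>BB\<^esub> b') g = artin_rep n H h b (artin_rep n H h b' g)"
  using hom_mult[OF artin_rep_hom[OF H.is_group h] assms(1,2)] rep_auto[OF assms(1)] rep_auto[OF assms(2)]
    assms(3) by (simp add: AutoGroup_mult[OF H.is_group h] compose_def)

lemma rep_one:
  assumes "g \<in> carrier GG"
  shows "artin_rep n H h \<one>\<^bsub>BB\<^esub> g = g"
proof -
  have "group_hom BB (AutoGroup GG) (artin_rep n H h)"
    using artin_rep_hom[OF H.is_group h] group_AutoGroup_free_power[OF H.is_group h] B.is_group
    by (simp add: group_hom_def group_hom_axioms_def)
  then have "artin_rep n H h \<one>\<^bsub>BB\<^esub> = \<one>\<^bsub>AutoGroup GG\<^esub>" by (rule group_hom.hom_one)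
  then show ?thesis using assms by (simp add: AutoGroup_def BijGroup_def)
qed

lemma rep_gen: "k \<in> {1..<n} \<Longrightarrow> artin_rep n H h (braid_gen n k) = artin_tau n H h k"
  by (rule artin_rep_gen[OF H.is_group h])

lemma rep_of_one: "b \<in> carrier BB \<Longrightarrow> artin_rep n H h b \<one>\<^bsub>GG\<^esub> = \<one>\<^bsub>GG\<^esub>"
  using rep_auto[of b] G.is_group
  by (intro group_hom.hom_one) (simp_all add: group_hom_def group_hom_axioms_def auto_def)

lemma group_AG: "group AG"
  by (rule group_artin_group[OF H.is_group h])

lemma of_free_hom: "of_free n \<in> hom GG AG"
  by (auto intro!: homI simp: of_free_def artin_group_def semidirect_product_def rep_one)

lemma of_braid_hom: "of_braid n H \<in> hom BB AG"
  by (auto intro!: homI simp: of_braid_def artin_group_def semidirect_product_def rep_of_one)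

lemma braid_gen_closed: "k \<in> {1..<n} \<Longrightarrow> braid_gen n k \<in> carrier BB"
  by (simp add: braid_gen_def braid_group_def pres_gen_closed)

lemma of_braid_of_free:
  assumes "b \<in> carrier BB" "g \<in> carrier GG"
  shows "of_braid n H b \<otimes>\<^bsub>AG\<^esub> of_free n g = of_free n (artin_rep n H h b g) \<otimes>\<^bsub>AG\<^esub> of_braid n H b"
  using assms by (simp add: of_braid_def of_free_def artin_group_def semidirect_product_def rep_one)

lemma of_free_of_braid:
  assumes "b \<in> carrier BB" "g \<in> carrier GG"
  shows "of_free n g \<otimes>\<^bsub>AG\<^esub> of_braid n H b = (g, b)"
  using assms by (simp add: of_braid_def of_free_def artin_group_def semidirect_product_def rep_one)

lemma braid_gen_rels:
  shows "\<lbrakk>1 \<le> i; i + 2 \<le> j; j < n\<rbrakk> \<Longrightarrow>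
      braid_gen n i \<otimes>\<^bsub>BB\<^esub> braid_gen n j = braid_gen n j \<otimes>\<^bsub>BB\<^esub> braid_gen n i"
    and "\<lbrakk>1 \<le> i; Suc i < n\<rbrakk> \<Longrightarrow>
      braid_gen n i \<otimes>\<^bsub>BB\<^esub> (braid_gen n (Suc i) \<otimes>\<^bsub>BB\<^esub> braid_gen n i)
      = braid_gen n (Suc i) \<otimes>\<^bsub>BB\<^esub> (braid_gen n i \<otimes>\<^bsub>BB\<^esub> braid_gen n (Suc i))"
proof -
  assume "1 \<le> i" "i + 2 \<le> j" "j < n"
  then have "word_class {1..<n} (braid_rels n) [(True, i), (True, j)]
      = word_class {1..<n} (braid_rels n) [(True, j), (True, i)]"
    by (intro pres_gen_relation) (auto simp: braid_rels_def)
  then show "braid_gen n i \<otimes>\<^bsub>BB\<^esub> braid_gen n j = braid_gen n j \<otimes>\<^bsub>BB\<^esub> braid_gen n i"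
    using \<open>1 \<le> i\<close> \<open>i + 2 \<le> j\<close> \<open>j < n\<close>
    by (simp add: braid_gen_def pres_gen_def braid_group_def presented_group_mult)
next
  assume "1 \<le> i" "Suc i < n"
  then have "word_class {1..<n} (braid_rels n) [(True, i), (True, Suc i), (True, i)]
      = word_class {1..<n} (braid_rels n) [(True, Suc i), (True, i), (True, Suc i)]"
    by (intro pres_gen_relation) (auto simp: braid_rels_def)
  then show "braid_gen n i \<otimes>\<^bsub>BB\<^esub> (braid_gen n (Suc i) \<otimes>\<^bsub>BB\<^esub> braid_gen n i)
      = braid_gen n (Suc i) \<otimes>\<^bsub>BB\<^esub> (braid_gen n i \<otimes>\<^bsub>BB\<^esub> braid_gen n (Suc i))"
    using \<open>1 \<le> i\<close> \<open>Suc i < n\<close>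
    by (simp add: braid_gen_def pres_gen_def braid_group_def presented_group_mult)
qed

end

text \<open>The image of the \<open>i\<close>-th free factor in \<open>K\<close> is the conjugate of the first one by \<open>C\<^sup>i\<^sup>-\<^sup>1\<close>, where \<open>C\<close>
  plays the role of \<open>h\<^sub>1\<sigma>\<^sub>1\<dots>\<sigma>\<^sub>n\<^sub>-\<^sub>1\<close>.\<close>

locale artin_target = artin_base H h n + K: group K
  for H :: "('a, 'b) monoid_scheme" and h :: 'a and n :: nat
    and K :: "('k, 'm) monoid_scheme" (structure) +
  fixes a :: "'a \<Rightarrow> 'k" and s :: "nat \<Rightarrow> 'k" and C :: 'k
  assumes n: "1 \<le> n"
    and a: "a \<in> hom H K"
    and s: "1 \<le> i \<Longrightarrow> i < n \<Longrightarrow> s i \<in> carrier K"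
    and C: "C \<in> carrier K"
    and C_a: "1 < n \<Longrightarrow> y \<in> carrier H \<Longrightarrow>
      C \<otimes> a y \<otimes> inv C = a h \<otimes> s 1 \<otimes> a y \<otimes> inv (s 1) \<otimes> inv (a h)"
    and s_C_a: "1 < n \<Longrightarrow> y \<in> carrier H \<Longrightarrow>
      s 1 \<otimes> (C \<otimes> a y \<otimes> inv C) \<otimes> inv (s 1) = a h \<otimes> a y \<otimes> inv (a h)"
    and C_s: "1 \<le> i \<Longrightarrow> Suc i < n \<Longrightarrow> C \<otimes> s i \<otimes> inv C = s (Suc i)"
    and C_pow: "y \<in> carrier H \<Longrightarrow>
      \<exists>y'\<in>carrier H. C [^] n \<otimes> a y \<otimes> inv (C [^] n) = a y'"
    and s_a: "2 \<le> i \<Longrightarrow> i < n \<Longrightarrow> y \<in> carrier H \<Longrightarrow> s i \<otimes> a y = a y \<otimes> s i"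
    and s_far: "1 \<le> i \<Longrightarrow> i + 2 \<le> j \<Longrightarrow> j < n \<Longrightarrow> s i \<otimes> s j = s j \<otimes> s i"
    and s_braid: "1 \<le> i \<Longrightarrow> Suc i < n \<Longrightarrow>
      s i \<otimes> (s (Suc i) \<otimes> s i) = s (Suc i) \<otimes> (s i \<otimes> s (Suc i))"
begin

lemma a_closed [simp]: "y \<in> carrier H \<Longrightarrow> a y \<in> carrier K"
  using a by (auto simp: hom_def)

definition conj_pow :: "nat \<Rightarrow> 'k \<Rightarrow> 'k" where "conj_pow k x = C [^] k \<otimes> x \<otimes> inv (C [^] k)"

lemma Kcancel [simp]:
  "x \<in> carrier K \<Longrightarrow> y \<in> carrier K \<Longrightarrow> inv x \<otimes> (x \<otimes> y) = y"
  "x \<in> carrier K \<Longrightarrow> y \<in> carrier K \<Longrightarrow> x \<otimes> (inv x \<otimes> y) = y"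
  by (simp_all flip: K.m_assoc)

lemma conj_pow_closed [simp]: "x \<in> carrier K \<Longrightarrow> conj_pow k x \<in> carrier K"
  using C by (simp add: conj_pow_def)

lemma conj_pow_mult: "x \<in> carrier K \<Longrightarrow> y \<in> carrier K \<Longrightarrow> conj_pow k (x \<otimes> y) = conj_pow k x \<otimes> conj_pow k y"
  using C by (simp add: conj_pow_def K.m_assoc)

lemma conj_pow_inv: "x \<in> carrier K \<Longrightarrow> conj_pow k (inv x) = inv (conj_pow k x)"
  using C by (simp add: conj_pow_def K.m_assoc K.inv_mult_group)

lemma conj_pow_add: "x \<in> carrier K \<Longrightarrow> conj_pow (k + l) x = conj_pow k (conj_pow l x)"
  using C by (simp add: conj_pow_def K.nat_pow_mult[symmetric] K.m_assoc K.inv_mult_group)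

lemma conj_pow_inj: "x \<in> carrier K \<Longrightarrow> y \<in> carrier K \<Longrightarrow> conj_pow k x = conj_pow k y \<Longrightarrow> x = y"
  using C by (simp add: conj_pow_def)

lemma conj_pow_one: "x \<in> carrier K \<Longrightarrow> conj_pow (Suc 0) x = C \<otimes> x \<otimes> inv C"
  using C by (simp add: conj_pow_def)

lemma conj_pow_s:
  assumes "1 \<le> i" "i + k < n"
  shows "conj_pow k (s i) = s (i + k)"
  using assms(2)
proof (induction k)
  case 0
  then show ?case using s assms by (simp add: conj_pow_def)
next
  case (Suc k)
  have "conj_pow (Suc 0 + k) (s i) = conj_pow (Suc 0) (s (i + k))" using Suc s[of i] assms by (subst conj_pow_add) auto
  also have "\<dots> = s (Suc (i + k))" using s C_s[of "i + k"] Suc.prems assms by (simp add: conj_pow_one)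
  finally show ?case by simp
qed

definition \<psi> :: "nat \<Rightarrow> 'a \<Rightarrow> 'k" where "\<psi> i y = conj_pow (i - 1) (a y)"

lemma psi_closed [simp]: "y \<in> carrier H \<Longrightarrow> \<psi> i y \<in> carrier K"
  by (simp add: \<psi>_def)

lemma psi_hom: "\<psi> i \<in> hom H K"
  using a by (auto intro!: homI simp: \<psi>_def conj_pow_mult hom_mult)

text \<open>For \<open>k = 1\<close> these are \<open>C_a\<close> and \<open>s_C_a\<close>;
  conjugation by \<open>C^(k-1)\<close> carries them to the \<open>k\<close>-th pair of neighbouring
  factors.\<close>

lemma psi_Suc:
  assumes "1 \<le> k" "k < n" "y \<in> carrier H"
  shows "\<psi> (Suc k) y = \<psi> k h \<otimes> s k \<otimes> \<psi> k y \<otimes> inv (s k) \<otimes> inv (\<psi> k h)"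
    and "s k \<otimes> \<psi> (Suc k) y \<otimes> inv (s k) = \<psi> k h \<otimes> \<psi> k y \<otimes> inv (\<psi> k h)"
proof -
  have s1: "s 1 \<in> carrier K" using s assms by auto
  have k: "conj_pow (k - 1) (s 1) = s k" using conj_pow_s[of 1 "k - 1"] assms by simp
  have p: "\<psi> (Suc k) y = conj_pow (k - 1) (C \<otimes> a y \<otimes> inv C)"
    using conj_pow_add[of "a y" "k - 1" 1] assms conj_pow_one[of "a y"] by (simp add: \<psi>_def)
  have CK: "C \<otimes> a y \<otimes> inv C \<in> carrier K" using C assms by simp
  show "\<psi> (Suc k) y = \<psi> k h \<otimes> s k \<otimes> \<psi> k y \<otimes> inv (s k) \<otimes> inv (\<psi> k h)"
    unfolding p using C_a[of y] assms s1 h k by (simp add: conj_pow_mult conj_pow_inv \<psi>_def)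
  have "conj_pow (k - 1) (s 1 \<otimes> (C \<otimes> a y \<otimes> inv C) \<otimes> inv (s 1)) = conj_pow (k - 1) (a h \<otimes> a y \<otimes> inv (a h))"
    using s_C_a[of y] assms by simp
  moreover have "conj_pow (k - 1) (s 1 \<otimes> (C \<otimes> a y \<otimes> inv C) \<otimes> inv (s 1))
      = s k \<otimes> \<psi> (Suc k) y \<otimes> inv (s k)"
    unfolding p using CK s1 k conj_pow_mult[of "s 1 \<otimes> (C \<otimes> a y \<otimes> inv C)" "inv (s 1)" "k - 1"]
      conj_pow_mult[OF s1 CK, of "k - 1"] conj_pow_inv[OF s1, of "k - 1"] by simp
  moreover have "conj_pow (k - 1) (a h \<otimes> a y \<otimes> inv (a h)) = \<psi> k h \<otimes> \<psi> k y \<otimes> inv (\<psi> k h)"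
    using h assms by (simp add: conj_pow_mult conj_pow_inv \<psi>_def)
  ultimately show "s k \<otimes> \<psi> (Suc k) y \<otimes> inv (s k) = \<psi> k h \<otimes> \<psi> k y \<otimes> inv (\<psi> k h)" by simp
qed

text \<open>A change of conjugation reduces the claim to \<open>s_a\<close>. For
  \<open>j < k\<close> the power \<open>C^(j-1)\<close> is stripped off; for
  \<open>j > k + 1\<close> it is completed to \<open>C^n\<close>, which maps the first factor into
  itself by \<open>C_pow\<close>.\<close>

lemma s_psi:
  assumes "1 \<le> k" "k < n" "1 \<le> j" "j \<le> n" "j \<noteq> k" "j \<noteq> Suc k" "y \<in> carrier H"
  shows "s k \<otimes> \<psi> j y = \<psi> j y \<otimes> s k"
proof (cases "j < k")
  case True
  have "s (k - j + 1) \<otimes> a y = a y \<otimes> s (k - j + 1)" using True assms by (intro s_a) auto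
  then have "conj_pow (j - 1) (s (k - j + 1) \<otimes> a y) = conj_pow (j - 1) (a y \<otimes> s (k - j + 1))" by simp
  moreover have "conj_pow (j - 1) (s (k - j + 1)) = s k" using conj_pow_s[of "k - j + 1" "j - 1"] True assms by simp
  moreover have "s (k - j + 1) \<in> carrier K" using True assms by (intro s) auto
  ultimately show ?thesis using assms by (simp add: conj_pow_mult \<psi>_def)
next
  case False
  \<comment> \<open>\<open>?m\<close> completes \<open>j - 1\<close> to \<open>n\<close>. The index
    \<open>k + ?m\<close> is at least 2, and below \<open>n\<close> because
    \<open>j \<ge> k + 2\<close>.\<close>
  let ?m = "n - j + 1"
  have sk: "s k \<in> carrier K" using assms s by auto
  obtain y' where y': "y' \<in> carrier H" "conj_pow n (a y) = a y'"
    using C_pow[OF assms(7)] by (auto simp: conj_pow_def)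
  have m: "conj_pow ?m (\<psi> j y) = a y'" using conj_pow_add[of "a y" ?m "j - 1"] assms y' by (simp add: \<psi>_def)
  have sm: "conj_pow ?m (s k) = s (k + ?m)" using False assms by (intro conj_pow_s) auto
  have "s (k + ?m) \<otimes> a y' = a y' \<otimes> s (k + ?m)" using False assms y' by (intro s_a) auto
  then have "conj_pow ?m (s k \<otimes> \<psi> j y) = conj_pow ?m (\<psi> j y \<otimes> s k)"
    unfolding conj_pow_mult[OF sk psi_closed[OF assms(7)]] conj_pow_mult[OF psi_closed[OF assms(7)] sk] m sm .
  then show ?thesis by (rule conj_pow_inj[rotated 2]) (use sk assms in simp_all)
qed

interpretation G: group GG by (rule group_free_power)
interpretation B: group BB by (rule group_braid_group)

definition F :: "(bool \<times> nat \<times> 'a) list set \<Rightarrow> 'k" where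
  "F = pres_lift (free_power_gens n H) (free_power_rels n H) K (\<lambda>(i, y). \<psi> i y)"

definition E :: "(bool \<times> nat) list set \<Rightarrow> 'k" where
  "E = pres_lift {1..<n} (braid_rels n) K s"

lemma respects_F: "respects_rels (free_power_gens n H) (free_power_rels n H) K (\<lambda>(i, y). \<psi> i y)"
  by (rule respects_free_power_rels) (simp_all add: psi_hom)

lemma F_hom: "F \<in> hom GG K"
  using pres_lift_hom[OF K.is_group respects_F] by (simp add: F_def free_power_def)

lemma F_gen: "i \<in> {1..n} \<Longrightarrow> y \<in> carrier H \<Longrightarrow> F (pp i y) = \<psi> i y"
  using pres_lift_gen[OF K.is_group respects_F, of "(i, y)"]
  by (simp add: F_def free_power_inj_def free_power_gens_def)

lemma respects_E: "respects_rels {1..<n} (braid_rels n) K s"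
  using s s_far s_braid by (auto simp: respects_rels_def braid_rels_def)

lemma E_hom: "E \<in> hom BB K"
  using pres_lift_hom[OF K.is_group respects_E] by (simp add: E_def braid_group_def)

lemma E_gen: "k \<in> {1..<n} \<Longrightarrow> E (braid_gen n k) = s k"
  using pres_lift_gen[OF K.is_group respects_E] by (simp add: E_def braid_gen_def)

interpretation F: group_hom GG K F
  using F_hom by (simp add: group_hom_def group_hom_axioms_def G.is_group K.is_group)

interpretation E: group_hom BB K E
  using E_hom by (simp add: group_hom_def group_hom_axioms_def B.is_group K.is_group)

text \<open>Both sides are homomorphisms in \<open>g\<close>, so the free factors decide; the three
  cases of \<open>artin_tau\<close> are covered by \<open>psi_Suc\<close> and
  \<open>s_psi\<close>.\<close>

lemma F_tau:
  assumes k: "k \<in> {1..<n}" and g: "g \<in> carrier GG"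
  shows "F (artin_tau n H h k g) = s k \<otimes> F g \<otimes> inv (s k)"
proof -
  have sk: "s k \<in> carrier K" using k s by auto
  have kk: "k \<in> {1..n}" "k + 1 \<in> {1..n}" using k by auto
  have "(F \<circ> artin_tau n H h k) g = (\<lambda>x. s k \<otimes> F x \<otimes> inv (s k)) g"
  proof (rule free_power_hom_unique[OF K.is_group _ _ _ g])
    show "F \<circ> artin_tau n H h k \<in> hom GG K"
      by (rule hom_compose[OF artin_tau_hom[OF H.is_group h k] F_hom])
    show "(\<lambda>x. s k \<otimes> F x \<otimes> inv (s k)) \<in> hom GG K"
      by (rule conj_hom(2)[OF K.is_group F_hom sk])
    fix j y assume j: "j \<in> {1..n}" and y: "y \<in> carrier H"
    note c = free_power_inj_closed[OF kk(1) h] free_power_inj_closed[OF kk(1) y]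
      free_power_inj_closed[OF kk(2) y] F_gen[OF kk(1) h] F_gen[OF kk(1) y] F_gen[OF kk(2) y]
    consider "j = k" | "j = k + 1" | "j \<noteq> k" "j \<noteq> Suc k" by fastforce
    then show "(F \<circ> artin_tau n H h k) (pp j y) = s k \<otimes> F (pp j y) \<otimes> inv (s k)"
    proof cases
      case 1
      then show ?thesis unfolding o_apply artin_tau_gen[OF H.is_group h k j y] using c sk y h psi_Suc(1)[of k y] k
        by (simp add: K.m_assoc)
    next
      case 2
      then show ?thesis unfolding o_apply artin_tau_gen[OF H.is_group h k j y] using c sk y h psi_Suc(2)[of k y] k by simp
    next
      case 3
      then show ?thesis unfolding o_apply artin_tau_gen[OF H.is_group h k j y] using sk y j k s_psi[of k j y]
        by (simp add: F_gen K.m_assoc)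
    qed
  qed
  then show ?thesis by simp
qed

text \<open>The braids with this property contain the generators by \<open>F_tau\<close> and are
  closed under products and inverses.\<close>

lemma equivariant:
  assumes "b \<in> carrier BB"
  shows "\<forall>g\<in>carrier GG. E b \<otimes> F g = F (artin_rep n H h b g) \<otimes> E b"
  using assms unfolding braid_group_def
proof (induction rule: presented_group_induct)
  case one
  show ?case unfolding braid_group_def[symmetric] using rep_one E.hom_one by simp
next
  case (gen k)
  have "E (braid_gen n k) \<otimes> F g = F (artin_rep n H h (braid_gen n k) g) \<otimes> E (braid_gen n k)"
    if g: "g \<in> carrier GG" for g
  proof -
    have sk: "s k \<in> carrier K" using gen s by auto
    have "s k \<otimes> F g = (s k \<otimes> F g \<otimes> inv (s k)) \<otimes> s k" using sk g by (simp add: K.m_assoc)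
    then show ?thesis using g gen by (simp add: E_gen artin_rep_gen[OF H.is_group h] F_tau)
  qed
  then show ?case by (simp add: braid_gen_def)
next
  case (mult x y)
  have xy: "x \<in> carrier BB" "y \<in> carrier BB" using mult by (simp_all add: braid_group_def)
  show ?case unfolding braid_group_def[symmetric]
  proof
    fix g assume g: "g \<in> carrier GG"
    let ?r = "artin_rep n H h"
    have "E (x \<otimes>\<^bsub>BB\<^esub> y) \<otimes> F g = E x \<otimes> (E y \<otimes> F g)" using xy g by (simp add: K.m_assoc)
    also have "\<dots> = E x \<otimes> (F (?r y g) \<otimes> E y)" using mult g by simp
    also have "\<dots> = (E x \<otimes> F (?r y g)) \<otimes> E y" using xy g by (simp add: K.m_assoc)
    also have "\<dots> = (F (?r x (?r y g)) \<otimes> E x) \<otimes> E y" using mult xy g by simp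
    also have "\<dots> = F (?r (x \<otimes>\<^bsub>BB\<^esub> y) g) \<otimes> E (x \<otimes>\<^bsub>BB\<^esub> y)"
      using xy g by (simp add: K.m_assoc rep_mult)
    finally show "E (x \<otimes>\<^bsub>BB\<^esub> y) \<otimes> F g = F (?r (x \<otimes>\<^bsub>BB\<^esub> y) g) \<otimes> E (x \<otimes>\<^bsub>BB\<^esub> y)" .
  qed
next
  case (inv x)
  have x: "x \<in> carrier BB" using inv by (simp add: braid_group_def)
  show ?case unfolding braid_group_def[symmetric]
  proof
    fix g assume g: "g \<in> carrier GG"
    let ?g = "artin_rep n H h (inv\<^bsub>BB\<^esub> x) g"
    have g': "?g \<in> carrier GG" using x g by simp
    have "artin_rep n H h x ?g = g" using rep_mult[of x "inv\<^bsub>BB\<^esub> x" g] x g rep_one by simp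
    then have "E x \<otimes> F ?g = F g \<otimes> E x" using inv g' by (metis braid_group_def)
    then have "inv (E x) \<otimes> (E x \<otimes> F ?g) \<otimes> inv (E x) = inv (E x) \<otimes> (F g \<otimes> E x) \<otimes> inv (E x)" by simp
    then show "E (inv\<^bsub>BB\<^esub> x) \<otimes> F g = F ?g \<otimes> E (inv\<^bsub>BB\<^esub> x)"
      using x g g' by (simp add: K.m_assoc)
  qed
qed

lemma artin_group_hom:
  "\<exists>\<Psi>\<in>hom (artin_group n H h) K.
    (\<forall>y\<in>carrier H. \<Psi> (of_free n (pp 1 y)) = a y) \<and>
    (\<forall>k\<in>{1..<n}. \<Psi> (of_braid n H (braid_gen n k)) = s k)"
proof (intro bexI conjI ballI)
  let ?P = "\<lambda>(g, b). F g \<otimes> E b"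
  show "?P \<in> hom (artin_group n H h) K"
  proof (rule homI)
    fix x y assume "x \<in> carrier (artin_group n H h)" "y \<in> carrier (artin_group n H h)"
    then obtain g b g' b' where x: "x = (g, b)" "g \<in> carrier GG" "b \<in> carrier BB"
      and y: "y = (g', b')" "g' \<in> carrier GG" "b' \<in> carrier BB"
      by (auto simp: artin_group_def semidirect_product_def)
    have "F g \<otimes> (F (artin_rep n H h b g') \<otimes> E b) \<otimes> E b' = F g \<otimes> (E b \<otimes> F g') \<otimes> E b'"
      using equivariant x y by simp
    then show "?P (x \<otimes>\<^bsub>artin_group n H h\<^esub> y) = ?P x \<otimes> ?P y"
      using x y by (simp add: artin_group_def semidirect_product_def K.m_assoc)
  qed (auto simp: artin_group_def semidirect_product_def)
  show "?P (of_free n (pp 1 y)) = a y" if "y \<in> carrier H" for y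
    using that n F_gen[of 1 y] C by (simp add: of_free_def \<psi>_def conj_pow_def)
  show "?P (of_braid n H (braid_gen n k)) = s k" if "k \<in> {1..<n}" for k
    using that E_gen[OF that] s by (simp add: of_braid_def)
qed

end

locale artin_datum = garside_datum +
  assumes frac: "is_group_of_fractions_of H M"
begin

lemma h_carrier: "h \<in> carrier H"
  by (rule M_carrier[OF h_in_M])

sublocale base: artin_base H h n
  by (unfold_locales) (rule h_carrier)

abbreviation "AG \<equiv> base.AG"
abbreviation AG_mult (infixl "\<cdot>" 70) where "x \<cdot> y \<equiv> x \<otimes>\<^bsub>artin_group n H h\<^esub> y"
abbreviation AG_inv ("\<iota> _" [81] 80) where "\<iota> x \<equiv> inv\<^bsub>artin_group n H h\<^esub> x"
abbreviation "\<phi> \<equiv> free_power_inj n H"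
abbreviation "\<eta> y \<equiv> of_free n (free_power_inj n H 1 y)"
abbreviation "\<sigma> k \<equiv> of_braid n H (braid_gen n k)"
abbreviation "GG \<equiv> base.GG"
abbreviation "BB \<equiv> base.BB"

interpretation BG: group BG by (rule group_BG)

lemma frac_act_pow: "valid w \<Longrightarrow> frac_act (wpow w k) = frac_act w [^]\<^bsub>BG\<^esub> k"
proof (induction k)
  case 0
  \<comment> \<open>An idempotent of a group is neutral.\<close>
  have "frac_act [] \<bullet> frac_act [] = frac_act []" using frac_act_append[of "[]" "[]"] by simp
  then show ?case using frac_act_closed[of "[]"] BG.l_cancel_one by (simp add: wpow_simps)
next
  case (Suc k)
  then show ?case using frac_act_append[OF wpow_letters[OF Suc.prems] Suc.prems]
    by (simp add: wpow_Suc_right)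
qed

lemma frac_act_eqv: "u \<approx> v \<Longrightarrow> valid u \<Longrightarrow> frac_act u = frac_act v"
  using frac_act_eq_iff eqv_letters by blast

lemma hconj_hom: "hconj \<in> hom H H"
  using h_carrier by (auto intro!: homI simp: hconj_def m_assoc)

lemma hconj_pow_hom: "hconj ^^ k \<in> hom H H"
proof (induction k)
  case 0
  then show ?case by (auto intro!: homI)
next
  case (Suc k)
  show ?case using Group.hom_compose[OF Suc hconj_hom] by (simp add: o_def)
qed

text \<open>The action of \<open>M\<close> on fractions extends to a homomorphism \<open>a\<close>
  on \<open>H\<close> by the universal property. The word identities for \<open>cox n\<close> and
  \<open>Delta\<close> then become the hypotheses of \<open>artin_target\<close>.\<close>

lemma frac_act_hom_exists:
  "\<exists>\<Psi>\<in>hom AG BG. (\<forall>y\<in>M. \<Psi> (\<eta> y) = frac_act (mword y)) \<and>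
    (\<forall>k\<in>{1..<n}. \<Psi> (\<sigma> k) = frac_act [Sig k])"
proof -
  have mw: "valid (mword y)" if "y \<in> M" for y using that by (rule mon_letters)
  obtain a where a: "a \<in> hom H BG" "\<And>y. y \<in> M \<Longrightarrow> a y = frac_act (mword y)"
  proof (rule frac_hom_extend[OF frac group_BG, of "\<lambda>y. frac_act (mword y)"])
    fix x y assume "x \<in> M" "y \<in> M"
    then show "frac_act (mword (x \<otimes> y)) = frac_act (mword x) \<bullet> frac_act (mword y)"
      using frac_act_append[OF mw mw] frac_act_eqv[OF mon_append] mw by simp
  qed (use frac_act_closed mw in auto)
  have ac: "a y \<in> carrier BG" if "y \<in> carrier H" for y using a(1) that by (auto simp: hom_def)
  have ah: "a h = frac_act [Mon h]" using a(2)[OF h_in_M] mword_h by simp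
  \<comment> \<open>Conjugation of \<open>a\<close> by \<open>frac_act w\<close> and
    \<open>a \<circ> f\<close> are homomorphisms on \<open>H\<close> that agree on \<open>M\<close>.
    Word identities, which speak of \<open>M\<close>, thereby become identities on all of
    \<open>H\<close>.\<close>
  have ext: "frac_act w \<bullet> a y = a (f y) \<bullet> frac_act w"
    if w: "valid w" and f: "f \<in> hom H H" "\<And>y. y \<in> M \<Longrightarrow> f y \<in> M"
      and e: "\<And>y. y \<in> M \<Longrightarrow> mword (f y) @ w \<approx> w @ mword y" and y: "y \<in> carrier H" for w f y
  proof -
    have W: "frac_act w \<in> carrier BG" using w by (rule frac_act_closed)
    have fy: "f y \<in> carrier H" using f(1) y by (auto simp: hom_def)
    have "(\<lambda>y. frac_act w \<bullet> a y \<bullet> inv\<^bsub>BG\<^esub> (frac_act w)) y = (a \<circ> f) y"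
    proof (rule frac_hom_unique[OF frac group_BG _ _ _ y])
      show "(\<lambda>y. frac_act w \<bullet> a y \<bullet> inv\<^bsub>BG\<^esub> (frac_act w)) \<in> hom H BG"
        by (rule conj_hom(2)[OF group_BG a(1) W])
      show "a \<circ> f \<in> hom H BG" by (rule Group.hom_compose[OF f(1) a(1)])
      fix x assume x: "x \<in> M"
      have "frac_act w \<bullet> a x = a (f x) \<bullet> frac_act w"
        using frac_act_eqv[OF e[OF x]] frac_act_append[OF w mw[OF x]] frac_act_append[OF mw[OF f(2)[OF x]] w]
          a(2)[OF x] a(2)[OF f(2)[OF x]] mw[OF f(2)[OF x]] w by simp
      then show "frac_act w \<bullet> a x \<bullet> inv\<^bsub>BG\<^esub> (frac_act w) = (a \<circ> f) x"
        using W ac[OF M_carrier[OF x]] ac[OF M_carrier[OF f(2)[OF x]]] by (simp add: BG.m_assoc)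
    qed
    then have "frac_act w \<bullet> a y \<bullet> inv\<^bsub>BG\<^esub> (frac_act w) \<bullet> frac_act w = a (f y) \<bullet> frac_act w" by simp
    then show ?thesis using W ac[OF y] by (simp add: BG.m_assoc)
  qed
  have id: "(\<lambda>x. x) \<in> hom H H" by (auto intro!: homI)
  let ?s = "\<lambda>i. frac_act [Sig i]" and ?C = "frac_act (cox n)"
  have cwL: "valid (cox n)" using cox_letters n_pos by blast
  have sc: "?s i \<in> carrier BG" if "1 \<le> i" "i < n" for i using that by (intro frac_act_closed) simp
  have Cc: "?C \<in> carrier BG" by (rule frac_act_closed[OF cwL])
  have C_a: "?C \<bullet> a y \<bullet> inv\<^bsub>BG\<^esub> ?C
      = a h \<bullet> ?s 1 \<bullet> a y \<bullet> inv\<^bsub>BG\<^esub> (?s 1) \<bullet> inv\<^bsub>BG\<^esub> (a h)"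
    if "1 < n" "y \<in> carrier H" for y
  proof -
    let ?d = "frac_act (sigs [2..<n])"
    have dL: "valid (sigs [2..<n])" by auto
    have d: "?d \<in> carrier BG" by (rule frac_act_closed[OF dL])
    have s1: "?s 1 \<in> carrier BG" using that by (intro sc) auto
    have "cox n = [Mon h] @ [Sig 1] @ sigs [2..<n]"
      using that by (simp add: cox_def upt_conv_Cons numeral_2_eq_2)
    moreover have "frac_act ([Mon h] @ [Sig 1] @ sigs [2..<n]) = frac_act [Mon h] \<bullet> frac_act ([Sig 1] @ sigs [2..<n])"
      using that dL by (intro frac_act_append) auto
    moreover have "frac_act ([Sig 1] @ sigs [2..<n]) = ?s 1 \<bullet> ?d"
      using that dL by (intro frac_act_append) auto
    ultimately have C: "?C = a h \<bullet> (?s 1 \<bullet> ?d)" using ah by simp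
    have "mword y @ sigs [2..<n] \<approx> sigs [2..<n] @ mword y" if "y \<in> M" for y
      by (rule mword_sigs_comm[OF that]) simp
    \<comment> \<open>The tail \<open>sigma_2 ... sigma_(n-1)\<close> of \<open>cox n\<close>
      commutes with \<open>a y\<close>, so only \<open>a h\<close> and \<open>?s 1\<close> survive
      in the conjugate.\<close>
    then have da: "?d \<bullet> a y = a y \<bullet> ?d"
      by (intro ext[OF dL id _ _ that(2)]) auto
    have "?d \<bullet> (a y \<bullet> (inv\<^bsub>BG\<^esub> ?d \<bullet> z)) = a y \<bullet> z" if "z \<in> carrier BG" for z
    proof -
      have "?d \<bullet> (a y \<bullet> (inv\<^bsub>BG\<^esub> ?d \<bullet> z)) = (?d \<bullet> a y) \<bullet> (inv\<^bsub>BG\<^esub> ?d \<bullet> z)"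
        using d ac \<open>y \<in> carrier H\<close> that by (simp add: BG.m_assoc)
      also have "\<dots> = a y \<bullet> (?d \<bullet> (inv\<^bsub>BG\<^esub> ?d \<bullet> z))"
        unfolding da using d ac \<open>y \<in> carrier H\<close> that by (simp add: BG.m_assoc)
      also have "?d \<bullet> (inv\<^bsub>BG\<^esub> ?d \<bullet> z) = z"
        using d that by (simp flip: BG.m_assoc)
      finally show ?thesis .
    qed
    then show ?thesis unfolding C using s1 d ac that h_carrier
      by (simp add: BG.m_assoc BG.inv_mult_group)
  qed
  have s_C_a: "?s 1 \<bullet> (?C \<bullet> a y \<bullet> inv\<^bsub>BG\<^esub> ?C) \<bullet> inv\<^bsub>BG\<^esub> (?s 1)
      = a h \<bullet> a y \<bullet> inv\<^bsub>BG\<^esub> (a h)"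
    if "1 < n" "y \<in> carrier H" for y
  proof -
    let ?w = "shs"
    have wL: "valid ?w" using that by simp
    have s1: "?s 1 \<in> carrier BG" using that by (intro sc) auto
    have "?w = [Sig 1] @ [Mon h] @ [Sig 1]" by simp
    moreover have "frac_act ([Sig 1] @ [Mon h] @ [Sig 1]) = ?s 1 \<bullet> frac_act ([Mon h] @ [Sig 1])"
      using that by (intro frac_act_append) auto
    moreover have "frac_act ([Mon h] @ [Sig 1]) = a h \<bullet> ?s 1"
      unfolding ah using that by (intro frac_act_append) auto
    ultimately have w: "frac_act ?w = ?s 1 \<bullet> (a h \<bullet> ?s 1)" by simp
    have W: "frac_act ?w \<in> carrier BG" by (rule frac_act_closed[OF wL])
    have "frac_act ?w \<bullet> a y = a (hconj y) \<bullet> frac_act ?w"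
      by (rule ext[OF wL hconj_hom _ _ that(2)]) (use Mon_Sig1 that in auto)
    moreover have efy: "hconj y \<in> carrier H" using that h_carrier by (simp add: hconj_def)
    ultimately have "frac_act ?w \<bullet> a y \<bullet> inv\<^bsub>BG\<^esub> (frac_act ?w) = a (hconj y)"
      using W ac by (simp add: BG.m_assoc)
    moreover have "a (hconj y) = a h \<bullet> a y \<bullet> inv\<^bsub>BG\<^esub> (a h)"
      using a(1) that h_carrier group_hom.hom_inv[of H BG a h] is_group group_BG
      by (simp add: hconj_def hom_mult group_hom_def group_hom_axioms_def)
    \<comment> \<open>By \<open>C_a\<close> the left side is the conjugate of \<open>a y\<close> by
      \<open>sigma_1 h sigma_1\<close>, just evaluated as \<open>a (hconj y)\<close>.\<close>
    ultimately show ?thesis unfolding C_a[OF that] w using s1 ac that h_carrier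
      by (simp add: BG.m_assoc BG.inv_mult_group)
  qed
  have Delta: "?C [^]\<^bsub>BG\<^esub> n = frac_act Delta" using frac_act_pow[OF cwL] by (simp add: Delta_def)
  interpret T: artin_target H h n BG a ?s ?C
  proof
    show "1 \<le> n" by (rule n_pos)
    show "a \<in> hom H BG" by (rule a(1))
    show "?C \<in> carrier BG" by (rule Cc)
    fix i
    show "1 \<le> i \<Longrightarrow> i < n \<Longrightarrow> ?s i \<in> carrier BG" by (rule sc)
    assume i: "1 \<le> i" "Suc i < n"
    have "?C \<bullet> ?s i = ?s (Suc i) \<bullet> ?C"
      using frac_act_eqv[OF cox_shift[of i n]] frac_act_append[of "cox n" "[Sig i]"] frac_act_append[of "[Sig (Suc i)]" "cox n"]
        i cwL by simp
    then show "?C \<bullet> ?s i \<bullet> inv\<^bsub>BG\<^esub> ?C = ?s (Suc i)"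
      using Cc sc[of "Suc i"] i by (simp add: BG.m_assoc)
    have b: "frac_act [Sig j, Sig k, Sig j] = ?s j \<bullet> (?s k \<bullet> ?s j)"
      if "1 \<le> j" "j < n" "1 \<le> k" "k < n" for j k
      using frac_act_append[of "[Sig j]" "[Sig k, Sig j]"] frac_act_append[of "[Sig k]" "[Sig j]"] that by simp
    show "?s i \<bullet> (?s (Suc i) \<bullet> ?s i) = ?s (Suc i) \<bullet> (?s i \<bullet> ?s (Suc i))"
      using frac_act_eqv[OF Sig_braid[OF i]] b[of i "Suc i"] b[of "Suc i" i] i by simp
  next
    fix i y assume i: "2 \<le> i" "i < n" and y: "y \<in> carrier H"
    show "?s i \<bullet> a y = a y \<bullet> ?s i"
      by (rule ext[OF _ id _ _ y]) (use i Mon_Sig_comm in auto)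
  next
    fix i j assume ij: "1 \<le> i" "i + 2 \<le> j" "j < n"
    show "?s i \<bullet> ?s j = ?s j \<bullet> ?s i"
      using frac_act_eqv[OF Sig_far[OF ij]] frac_act_append[of "[Sig i]" "[Sig j]"]
        frac_act_append[of "[Sig j]" "[Sig i]"] ij by simp
  next
    fix y assume y: "y \<in> carrier H"
    have "mword ((hconj ^^ n) x) @ Delta \<approx> Delta @ mword x" if "x \<in> M" for x
      using mword_cox_power[OF that n_pos] by (simp add: Delta_def)
    then have "frac_act Delta \<bullet> a y = a ((hconj ^^ n) y) \<bullet> frac_act Delta"
      by (intro ext[OF Delta_letters hconj_pow_hom _ _ y]) auto
    moreover have "(hconj ^^ n) y \<in> carrier H" using hconj_pow_hom y by (auto simp: hom_def)
    ultimately show "\<exists>y'\<in>carrier H. ?C [^]\<^bsub>BG\<^esub> n \<bullet> a y \<bullet> inv\<^bsub>BG\<^esub> (?C [^]\<^bsub>BG\<^esub> n) = a y'"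
      unfolding Delta using frac_act_closed[OF Delta_letters] ac y
      by (intro bexI[of _ "(hconj ^^ n) y"]) (simp_all add: BG.m_assoc)
  qed (rule C_a s_C_a, assumption+)+
  obtain \<Psi> where P: "\<Psi> \<in> hom AG BG"
    "\<forall>y\<in>carrier H. \<Psi> (\<eta> y) = a y"
    "\<forall>k\<in>{1..<n}. \<Psi> (\<sigma> k) = ?s k"
    using T.artin_group_hom by (elim bexE conjE)
  have "\<forall>y\<in>M. \<Psi> (\<eta> y) = frac_act (mword y)"
    using P(2) a(2) M_carrier by simp
  then show ?thesis using P(1,3) by (intro bexI conjI)
qed

section \<open>Words as elements of the semidirect product\<close>

fun elt_letter :: "'a letter \<Rightarrow> 'a artin_elt" where
  "elt_letter (Mon a) = \<eta> a"
| "elt_letter (Sig k) = \<sigma> k"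

definition elt :: "'a letter list \<Rightarrow> 'a artin_elt" where
  "elt w = foldr (\<lambda>s x. elt_letter s \<cdot> x) w \<one>\<^bsub>AG\<^esub>"

interpretation AG: group AG by (rule base.group_AG)
interpretation G: group GG by (rule group_free_power)
interpretation B: group BB by (rule group_braid_group)

lemma one_in: "(1::nat) \<in> {1..n}"
  using n_pos by simp

lemma phi_closed [simp]: "a \<in> carrier H \<Longrightarrow> \<phi> (Suc 0) a \<in> carrier GG"
  using free_power_inj_closed[OF one_in] by simp

lemma of_free_closed [simp]: "g \<in> carrier GG \<Longrightarrow> of_free n g \<in> carrier AG"
  using base.of_free_hom by (auto simp: hom_def)

lemma of_braid_closed [simp]: "b \<in> carrier BB \<Longrightarrow> of_braid n H b \<in> carrier AG"
  using base.of_braid_hom by (auto simp: hom_def)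

lemma phi_hom: "(\<lambda>a. \<eta> a) \<in> hom H AG"
  using Group.hom_compose[OF free_power_inj_hom[OF is_group one_in] base.of_free_hom] by (simp add: o_def)

lemma elt_letter_closed: "s \<in> letters \<Longrightarrow> elt_letter s \<in> carrier AG"
  using base.braid_gen_closed by (auto elim!: letters_cases)

lemma elt_closed: "valid w \<Longrightarrow> elt w \<in> carrier AG"
  by (induction w) (auto simp: elt_def elt_letter_closed)

lemma elt_simps [simp]: "elt [] = \<one>\<^bsub>AG\<^esub>" "elt (s # w) = elt_letter s \<cdot> elt w"
  by (simp_all add: elt_def)

lemma elt_append: "valid u \<Longrightarrow> valid v \<Longrightarrow> elt (u @ v) = elt u \<cdot> elt v"
  by (induction u) (auto simp: elt_closed elt_letter_closed AG.m_assoc)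

lemma elt_mword: "a \<in> M \<Longrightarrow> elt (mword a) = \<eta> a"
  using group_hom.hom_one[of H AG, OF group_hom.intro[OF is_group AG.is_group group_hom_axioms.intro[OF phi_hom]]]
  by (simp add: mword_def)

lemma elt_Sig_Mon_far:
  assumes "2 \<le> k" "k < n" "a \<in> carrier H"
  shows "elt_letter (Sig k) \<cdot> elt_letter (Mon a) = elt_letter (Mon a) \<cdot> elt_letter (Sig k)"
  using base.of_braid_of_free[OF base.braid_gen_closed[of k] phi_closed[OF assms(3)]]
    base.rep_gen[of k] artin_tau_gen[OF is_group h_carrier _ one_in assms(3), of k] assms by simp

text \<open>The inner \<open>sigma_1\<close> turns \<open>\<phi> 1 a\<close> into a conjugate of
  \<open>\<phi> 2 a\<close> by \<open>h\<close>, the letter \<open>h\<close> undoes that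
  conjugation, and the outer \<open>sigma_1\<close> returns to the first factor, now conjugated by
  \<open>h\<close>.\<close>

lemma elt_Sig_Mon_near:
  assumes "1 < n" "a \<in> carrier H"
  shows "elt_letter (Sig 1) \<cdot> (elt_letter (Mon h) \<cdot> (elt_letter (Sig 1) \<cdot> elt_letter (Mon a)))
    = elt_letter (Mon (h \<otimes> a \<otimes> inv h)) \<cdot> (elt_letter (Sig 1) \<cdot> (elt_letter (Mon h) \<cdot> elt_letter (Sig 1)))"
proof -
  let ?t = "\<sigma> 1" and ?o = "of_free n"
  have k: "1 \<in> {1..<n}" and two: "2 \<in> {1..n}" using assms by auto
  note b = base.braid_gen_closed[OF k]
  note tau = artin_tau_gen[OF is_group h_carrier k]
  have tc: "?t \<in> carrier AG" using b by simp
  note hc = free_power_inj_closed[OF one_in h_carrier] and ac = free_power_inj_closed[OF one_in assms(2)]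
    and a2 = free_power_inj_closed[OF two assms(2)]
  let ?h = "\<phi> 1 h" and ?a = "\<phi> 1 a" and ?a2 = "\<phi> 2 a"
  have 1: "?t \<cdot> ?o ?a = ?o (inv\<^bsub>GG\<^esub> ?h \<otimes>\<^bsub>GG\<^esub> ?a2 \<otimes>\<^bsub>GG\<^esub> ?h) \<cdot> ?t"
    using base.of_braid_of_free[OF b ac] tau[OF one_in assms(2)] base.rep_gen[OF k]
    by (simp add: numeral_2_eq_2)
  have 2: "?o ?h \<cdot> ?o (inv\<^bsub>GG\<^esub> ?h \<otimes>\<^bsub>GG\<^esub> ?a2 \<otimes>\<^bsub>GG\<^esub> ?h) = ?o ?a2 \<cdot> ?o ?h"
    using hom_mult[OF base.of_free_hom, of ?h "inv\<^bsub>GG\<^esub> ?h \<otimes>\<^bsub>GG\<^esub> ?a2 \<otimes>\<^bsub>GG\<^esub> ?h"]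
      hom_mult[OF base.of_free_hom, of ?a2 ?h] hc a2
    by (simp add: G.m_assoc[symmetric])
  have 3: "?t \<cdot> ?o ?a2 = ?o (\<phi> 1 (h \<otimes> a \<otimes> inv h)) \<cdot> ?t"
    using base.of_braid_of_free[OF b a2] tau[OF two assms(2)] base.rep_gen[OF k]
      assms(2) h_carrier free_power_inj_mult[OF is_group one_in] pp_inv[OF is_group h_carrier one_in h_carrier]
    by simp
  have "?t \<cdot> (?o ?h \<cdot> (?t \<cdot> ?o ?a))
      = ?t \<cdot> ((?o ?h \<cdot> ?o (inv\<^bsub>GG\<^esub> ?h \<otimes>\<^bsub>GG\<^esub> ?a2 \<otimes>\<^bsub>GG\<^esub> ?h)) \<cdot> ?t)"
    unfolding 1 using tc hc a2 by (simp add: AG.m_assoc)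
  also have "\<dots> = (?t \<cdot> ?o ?a2) \<cdot> (?o ?h \<cdot> ?t)"
    unfolding 2 using tc hc a2 by (simp add: AG.m_assoc)
  also have "\<dots> = ?o (\<phi> 1 (h \<otimes> a \<otimes> inv h)) \<cdot> (?t \<cdot> (?o ?h \<cdot> ?t))"
    unfolding 3 using tc hc assms(2) h_carrier by (simp add: AG.m_assoc)
  finally show ?thesis by simp
qed

lemma elt_rel:
  assumes "s \<in> letters" "t \<in> letters"
  shows "elt (s # compl s t) = elt (t # compl t s)"
proof -
  have MS: "elt (Mon a # compl (Mon a) (Sig i)) = elt (Sig i # compl (Sig i) (Mon a))"
    if "a \<in> M" "1 \<le> i" "i < n" for a i
  proof (cases "i = Suc 0")
    case True
    have "h \<otimes> hconj_inv a \<otimes> inv h = a" using conj_hconj_inv that by simp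
    then show ?thesis
      using elt_Sig_Mon_near[of "hconj_inv a"] True that elt_letter_closed[of "Sig 1"] elt_letter_closed[of "Mon h"]
      by (simp add: AG.m_assoc)
  next
    case False
    then show ?thesis using elt_Sig_Mon_far[of i a] that elt_letter_closed[of "Sig i"]
      by (simp del: elt_letter.simps) (simp add: base.braid_gen_closed)
  qed
  have SS: "elt_letter (Sig i) \<cdot> elt_letter (Sig j) = of_braid n H (braid_gen n i \<otimes>\<^bsub>BB\<^esub> braid_gen n j)"
    if "i \<in> {1..<n}" "j \<in> {1..<n}" for i j
    using hom_mult[OF base.of_braid_hom] that base.braid_gen_closed by simp
  have SSS: "elt_letter (Sig i) \<cdot> (elt_letter (Sig j) \<cdot> elt_letter (Sig i)) =
      of_braid n H (braid_gen n i \<otimes>\<^bsub>BB\<^esub> (braid_gen n j \<otimes>\<^bsub>BB\<^esub> braid_gen n i))"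
    if "i \<in> {1..<n}" "j \<in> {1..<n}" for i j
    using hom_mult[OF base.of_braid_hom] that base.braid_gen_closed by simp
  show ?thesis using assms
  proof (elim letters_cases)
    fix a b assume *: "s = Mon a" "t = Mon b" "a \<in> M" "b \<in> M"
    then have "elt (mword a @ mword (quot a b)) = elt (mword b @ mword (quot b a))"
      using hom_mult[OF phi_hom, of a "quot a b"] hom_mult[OF phi_hom, of b "quot b a"]
        mult_quot[of a b] mult_quot[of b a] lcmM_sym[of a b]
      by (simp add: elt_append elt_mword)
    moreover assume "a \<noteq> \<one>" "b \<noteq> \<one>"
    ultimately show ?thesis using * mon_comp_eq[of a b] mon_comp_eq[of b a]
      by (simp add: mword_def[of a] mword_def[of b] del: compl.simps)
  next
    fix i j assume *: "s = Sig i" "t = Sig j" "1 \<le> i" "i < n" "1 \<le> j" "j < n"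
    consider "i = j" | "Suc i = j" | "Suc j = i" | "i + 2 \<le> j" | "j + 2 \<le> i" by linarith
    then show ?thesis
      using * base.braid_gen_rels(1)[of i j] base.braid_gen_rels(1)[of j i]
        base.braid_gen_rels(2)[of i] base.braid_gen_rels(2)[of j]
        SS[of i j] SS[of j i] SSS[of i j] SSS[of j i] elt_letter_closed[of "Sig i"] elt_letter_closed[of "Sig j"]
      by cases (simp_all add: adj_def del: elt_letter.simps)
  qed (use MS in auto)
qed

lemma eqv_imp_elt_eq:
  assumes "u \<approx> v" "valid u"
  shows "elt u = elt v"
  using assms(1) unfolding eqv_def
proof (induction rule: rtranclp_induct)
  case (step v w)
  have "valid v" using step(1) assms(2) eqv_letters[of u v] by (simp add: eqv_def)
  with step(2) have "elt v = elt w"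
  proof cases
    case (step s t p q)
    have "valid (s # compl s t)" "valid (t # compl t s)"
      using comp_closed step by auto
    then show ?thesis using step \<open>valid v\<close> elt_rel[of s t]
      by (simp add: elt_append del: elt_simps append_Cons)
  qed
  with step.IH show ?case by simp
qed simp

text \<open>\<open>\<Psi>\<close> sends \<open>elt w\<close> to \<open>frac_act w\<close>, and the
  action on fractions separates words. This is the embedding of the word monoid.\<close>

lemma elt_eq_iff:
  assumes "valid u" "valid v"
  shows "elt u = elt v \<longleftrightarrow> u \<approx> v"
proof
  obtain \<Psi> where P: "\<Psi> \<in> hom AG BG" "\<And>y. y \<in> M \<Longrightarrow> \<Psi> (\<eta> y) = frac_act (mword y)"
    "\<And>k. k \<in> {1..<n} \<Longrightarrow> \<Psi> (\<sigma> k) = frac_act [Sig k]"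
    using frac_act_hom_exists by blast
  interpret P: group_hom AG BG \<Psi>
    using P(1) by (simp add: group_hom_def group_hom_axioms_def AG.is_group group_BG)
  have l: "\<Psi> (elt_letter s) = frac_act [s]" if "s \<in> letters" for s
    using that P(2,3) by (auto elim!: letters_cases simp: mword_def)
  have "\<Psi> (elt w) = frac_act w" if "valid w" for w
    using that
  proof (induction w)
    case Nil
    then show ?case using frac_act_pow[of "[]" 0] by (simp add: wpow_simps)
  next
    case (Cons s w)
    then show ?case using l[of s] frac_act_append[of "[s]" w] by (simp add: elt_letter_closed elt_closed)
  qed
  then show "u \<approx> v" if "elt u = elt v"
    using that assms frac_act_eq_iff by metis
qed (use eqv_imp_elt_eq assms in blast)

abbreviation "MM \<equiv> artin_submonoid n H h M"

lemma elt_in_MM: "valid w \<Longrightarrow> elt w \<in> MM"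
proof (induction w)
  case Nil
  then show ?case by (simp add: artin_submonoid_def mgenerate.one)
next
  case (Cons s w)
  have "s \<in> letters" using Cons by simp
  then have "elt_letter s \<in> of_free n ` \<phi> 1 ` M \<union> of_braid n H ` positive_braids n"
  proof (cases rule: letters_cases)
    case (2 i)
    then have "braid_gen n i \<in> positive_braids n"
      unfolding positive_braids_def by (intro mgenerate.incl) simp
    with 2 show ?thesis by simp
  qed simp
  then have "elt_letter s \<in> MM" unfolding artin_submonoid_def by (rule mgenerate.incl)
  then show ?case using Cons by (auto simp: artin_submonoid_def intro: mgenerate.mult)
qed

lemma MM_eq_elt: "x \<in> MM \<longleftrightarrow> (\<exists>w. valid w \<and> x = elt w)"
proof
  assume "x \<in> MM"
  then show "\<exists>w. valid w \<and> x = elt w"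
    unfolding artin_submonoid_def
  proof (induction rule: mgenerate.induct)
    case one
    then show ?case by (intro exI[of _ "[]"]) simp
  next
    case (incl x)
    then consider y where "y \<in> M" "x = \<eta> y"
      | b where "b \<in> positive_braids n" "x = of_braid n H b" by blast
    then show ?case
    proof cases
      case 1
      then show ?thesis using elt_mword[of y] mon_letters[of y] by metis
    next
      case 2
      have "b \<in> carrier BB \<and> (\<exists>w. valid w \<and> of_braid n H b = elt w)"
        using 2(1) unfolding positive_braids_def
      proof (induction rule: mgenerate.induct)
        case one
        then show ?case
          using group_hom.hom_one[of BB AG, OF group_hom.intro[OF B.is_group AG.is_group
                group_hom_axioms.intro[OF base.of_braid_hom]]]
          by (auto intro: exI[of _ "[]"])
      next
        case (incl b)
        then obtain k where k: "k \<in> {1..<n}" "b = braid_gen n k" by blast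
        then show ?case using base.braid_gen_closed[OF k(1)]
          by (auto intro!: exI[of _ "[Sig k]"])
      next
        case (mult b b')
        then obtain w w' where w: "valid w" "of_braid n H b = elt w"
          and w': "valid w'" "of_braid n H b' = elt w'" by blast
        then show ?case using mult hom_mult[OF base.of_braid_hom, of b b']
          by (auto simp: elt_append intro!: exI[of _ "w @ w'"])
      qed
      then show ?thesis using 2 by blast
    qed
  next
    case (mult x y)
    then obtain w w' where "valid w" "x = elt w" "valid w'" "y = elt w'" by blast
    then show ?case by (intro exI[of _ "w @ w'"]) (simp add: elt_append)
  qed
qed (use elt_in_MM in blast)

lemma elt_wpow: "valid w \<Longrightarrow> elt (wpow w k) = elt w [^]\<^bsub>AG\<^esub> k"
  by (induction k) (simp_all add: wpow_simps(1) wpow_Suc_right elt_append wpow_letters)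

lemma elt_Delta: "elt Delta = artin_Delta n H h"
proof -
  have "elt (sigs xs) = foldr (\<lambda>k x. \<sigma> k \<cdot> x) xs \<one>\<^bsub>AG\<^esub>" for xs
    by (induction xs) simp_all
  then show ?thesis
    using cox_letters[of n] n_pos by (simp add: Delta_def elt_wpow artin_Delta_def cox_def)
qed

end

section \<open>Norms, lattices and groups of fractions\<close>

definition mprod :: "('a, 'b) monoid_scheme \<Rightarrow> 'a list \<Rightarrow> 'a" where
  "mprod G xs = foldr (\<otimes>\<^bsub>G\<^esub>) xs \<one>\<^bsub>G\<^esub>"

definition factor_lengths :: "('a, 'b) monoid_scheme \<Rightarrow> 'a \<Rightarrow> nat set" where
  "factor_lengths G a = {length xs | xs. set xs \<subseteq> carrier G - {\<one>\<^bsub>G\<^esub>} \<and> mprod G xs = a}"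

definition max_length :: "('a, 'b) monoid_scheme \<Rightarrow> 'a \<Rightarrow> nat" where
  "max_length G a = Max (factor_lengths G a)"

lemma mprod_simps [simp]: "mprod G [] = \<one>\<^bsub>G\<^esub>" "mprod G (x # xs) = x \<otimes>\<^bsub>G\<^esub> mprod G xs"
  by (simp_all add: mprod_def)

lemma (in monoid) mprod_closed: "set xs \<subseteq> carrier G \<Longrightarrow> mprod G xs \<in> carrier G"
  by (induction xs) auto

lemma (in monoid) mprod_append:
  "set xs \<subseteq> carrier G \<Longrightarrow> set ys \<subseteq> carrier G \<Longrightarrow> mprod G (xs @ ys) = mprod G xs \<otimes> mprod G ys"
  by (induction xs) (auto simp: m_assoc mprod_closed)

text \<open>Longest factorizations of \<open>a\<close> and \<open>b\<close> concatenate to one of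
  the product. The bound \<open>\<beta>\<close> makes the sets of lengths finite, so that maxima are
  attained.\<close>

lemma (in monoid) max_length_norm:
  fixes \<beta> :: "'a \<Rightarrow> nat"
  assumes "\<And>xs. set xs \<subseteq> carrier G - {\<one>} \<Longrightarrow> length xs \<le> \<beta> (mprod G xs)"
  shows "a \<in> carrier G \<Longrightarrow> max_length G a = 0 \<longleftrightarrow> a = \<one>"
    and "a \<in> carrier G \<Longrightarrow> b \<in> carrier G \<Longrightarrow> max_length G a + max_length G b \<le> max_length G (a \<otimes> b)"
proof -
  have fin: "finite (factor_lengths G a)" for a
    by (rule finite_subset[of _ "{..\<beta> a}"]) (auto simp: factor_lengths_def dest: assms)
  have ge: "length xs \<le> max_length G (mprod G xs)" if "set xs \<subseteq> carrier G - {\<one>}" for xs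
    unfolding max_length_def by (rule Max_ge[OF fin]) (use that in \<open>auto simp: factor_lengths_def\<close>)
  have attain: "\<exists>xs. set xs \<subseteq> carrier G - {\<one>} \<and> mprod G xs = a \<and> length xs = max_length G a"
    if "a \<in> carrier G" for a
  proof -
    have "length (if a = \<one> then [] else [a]) \<in> factor_lengths G a"
      unfolding factor_lengths_def using that by (intro CollectI exI conjI) (auto split: if_splits)
    then have "max_length G a \<in> factor_lengths G a"
      unfolding max_length_def by (intro Max_in fin) auto
    then show ?thesis by (auto simp: factor_lengths_def)
  qed
  show add: "max_length G a + max_length G b \<le> max_length G (a \<otimes> b)"
    if ab: "a \<in> carrier G" "b \<in> carrier G" for a b
  proof -
    obtain xs where xs: "set xs \<subseteq> carrier G - {\<one>}" "mprod G xs = a" "length xs = max_length G a"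
      using attain[OF ab(1)] by blast
    obtain ys where ys: "set ys \<subseteq> carrier G - {\<one>}" "mprod G ys = b" "length ys = max_length G b"
      using attain[OF ab(2)] by blast
    have "mprod G (xs @ ys) = a \<otimes> b" using xs ys by (subst mprod_append) auto
    then show ?thesis using ge[of "xs @ ys"] xs ys by simp
  qed
  show "max_length G a = 0 \<longleftrightarrow> a = \<one>" if "a \<in> carrier G"
    \<comment> \<open>Superadditivity at \<open>\<one>\<close> forces the value 0 there.\<close>
    using attain[OF that] add[of \<one> \<one>] by auto
qed

lemma atomic_monoid_bound:
  assumes "atomic_monoid G"
  obtains \<beta> :: "'a \<Rightarrow> nat" where
    "\<And>xs. set xs \<subseteq> carrier (G :: ('a, 'b) monoid_scheme) - {\<one>\<^bsub>G\<^esub>} \<Longrightarrow> length xs \<le> \<beta> (mprod G xs)"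
proof -
  interpret monoid G using assms by (simp add: atomic_monoid_def)
  obtain \<nu> :: "'a \<Rightarrow> nat" where \<nu>: "\<And>a. a \<in> carrier G \<Longrightarrow> \<nu> a = 0 \<longleftrightarrow> a = \<one>\<^bsub>G\<^esub>"
    "\<And>a b. a \<in> carrier G \<Longrightarrow> b \<in> carrier G \<Longrightarrow> \<nu> (a \<otimes>\<^bsub>G\<^esub> b) \<ge> \<nu> a + \<nu> b"
    using assms unfolding atomic_monoid_def by blast
  have "length xs \<le> \<nu> (mprod G xs)" if "set xs \<subseteq> carrier G - {\<one>\<^bsub>G\<^esub>}" for xs
    using that
  proof (induction xs)
    case (Cons x xs)
    have "\<nu> x + \<nu> (mprod G xs) \<le> \<nu> (mprod G (x # xs))"
      using \<nu>(2)[of x "mprod G xs"] mprod_closed[of xs] Cons.prems by auto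
    moreover have "\<nu> x \<noteq> 0" using \<nu>(1)[of x] Cons.prems by auto
    ultimately show ?case using Cons by simp
  qed simp
  then show thesis using that by blast
qed

text \<open>Factorizations are mapped factor by factor, with no factor becoming trivial. Applied to
  an automorphism and its inverse, this makes \<open>max_length\<close> invariant.\<close>

lemma (in monoid) factor_lengths_hom:
  assumes "\<And>x. x \<in> carrier G \<Longrightarrow> f x \<in> carrier G" "f \<one> = \<one>"
    "\<And>x y. x \<in> carrier G \<Longrightarrow> y \<in> carrier G \<Longrightarrow> f (x \<otimes> y) = f x \<otimes> f y"
    "\<And>x. x \<in> carrier G \<Longrightarrow> f x = \<one> \<Longrightarrow> x = \<one>"
  shows "factor_lengths G a \<subseteq> factor_lengths G (f a)"
proof
  fix l assume "l \<in> factor_lengths G a"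
  then obtain xs where xs: "l = length xs" "set xs \<subseteq> carrier G - {\<one>}" "mprod G xs = a"
    by (auto simp: factor_lengths_def)
  have "mprod G (map f xs) = f (mprod G xs)" if "set xs \<subseteq> carrier G" for xs
    using that by (induction xs) (auto simp: assms mprod_closed)
  then show "l \<in> factor_lengths G (f a)"
    unfolding factor_lengths_def using xs assms(1,4)
    by (intro CollectI exI[of _ "map f xs"]) auto
qed

lemma (in monoid) atomic_monoidI:
  fixes \<beta> :: "'a \<Rightarrow> nat"
  assumes "\<And>xs. set xs \<subseteq> carrier G - {\<one>} \<Longrightarrow> length xs \<le> \<beta> (mprod G xs)"
  shows "atomic_monoid G"
  unfolding atomic_monoid_def using max_length_norm[of \<beta>] assms monoid_axioms
  by (intro conjI exI[of _ "max_length G"]) auto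

section \<open>Lattices from one kind of bound and a norm\<close>

abbreviation poset :: "'a set \<Rightarrow> ('a \<Rightarrow> 'a \<Rightarrow> bool) \<Rightarrow> 'a gorder" where
  "poset A leq \<equiv> \<lparr>carrier = A, eq = (=), le = leq\<rparr>"

lemma lattice_posetI:
  assumes "\<And>x. x \<in> A \<Longrightarrow> leq x x"
    and "\<And>x y. x \<in> A \<Longrightarrow> y \<in> A \<Longrightarrow> leq x y \<Longrightarrow> leq y x \<Longrightarrow> x = y"
    and "\<And>x y z. x \<in> A \<Longrightarrow> y \<in> A \<Longrightarrow> z \<in> A \<Longrightarrow> leq x y \<Longrightarrow> leq y z \<Longrightarrow> leq x z"
    and "\<And>x y. x \<in> A \<Longrightarrow> y \<in> A \<Longrightarrow>
      \<exists>s\<in>A. leq x s \<and> leq y s \<and> (\<forall>u\<in>A. leq x u \<longrightarrow> leq y u \<longrightarrow> leq s u)"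
    and "\<And>x y. x \<in> A \<Longrightarrow> y \<in> A \<Longrightarrow>
      \<exists>s\<in>A. leq s x \<and> leq s y \<and> (\<forall>u\<in>A. leq u x \<longrightarrow> leq u y \<longrightarrow> leq u s)"
  shows "lattice (poset A leq)"
proof
  fix x y assume xy: "x \<in> carrier (poset A leq)" "y \<in> carrier (poset A leq)"
  show "\<exists>s. least (poset A leq) s (Upper (poset A leq) {x, y})"
    using assms(4)[of x y] xy by (auto simp: least_def Upper_def)
  show "\<exists>s. greatest (poset A leq) s (Lower (poset A leq) {x, y})"
    using assms(5)[of x y] xy by (auto simp: greatest_def Lower_def)
next
  fix x y z assume "gorder.le (poset A leq) x y" "gorder.le (poset A leq) y z" "x \<in> carrier (poset A leq)"
    "y \<in> carrier (poset A leq)" "z \<in> carrier (poset A leq)"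
  then show "gorder.le (poset A leq) x z" using assms(3)[of x y z] by simp
next
  fix x y assume "gorder.le (poset A leq) x y" "gorder.le (poset A leq) y x" "x \<in> carrier (poset A leq)"
    "y \<in> carrier (poset A leq)"
  then show "x .=\<^bsub>poset A leq\<^esub> y" using assms(2)[of x y] by simp
qed (simp_all add: assms(1))

lemma lattice_poset_lub:
  assumes "lattice (poset A leq)" "x \<in> A" "y \<in> A"
  shows "\<exists>s\<in>A. leq x s \<and> leq y s \<and> (\<forall>u\<in>A. leq x u \<longrightarrow> leq y u \<longrightarrow> leq s u)"
proof -
  interpret lattice "poset A leq" by fact
  show ?thesis using sup_of_two_exists[of x y] assms(2,3) by (auto simp: least_def Upper_def)
qed

lemma extremal_bound:
  fixes \<nu> :: "'a \<Rightarrow> nat"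
  assumes "P z0" "\<And>z. P z \<Longrightarrow> \<nu> z \<le> B"
  obtains z where "P z" "\<And>w. P w \<Longrightarrow> \<nu> w \<le> \<nu> z"
  using assms ex_has_greatest_nat[of P z0 \<nu> "Suc B"] by (metis le_imp_less_Suc)

text \<open>A common lower bound of maximal norm is a greatest one, since its join with any other
  common lower bound is again a common lower bound.\<close>

lemma lattice_from_lubs:
  fixes \<nu> :: "'a \<Rightarrow> nat"
  assumes refl: "\<And>x. x \<in> A \<Longrightarrow> leq x x"
    and trans: "\<And>x y z. x \<in> A \<Longrightarrow> y \<in> A \<Longrightarrow> z \<in> A \<Longrightarrow> leq x y \<Longrightarrow> leq y z \<Longrightarrow> leq x z"
    and norm: "\<And>x y. x \<in> A \<Longrightarrow> y \<in> A \<Longrightarrow> leq x y \<Longrightarrow> x = y \<or> \<nu> x < \<nu> y"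
    and bot: "b \<in> A" "\<And>x. x \<in> A \<Longrightarrow> leq b x"
    and lub: "\<And>x y. x \<in> A \<Longrightarrow> y \<in> A \<Longrightarrow>
      \<exists>s\<in>A. leq x s \<and> leq y s \<and> (\<forall>u\<in>A. leq x u \<longrightarrow> leq y u \<longrightarrow> leq s u)"
  shows "lattice (poset A leq)"
proof (rule lattice_posetI[OF refl _ trans lub])
  show "x = y" if "x \<in> A" "y \<in> A" "leq x y" "leq y x" for x y
    using norm[OF that(1-3)] norm[OF that(2,1,4)] by auto
  fix x y assume xy: "x \<in> A" "y \<in> A"
  let ?P = "\<lambda>z. z \<in> A \<and> leq z x \<and> leq z y"
  have "?P b" using bot xy by blast
  moreover have "\<nu> z \<le> \<nu> x" if "?P z" for z using norm[of z x] that xy by auto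
  ultimately obtain z where z: "?P z" "\<And>w. ?P w \<Longrightarrow> \<nu> w \<le> \<nu> z"
    using extremal_bound[of ?P b \<nu> "\<nu> x"] by blast
  have "leq w z" if w: "w \<in> A" "leq w x" "leq w y" for w
  proof -
    obtain s where s: "s \<in> A" "leq z s" "leq w s" "\<And>u. u \<in> A \<Longrightarrow> leq z u \<Longrightarrow> leq w u \<Longrightarrow> leq s u"
      using lub[of z w] z w by blast
    then have "\<nu> s \<le> \<nu> z" using z(1) w xy by (intro z(2)) blast
    then have "z = s" using norm[of z s] s z by auto
    then show ?thesis using s by simp
  qed
  then show "\<exists>s\<in>A. leq s x \<and> leq s y \<and> (\<forall>u\<in>A. leq u x \<longrightarrow> leq u y \<longrightarrow> leq u s)"
    using z by blast
qed

text \<open>Dual argument: a common upper bound of minimal norm is least, since its meet with any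
  other upper bound is again one. The premise \<open>upper\<close> replaces the bottom
  element.\<close>

lemma lattice_from_glbs:
  fixes \<nu> :: "'a \<Rightarrow> nat"
  assumes refl: "\<And>x. x \<in> A \<Longrightarrow> leq x x"
    and trans: "\<And>x y z. x \<in> A \<Longrightarrow> y \<in> A \<Longrightarrow> z \<in> A \<Longrightarrow> leq x y \<Longrightarrow> leq y z \<Longrightarrow> leq x z"
    and norm: "\<And>x y. x \<in> A \<Longrightarrow> y \<in> A \<Longrightarrow> leq x y \<Longrightarrow> x = y \<or> \<nu> x < \<nu> y"
    and upper: "\<And>x y. x \<in> A \<Longrightarrow> y \<in> A \<Longrightarrow> \<exists>z\<in>A. leq x z \<and> leq y z"
    and glb: "\<And>x y. x \<in> A \<Longrightarrow> y \<in> A \<Longrightarrow>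
      \<exists>s\<in>A. leq s x \<and> leq s y \<and> (\<forall>u\<in>A. leq u x \<longrightarrow> leq u y \<longrightarrow> leq u s)"
  shows "lattice (poset A leq)"
proof (rule lattice_posetI[OF refl _ trans _ glb])
  show "x = y" if "x \<in> A" "y \<in> A" "leq x y" "leq y x" for x y
    using norm[OF that(1-3)] norm[OF that(2,1,4)] by auto
  fix x y assume xy: "x \<in> A" "y \<in> A"
  let ?P = "\<lambda>z. z \<in> A \<and> leq x z \<and> leq y z"
  obtain z0 where z0: "?P z0" using upper[OF xy] by blast
  obtain z where z: "?P z" "\<And>w. ?P w \<Longrightarrow> \<nu> z \<le> \<nu> w"
    using ex_has_least_nat[of ?P z0 \<nu>] z0 by blast
  have "leq z w" if w: "w \<in> A" "leq x w" "leq y w" for w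
  proof -
    obtain s where s: "s \<in> A" "leq s z" "leq s w" "\<And>u. u \<in> A \<Longrightarrow> leq u z \<Longrightarrow> leq u w \<Longrightarrow> leq u s"
      using glb[of z w] z w by blast
    then have "\<nu> z \<le> \<nu> s" using z(1) w xy by (intro z(2)) blast
    then have "s = z" using norm[of s z] s z by auto
    then show ?thesis using s by simp
  qed
  then show "\<exists>s\<in>A. leq x s \<and> leq y s \<and> (\<forall>u\<in>A. leq x u \<longrightarrow> leq y u \<longrightarrow> leq s u)"
    using z by blast
qed

lemma mgenerate_carrier_update: "mgenerate (G\<lparr>carrier := N\<rparr>) S = mgenerate G S"
proof (intro equalityI subsetI)
  fix x assume "x \<in> mgenerate (G\<lparr>carrier := N\<rparr>) S"
  then show "x \<in> mgenerate G S"
    by (induction rule: mgenerate.induct) (auto intro: mgenerate.intros)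
next
  fix x assume "x \<in> mgenerate G S"
  then show "x \<in> mgenerate (G\<lparr>carrier := N\<rparr>) S"
  proof (induction rule: mgenerate.induct)
    case one
    then show ?case using mgenerate.one[of "G\<lparr>carrier := N\<rparr>" S] by simp
  next
    case (incl x)
    then show ?case by (rule mgenerate.incl)
  next
    case (mult x y)
    then show ?case using mgenerate.mult[of x "G\<lparr>carrier := N\<rparr>" S y] by simp
  qed
qed

section \<open>Submonoids of groups and the Ore condition\<close>

lemma (in group) submonoid_le:
  assumes "N \<subseteq> carrier G" "x \<in> N" "y \<in> N"
  shows "left_le (G\<lparr>carrier := N\<rparr>) x y \<longleftrightarrow> inv x \<otimes> y \<in> N"
    and "right_le (G\<lparr>carrier := N\<rparr>) x y \<longleftrightarrow> y \<otimes> inv x \<in> N"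
proof -
  have xy: "x \<in> carrier G" "y \<in> carrier G" using assms by auto
  have 1: "y = x \<otimes> c \<longleftrightarrow> inv x \<otimes> y = c" if "c \<in> N" for c
    using xy that assms(1) by (auto simp: inv_solve_left m_assoc[symmetric] subset_iff)
  have 2: "y = c \<otimes> x \<longleftrightarrow> y \<otimes> inv x = c" if "c \<in> N" for c
    using xy that assms(1) by (auto simp: inv_solve_right m_assoc subset_iff)
  show "left_le (G\<lparr>carrier := N\<rparr>) x y \<longleftrightarrow> inv x \<otimes> y \<in> N"
    using 1 by (auto simp: left_le_def factor_def)
  show "right_le (G\<lparr>carrier := N\<rparr>) x y \<longleftrightarrow> y \<otimes> inv x \<in> N"
    using 2 by (auto simp: right_le_def)
qed

lemma frac_generates:
  assumes "is_group_of_fractions_of G N" "subgroup K G" "N \<subseteq> K"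
  shows "carrier G \<subseteq> K"
proof
  let ?R = "frac_rels (G\<lparr>carrier := N\<rparr>)" and ?Q = "group_of_fractions (G\<lparr>carrier := N\<rparr>)"
  obtain E where E: "E \<in> iso ?Q G" "\<And>x. x \<in> N \<Longrightarrow> E (pres_gen N ?R x) = x"
    using frac_iso[OF assms(1)] by blast
  have "group G" using assms(1) by (simp add: is_group_of_fractions_of_def)
  moreover have "E \<in> hom (presented_group N ?R) G"
    using E(1) by (simp add: iso_def group_of_fractions_def)
  ultimately have K: "E q \<in> K" if "q \<in> carrier (presented_group N ?R)" for q
    by (rule presented_hom_into_subgroup[OF _ _ assms(2) _ that]) (use E(2) assms(3) in auto)
  fix x assume "x \<in> carrier G"
  then have "x \<in> E ` carrier ?Q" using E(1) by (simp add: iso_def bij_betw_def)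
  then show "x \<in> K" using K by (auto simp: group_of_fractions_def)
qed

text \<open>By the Ore condition every element of the abstract group of fractions is
  \<open>x y^-1\<close> with \<open>x\<close>, \<open>y\<close> in \<open>N\<close>; if it is
  trivial in \<open>G\<close>, then \<open>x = y\<close>.\<close>

lemma (in group) is_group_of_fractions_ofI:
  assumes N: "submonoid N G"
    and gen: "\<And>K. subgroup K G \<Longrightarrow> N \<subseteq> K \<Longrightarrow> carrier G \<subseteq> K"
    and ore: "\<And>x y. x \<in> N \<Longrightarrow> y \<in> N \<Longrightarrow> \<exists>u\<in>N. \<exists>v\<in>N. x \<otimes> u = y \<otimes> v"
  shows "is_group_of_fractions_of G N"
proof -
  let ?R = "frac_rels (G\<lparr>carrier := N\<rparr>)"
  let ?Q = "presented_group N ?R" and ?E = "pres_lift N ?R G (\<lambda>x. x)"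
  let ?p = "pres_gen N ?R"
  interpret Q: group ?Q by (rule group_presented_group)
  have sub: "N \<subseteq> carrier G" using N submonoid.subset by blast
  have res: "respects_rels N ?R G (\<lambda>x. x)"
    using sub by (auto simp: respects_rels_def frac_rels_def subset_iff)
  have E: "?E \<in> hom ?Q G" by (rule pres_lift_hom[OF is_group res])
  interpret E: group_hom ?Q G ?E
    using E by (simp add: group_hom_def group_hom_axioms_def Q.is_group is_group)
  have Ep: "?E (?p x) = x" if "x \<in> N" for x by (rule pres_lift_gen[OF is_group res that])
  have pc [simp]: "?p x \<in> carrier ?Q" if "x \<in> N" for x by (rule pres_gen_closed[OF that])
  have pm: "?p (x \<otimes> y) = ?p x \<otimes>\<^bsub>?Q\<^esub> ?p y" if "x \<in> N" "y \<in> N" for x y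
  proof -
    have xy: "x \<otimes> y \<in> N" using submonoid.m_closed[OF N that] .
    have "word_class N ?R [(True, x), (True, y)] = word_class N ?R [(True, x \<otimes> y)]"
      using that xy by (intro pres_gen_relation) (auto simp: frac_rels_def)
    then show ?thesis using that by (simp add: pres_gen_def presented_group_mult)
  qed
  have frac: "\<exists>x\<in>N. \<exists>y\<in>N. q = ?p x \<otimes>\<^bsub>?Q\<^esub> inv\<^bsub>?Q\<^esub> (?p y)" if "q \<in> carrier ?Q" for q
  proof -
    obtain w where w: "w \<in> words N" "q = word_class N ?R w"
      using \<open>q \<in> carrier ?Q\<close> by (auto simp: presented_group_carrier)
    have "\<exists>x\<in>N. \<exists>y\<in>N. word_eval ?Q ?p w = ?p x \<otimes>\<^bsub>?Q\<^esub> inv\<^bsub>?Q\<^esub> (?p y)" using w(1)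
    proof (induction w)
      case Nil
      have one: "\<one> \<in> N" by (rule submonoid.one_closed[OF N])
      then show ?case by (intro bexI[of _ \<one>]) auto
    next
      case (Cons c w)
      obtain b s where c: "c = (b, s)" by fastforce
      have s: "s \<in> N" "w \<in> words N" using Cons.prems c by auto
      obtain x y where xy: "x \<in> N" "y \<in> N" "word_eval ?Q ?p w = ?p x \<otimes>\<^bsub>?Q\<^esub> inv\<^bsub>?Q\<^esub> (?p y)"
        using Cons.IH s by blast
      show ?case
      proof (cases b)
        case True
        then show ?thesis using s xy c submonoid.m_closed[OF N s(1) xy(1)]
          by (intro bexI[of _ "s \<otimes> x"] bexI[of _ y]) (auto simp: pm Q.m_assoc)
      next
        case False
        \<comment> \<open>From \<open>s u = x v\<close> the product \<open>s^-1 x\<close> becomes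
          \<open>u v^-1\<close>, which moves the inverse to the right.\<close>
        obtain u v where uv: "u \<in> N" "v \<in> N" "s \<otimes> u = x \<otimes> v" using ore[OF s(1) xy(1)] by blast
        have "?p s \<otimes>\<^bsub>?Q\<^esub> ?p u = ?p x \<otimes>\<^bsub>?Q\<^esub> ?p v" using pm uv s xy by metis
        then have "?p x = ?p s \<otimes>\<^bsub>?Q\<^esub> (?p u \<otimes>\<^bsub>?Q\<^esub> inv\<^bsub>?Q\<^esub> (?p v))"
          using uv s xy by (simp add: Q.m_assoc[symmetric]) (simp add: Q.m_assoc)
        then have "?p u \<otimes>\<^bsub>?Q\<^esub> inv\<^bsub>?Q\<^esub> (?p v) = inv\<^bsub>?Q\<^esub> (?p s) \<otimes>\<^bsub>?Q\<^esub> ?p x"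
          using uv s xy by (subst Q.inv_solve_left) simp_all
        then have "inv\<^bsub>?Q\<^esub> (?p s) \<otimes>\<^bsub>?Q\<^esub> ?p x = ?p u \<otimes>\<^bsub>?Q\<^esub> inv\<^bsub>?Q\<^esub> (?p v)" ..
        then have "word_eval ?Q ?p (c # w) = ?p u \<otimes>\<^bsub>?Q\<^esub> inv\<^bsub>?Q\<^esub> (?p (y \<otimes> v))"
          using False c xy uv s by (simp add: pm Q.inv_mult_group flip: Q.m_assoc)
        then show ?thesis using uv xy submonoid.m_closed[OF N xy(2) uv(2)] by blast
      qed
    qed
    then show ?thesis using w word_class_eval by metis
  qed
  have "inj_on ?E (carrier ?Q)"
  proof (rule E.trivial_ker_imp_inj)
    show "kernel ?Q G ?E = {\<one>\<^bsub>?Q\<^esub>}"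
    proof (intro equalityI subsetI)
      fix q assume "q \<in> kernel ?Q G ?E"
      then have q: "q \<in> carrier ?Q" "?E q = \<one>" by (auto simp: kernel_def)
      obtain x y where xy: "x \<in> N" "y \<in> N" "q = ?p x \<otimes>\<^bsub>?Q\<^esub> inv\<^bsub>?Q\<^esub> (?p y)" using frac[OF q(1)] by blast
      have "x \<otimes> inv y = \<one>" using q(2) xy by (simp add: Ep)
      then have "x = y" using xy sub by (metis inv_equality inv_inv subsetD inv_closed)
      then show "q \<in> {\<one>\<^bsub>?Q\<^esub>}" using xy by simp
    qed (auto simp: kernel_def)
  qed
  moreover have "?E ` carrier ?Q = carrier G"
  proof
    show "carrier G \<subseteq> ?E ` carrier ?Q"
    proof (rule gen)
      show "subgroup (?E ` carrier ?Q) G" by (rule E.img_is_subgroup)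
      show "N \<subseteq> ?E ` carrier ?Q" using Ep pc by (metis imageI subsetI)
    qed
  qed auto
  ultimately show ?thesis
    unfolding is_group_of_fractions_of_def group_of_fractions_def
    using E N is_group by (simp add: iso_def bij_betw_def)
qed

section \<open>The Garside structure\<close>

context artin_datum
begin

interpretation AG: group AG by (rule base.group_AG)

abbreviation "MR \<equiv> AG\<lparr>carrier := MM\<rparr>"

lemma MM_cases:
  assumes "x \<in> MM"
  obtains w where "valid w" "x = elt w"
  using assms MM_eq_elt by blast

lemma MM_carrier: "MM \<subseteq> carrier AG"
  by (auto elim!: MM_cases intro: elt_closed)

lemma MM_one: "\<one>\<^bsub>AG\<^esub> \<in> MM"
  using elt_in_MM[of "[]"] by simp

lemma MM_mult: "x \<in> MM \<Longrightarrow> y \<in> MM \<Longrightarrow> x \<cdot> y \<in> MM"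
  unfolding artin_submonoid_def by (rule mgenerate.mult)

lemma MM_submonoid: "submonoid MM AG"
  by (rule submonoid.intro[OF MM_carrier MM_mult MM_one])

lemma MM_monoid: "monoid MR"
  by (rule submonoid.submonoid_is_monoid[OF MM_submonoid AG.is_monoid])

interpretation MR: monoid MR by (rule MM_monoid)

text \<open>Independent of the chosen word by \<open>elt_eq_iff\<close> and \<open>norm_eqv\<close>.
  It serves as bound on factorization lengths; the norm of the monoid is then
  \<open>max_length\<close>.\<close>

definition word_norm :: "'a artin_elt \<Rightarrow> nat" where
  "word_norm x = norm (SOME w. valid w \<and> x = elt w)"

lemma word_norm_elt:
  assumes "valid w"
  shows "word_norm (elt w) = norm w"
proof -
  let ?v = "SOME v. valid v \<and> elt w = elt v"
  have v: "valid ?v \<and> elt w = elt ?v" by (rule someI[of _ w]) (simp add: assms)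
  then have "w \<approx> ?v" using elt_eq_iff[OF assms, of ?v] by blast
  then show ?thesis using norm_eqv assms by (simp add: word_norm_def)
qed

text \<open>A nontrivial factor needs at least one letter, and each letter raises
  \<open>norm\<close>.\<close>

lemma word_norm_bound:
  assumes "set xs \<subseteq> carrier MR - {\<one>\<^bsub>MR\<^esub>}"
  shows "length xs \<le> word_norm (mprod MR xs)"
proof -
  have "\<exists>w. valid w \<and> mprod MR xs = elt w \<and> length xs \<le> length w"
    using assms
  proof (induction xs)
    case Nil
    then show ?case by (intro exI[of _ "[]"]) simp
  next
    case (Cons x xs)
    then obtain w where w: "valid w" "mprod MR xs = elt w" "length xs \<le> length w" by auto
    have "x \<in> MM" "x \<noteq> \<one>\<^bsub>AG\<^esub>" using Cons.prems by auto
    then obtain u where u: "valid u" "x = elt u" by (auto elim: MM_cases)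
    with \<open>x \<noteq> \<one>\<^bsub>AG\<^esub>\<close> have "1 \<le> length u" by (cases u) auto
    then show ?case using u w by (intro exI[of _ "u @ w"]) (simp add: elt_append)
  qed
  then obtain w where w: "valid w" "mprod MR xs = elt w" "length xs \<le> length w" by blast
  then show ?thesis using norm_append[of w "[]"] word_norm_elt[of w] by simp
qed

lemma atomic_MR: "atomic_monoid MR"
  using MR.atomic_monoidI word_norm_bound by blast

abbreviation "\<nu> \<equiv> max_length MR"

lemma nu_zero: "x \<in> MM \<Longrightarrow> \<nu> x = 0 \<longleftrightarrow> x = \<one>\<^bsub>AG\<^esub>"
  using MR.max_length_norm(1)[OF word_norm_bound, of x] by simp

lemma nu_mult: "x \<in> MM \<Longrightarrow> y \<in> MM \<Longrightarrow> \<nu> x + \<nu> y \<le> \<nu> (x \<cdot> y)"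
  using MR.max_length_norm(2)[OF word_norm_bound, of x y] by simp

text \<open>Applied to a finite generating set of \<open>M\<close>, and to the divisors of
  \<open>h\<close> for the Garside element.\<close>

lemma MR_generated:
  assumes T: "T \<subseteq> MM" and S: "mgenerate H S = M" "\<And>x. x \<in> S \<Longrightarrow> \<eta> x \<in> T"
    and Sig: "\<And>i. i \<in> {1..<n} \<Longrightarrow> \<sigma> i \<in> T"
  shows "mgenerate MR T = carrier MR"
proof -
  have mon: "\<eta> a \<in> mgenerate AG T" if "a \<in> M" for a
  proof -
    have "a \<in> mgenerate H S \<Longrightarrow> a \<in> M \<and> \<eta> a \<in> mgenerate AG T" for a
    proof (induction rule: mgenerate.induct)
      case one
      then show ?case using elt_mword[OF M_one] mgenerate.one[of AG T] by (simp add: mword_def)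
    next
      case (incl x)
      then show ?case using S mgenerate.incl by metis
    next
      case (mult x y)
      then show ?case using hom_mult[OF phi_hom, of x y] mgenerate.mult[of _ AG T] by simp
    qed
    then show ?thesis using that S(1) by blast
  qed
  have "elt w \<in> mgenerate AG T" if "valid w" for w
    using that
  proof (induction w)
    case Nil
    then show ?case using mgenerate.one[of AG T] by simp
  next
    case (Cons s w)
    have "s \<in> letters" using Cons by simp
    then have "elt_letter s \<in> mgenerate AG T"
    proof (cases rule: letters_cases)
      case (1 a)
      then show ?thesis using mon by simp
    next
      case (2 i)
      then show ?thesis using mgenerate.incl[OF Sig[of i], of AG] by simp
    qed
    then show ?case using Cons mgenerate.mult[of "elt_letter s" AG T "elt w"] by simp
  qed
  then have "MM \<subseteq> mgenerate AG T" by (auto elim!: MM_cases)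
  moreover have "x \<in> mgenerate AG T \<Longrightarrow> x \<in> MM" for x
    by (induction rule: mgenerate.induct) (use T MM_one MM_mult in auto)
  ultimately show ?thesis by (auto simp: mgenerate_carrier_update)
qed

lemma finitely_generated_MR:
  assumes "finite S" "mgenerate H S = M"
  shows "finitely_generated_monoid MR"
proof -
  let ?T = "(\<lambda>x. \<eta> x) ` S \<union> (\<lambda>i. \<sigma> i) ` {1..<n}"
  have "\<eta> x \<in> MM" if "x \<in> S" for x
  proof -
    have x: "x \<in> M" using mgenerate.incl[OF that, of H] by (simp add: assms(2))
    then show ?thesis using elt_in_MM[OF mon_letters[OF x]] by (simp add: elt_mword)
  qed
  moreover have "\<sigma> i \<in> MM" if "i \<in> {1..<n}" for i
    using elt_in_MM[of "[Sig i]"] that elt_letter_closed[of "Sig i"] by simp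
  ultimately have T: "?T \<subseteq> MM" by blast
  have "mgenerate MR ?T = carrier MR" by (rule MR_generated[OF T assms(2)]) auto
  then show ?thesis unfolding finitely_generated_monoid_def
    using MM_monoid T assms(1) by (intro conjI exI[of _ ?T]) auto
qed

lemma monoid_cancel_MR: "monoid_cancel MR"
  by (rule MR.monoid_cancelI) (use MM_carrier in \<open>auto simp: subset_iff\<close>)

lemma inv_mem [simp]: "x \<in> MM \<Longrightarrow> x \<in> carrier AG"
  using MM_carrier by blast

lemma AG_cancel [simp]:
  "x \<in> carrier AG \<Longrightarrow> y \<in> carrier AG \<Longrightarrow> \<iota> x \<cdot> (x \<cdot> y) = y"
  "x \<in> carrier AG \<Longrightarrow> y \<in> carrier AG \<Longrightarrow> x \<cdot> (\<iota> x \<cdot> y) = y"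
  by (simp_all flip: AG.m_assoc)

section \<open>Left and right divisibility\<close>

abbreviation "lle x y \<equiv> \<iota> x \<cdot> y \<in> MM"
abbreviation "rle x y \<equiv> y \<cdot> \<iota> x \<in> MM"

lemma lle_iff: "x \<in> MM \<Longrightarrow> y \<in> MM \<Longrightarrow> left_le MR x y \<longleftrightarrow> lle x y"
  and rle_iff: "x \<in> MM \<Longrightarrow> y \<in> MM \<Longrightarrow> right_le MR x y \<longleftrightarrow> rle x y"
  using AG.submonoid_le[OF MM_carrier] by auto

lemma MM_lub:
  assumes "x \<in> MM" "y \<in> MM"
  shows "\<exists>z\<in>MM. lle x z \<and> lle y z \<and> (\<forall>w\<in>MM. lle x w \<longrightarrow> lle y w \<longrightarrow> lle z w)"
proof -
  obtain u where u: "valid u" "x = elt u" using assms(1) by (rule MM_cases)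
  obtain v where v: "valid v" "y = elt v" using assms(2) by (rule MM_cases)
  obtain a b where ab: "valid a" "valid b" "u @ a \<approx> v @ b"
    "\<And>w w'. valid w \<Longrightarrow> u @ w \<approx> v @ w' \<Longrightarrow> \<exists>z. valid z \<and> w \<approx> a @ z"
    using word_lcm[OF u(1) v(1)] by blast
  have e: "elt (u @ a) = elt (v @ b)" using ab u v by (intro eqv_imp_elt_eq) auto
  have x: "lle x (elt (u @ a))" using elt_in_MM[OF ab(1)] by (simp add: u ab elt_append elt_closed)
  have y: "lle y (elt (u @ a))"
    unfolding e using elt_in_MM[OF ab(2)] by (simp add: v ab elt_append elt_closed)
  have "lle (elt (u @ a)) w" if w: "w \<in> MM" "lle x w" "lle y w" for w
  proof -
    obtain p where p: "valid p" "\<iota> x \<cdot> w = elt p" using w(2) by (rule MM_cases)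
    obtain q where q: "valid q" "\<iota> y \<cdot> w = elt q" using w(3) by (rule MM_cases)
    have wpow: "w = elt (u @ p)" using u p assms w AG_cancel(2)[of x w] by (simp add: elt_append)
    have wq: "w = elt (v @ q)" using v q assms w AG_cancel(2)[of y w] by (simp add: elt_append)
    have "u @ p \<approx> v @ q" using elt_eq_iff[of "u @ p" "v @ q"] u v p q wpow wq by simp
    then obtain z where z: "valid z" "p \<approx> a @ z" using ab(4) p by blast
    then have "elt p = elt a \<cdot> elt z" using eqv_imp_elt_eq[OF z(2) p(1)] ab by (simp add: elt_append)
    then have "w = elt (u @ a) \<cdot> elt z" using wpow u p ab z by (simp add: elt_append elt_closed AG.m_assoc)
    then show ?thesis using elt_in_MM[OF z(1)] u ab z by (simp add: elt_closed)
  qed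
  moreover have "elt (u @ a) \<in> MM" using u ab by (intro elt_in_MM) simp
  ultimately show ?thesis using x y by blast
qed

abbreviation "D \<equiv> elt Delta"
abbreviation "Dpow (k :: nat) \<equiv> D [^]\<^bsub>AG\<^esub> k"

lemma D_MM: "D \<in> MM"
  by (rule elt_in_MM[OF Delta_letters])

lemma D_normal:
  assumes "x \<in> MM"
  shows "D \<cdot> x \<cdot> \<iota> D \<in> MM" "\<iota> D \<cdot> x \<cdot> D \<in> MM"
proof -
  obtain w where w: "valid w" "x = elt w" using assms by (rule MM_cases)
  have t: "valid (twist n w)" using w by (intro twist_letters)
  have "elt (twist n w @ Delta) = elt (Delta @ w)"
    using Delta_twist[OF w(1)] t Delta_letters by (intro eqv_imp_elt_eq) auto
  then have "D \<cdot> x = elt (twist n w) \<cdot> D" using w t Delta_letters by (simp add: elt_append)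
  then show "D \<cdot> x \<cdot> \<iota> D \<in> MM"
    using elt_in_MM[OF t] D_MM by (simp add: AG.m_assoc)
  obtain w' where w': "valid w'" "w @ Delta \<approx> Delta @ w'"
    using Delta_normal[OF w(1)] by blast
  have "elt (w @ Delta) = elt (Delta @ w')" using w' w Delta_letters by (intro eqv_imp_elt_eq) auto
  then have "x \<cdot> D = D \<cdot> elt w'" using w w' Delta_letters by (simp add: elt_append)
  then show "\<iota> D \<cdot> x \<cdot> D \<in> MM"
    using elt_in_MM[OF w'(1)] D_MM w w' by (simp add: AG.m_assoc elt_closed)
qed

text \<open>Conjugation by \<open>D\<close> exchanges the left quotient
  \<open>\<iota> x \<cdot> D\<close> and the right quotient
  \<open>D \<cdot> \<iota> x\<close>.\<close>

lemma D_lle_rle: "x \<in> MM \<Longrightarrow> lle x D \<longleftrightarrow> rle x D"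
proof
  assume x: "x \<in> MM"
  show "rle x D" if "lle x D"
    using D_normal(1)[OF that] x D_MM by (simp add: AG.m_assoc)
  show "lle x D" if "rle x D"
    using D_normal(2)[OF that] x D_MM by (simp add: AG.m_assoc)
qed

text \<open>Quasi-centrality of \<open>D\<close> turns left quotients of its powers into right quotients.\<close>

lemma rle_D_power:
  assumes "x \<in> MM"
  shows "\<exists>k :: nat. rle x (Dpow k)"
proof -
  obtain w where w: "valid w" "x = elt w" using assms by (rule MM_cases)
  obtain q k where q: "valid q" "w @ q \<approx> wpow Delta k"
    using word_divides_Delta_power[OF w(1)] by (auto simp: dvd_Dpow_def)
  have "elt (w @ q) = elt (wpow Delta k)" using q w by (intro eqv_imp_elt_eq) auto
  then have e: "x \<cdot> elt q = Dpow k" using w q Delta_letters by (simp add: elt_append elt_wpow)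
  have "Dpow k \<cdot> z \<cdot> \<iota> (Dpow k) \<in> MM" if "z \<in> MM" for z and k :: nat
    using that
  proof (induction k arbitrary: z)
    case (Suc k)
    have "Dpow k \<cdot> (D \<cdot> z \<cdot> \<iota> D) \<cdot> \<iota> (Dpow k) \<in> MM"
      using D_normal(1)[OF Suc.prems] by (rule Suc.IH)
    then show ?case using Suc.prems D_MM by (simp add: AG.m_assoc AG.inv_mult_group)
  qed simp
  \<comment> \<open>Since \<open>x \<cdot> elt q = Dpow k\<close>, this conjugate of
    \<open>elt q\<close> equals \<open>Dpow k \<cdot> \<iota> x\<close>.\<close>
  from this[OF elt_in_MM[OF q(1)], of k]
  have "Dpow k \<cdot> elt q \<cdot> \<iota> (x \<cdot> elt q) \<in> MM" by (simp add: e)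
  then show ?thesis using assms q elt_closed[OF q(1)] D_MM
    by (intro exI[of _ k]) (simp add: AG.m_assoc AG.inv_mult_group)
qed

lemma D_power_MM: "Dpow k \<in> MM"
  by (induction k) (simp_all add: MM_one MM_mult D_MM)

lemma rle_D_power_add:
  assumes "x \<in> MM" "rle x (Dpow k)"
  shows "rle x (Dpow (l + k))"
proof -
  have "Dpow l \<cdot> (Dpow k \<cdot> \<iota> x) \<in> MM" using D_power_MM assms(2) by (rule MM_mult)
  then show ?thesis using assms D_MM by (simp add: AG.m_assoc AG.nat_pow_mult[symmetric])
qed

lemma rle_common:
  assumes "x \<in> MM" "y \<in> MM"
  obtains k :: nat where "rle x (Dpow k)" "rle y (Dpow k)"
proof -
  obtain k l where "rle x (Dpow k)" "rle y (Dpow l)"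
    using rle_D_power assms by meson
  then have "rle x (Dpow (l + k))" "rle y (Dpow (k + l))"
    using rle_D_power_add assms by blast+
  then show thesis using that[of "l + k"] by (simp add: add.commute)
qed

text \<open>Passing from \<open>w\<close> to \<open>Dpow k \<cdot> \<iota> w\<close> turns right
  divisibility into left divisibility and reverses it. The right gcd is therefore the complement of
  a left lcm.\<close>

lemma MM_right_glb:
  assumes x: "x \<in> MM" and y: "y \<in> MM"
  shows "\<exists>z\<in>MM. rle z x \<and> rle z y \<and> (\<forall>w\<in>MM. rle w x \<longrightarrow> rle w y \<longrightarrow> rle w z)"
proof -
  obtain k :: nat where k: "rle x (Dpow k)" "rle y (Dpow k)" using rle_common[OF assms] .
  let ?P = "Dpow k"
  let ?a = "?P \<cdot> \<iota> x" and ?b = "?P \<cdot> \<iota> y"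
  have P: "?P \<in> carrier AG" using D_MM by simp
  note c = P inv_mem[OF x] inv_mem[OF y]
  obtain l where l: "l \<in> MM" "lle ?a l" "lle ?b l" "\<And>w. w \<in> MM \<Longrightarrow> lle ?a w \<Longrightarrow> lle ?b w \<Longrightarrow> lle l w"
    using MM_lub[OF k] by blast
  \<comment> \<open>\<open>?P\<close> is a common multiple of \<open>?a\<close> and
    \<open>?b\<close>, with quotients \<open>x\<close> and \<open>y\<close>.\<close>
  have "lle l ?P"
    by (rule l(4)) (use D_power_MM x y c in \<open>simp_all add: AG.inv_mult_group AG.m_assoc\<close>)
  moreover have "rle (\<iota> l \<cdot> ?P) x" "rle (\<iota> l \<cdot> ?P) y"
    using l(2,3) c inv_mem[OF l(1)] by (simp_all add: AG.inv_mult_group AG.m_assoc)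
  moreover have "rle w (\<iota> l \<cdot> ?P)" if w: "w \<in> MM" "rle w x" "rle w y" for w
  proof -
    have wc: "w \<in> carrier AG" using w by simp
    have "?a \<cdot> (x \<cdot> \<iota> w) \<in> MM" using k(1) w(2) by (rule MM_mult)
    then have "?P \<cdot> \<iota> w \<in> MM" using c wc by (simp add: AG.m_assoc)
    then have "lle l (?P \<cdot> \<iota> w)"
      by (rule l(4)) (use w c wc in \<open>simp_all add: AG.inv_mult_group AG.m_assoc\<close>)
    then show ?thesis using c wc inv_mem[OF l(1)] by (simp add: AG.m_assoc)
  qed
  ultimately show ?thesis by blast
qed

lemma lle_trans:
  assumes "x \<in> MM" "y \<in> MM" "z \<in> MM" "lle x y" "lle y z"
  shows "lle x z"
  using MM_mult[OF assms(4,5)] assms(1-3) by (simp add: AG.m_assoc)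

lemma rle_trans:
  assumes "x \<in> MM" "y \<in> MM" "z \<in> MM" "rle x y" "rle y z"
  shows "rle x z"
  using MM_mult[OF assms(5,4)] assms(1-3) by (simp add: AG.m_assoc)

lemma lle_norm:
  assumes "x \<in> MM" "y \<in> MM" "lle x y"
  shows "x = y \<or> \<nu> x < \<nu> y"
proof (cases "\<iota> x \<cdot> y = \<one>\<^bsub>AG\<^esub>")
  case True
  then have "x \<cdot> (\<iota> x \<cdot> y) = x" using assms by simp
  then show ?thesis using assms by simp
next
  case False
  then show ?thesis using nu_mult[OF assms(1,3)] nu_zero[OF assms(3)] assms by simp
qed

lemma rle_norm:
  assumes "x \<in> MM" "y \<in> MM" "rle x y"
  shows "x = y \<or> \<nu> x < \<nu> y"
proof (cases "y \<cdot> \<iota> x = \<one>\<^bsub>AG\<^esub>")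
  case True
  then have "(y \<cdot> \<iota> x) \<cdot> x = x" using assms by simp
  then show ?thesis using assms by (simp add: AG.m_assoc)
next
  case False
  then show ?thesis using nu_mult[OF assms(3,1)] nu_zero[OF assms(3)] assms by (simp add: AG.m_assoc)
qed

lemma lattice_left: "lattice \<lparr>carrier = carrier MR, eq = (=), le = left_le MR\<rparr>"
proof -
  have "lattice (poset MM (left_le MR))"
  proof (rule lattice_from_lubs[where \<nu> = \<nu> and b = "\<one>\<^bsub>AG\<^esub>"])
    show "\<exists>s\<in>MM. left_le MR x s \<and> left_le MR y s \<and>
        (\<forall>u\<in>MM. left_le MR x u \<longrightarrow> left_le MR y u \<longrightarrow> left_le MR s u)"
      if xy: "x \<in> MM" "y \<in> MM" for x y
    proof -
      obtain z where "z \<in> MM" "lle x z" "lle y z"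
        "\<forall>w\<in>MM. lle x w \<longrightarrow> lle y w \<longrightarrow> lle z w" using MM_lub[OF xy] by blast
      then show ?thesis using xy by (intro bexI[of _ z]) (simp_all add: lle_iff)
    qed
    show "left_le MR x z"
      if "x \<in> MM" "y \<in> MM" "z \<in> MM" "left_le MR x y" "left_le MR y z" for x y z
      using lle_trans[OF that(1-3)] that lle_iff by simp
    show "x = y \<or> \<nu> x < \<nu> y" if "x \<in> MM" "y \<in> MM" "left_le MR x y" for x y
      using lle_norm[OF that(1,2)] lle_iff that by simp
  qed (use lle_iff MM_one in auto)
  then show ?thesis by simp
qed

lemma lattice_right: "lattice \<lparr>carrier = carrier MR, eq = (=), le = right_le MR\<rparr>"
proof -
  have "lattice (poset MM (right_le MR))"
  proof (rule lattice_from_glbs[where \<nu> = \<nu>])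
    show "\<exists>s\<in>MM. right_le MR s x \<and> right_le MR s y \<and>
        (\<forall>u\<in>MM. right_le MR u x \<longrightarrow> right_le MR u y \<longrightarrow> right_le MR u s)"
      if xy: "x \<in> MM" "y \<in> MM" for x y
    proof -
      obtain z where "z \<in> MM" "rle z x" "rle z y"
        "\<forall>w\<in>MM. rle w x \<longrightarrow> rle w y \<longrightarrow> rle w z" using MM_right_glb[OF xy] by blast
      then show ?thesis using xy by (intro bexI[of _ z]) (simp_all add: rle_iff)
    qed
    show "\<exists>z\<in>MM. right_le MR x z \<and> right_le MR y z" if xy: "x \<in> MM" "y \<in> MM" for x y
    proof -
      obtain k :: nat where "rle x (Dpow k)" "rle y (Dpow k)" using rle_common[OF xy] .
      then show ?thesis using D_power_MM[of k] rle_iff xy by blast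
    qed
    show "right_le MR x z"
      if "x \<in> MM" "y \<in> MM" "z \<in> MM" "right_le MR x y" "right_le MR y z" for x y z
      using rle_trans[OF that(1-3)] that rle_iff by simp
    show "x = y \<or> \<nu> x < \<nu> y" if "x \<in> MM" "y \<in> MM" "right_le MR x y" for x y
      using rle_norm[OF that(1,2)] rle_iff that by simp
  qed (use rle_iff MM_one in auto)
  then show ?thesis by simp
qed

text \<open>Among the divisors of \<open>Delta\<close> are all \<open>\<sigma> i\<close> and the
  images of the divisors of \<open>h\<close>; these already generate.\<close>

lemma garside_element_Delta: "garside_element MR (artin_Delta n H h)"
proof -
  have lD: "lle (elt w) D" if "valid w" "valid q" "w @ q \<approx> Delta" for w q
  proof -
    have "elt w \<cdot> elt q = D" using eqv_imp_elt_eq[OF that(3)] that by (simp add: elt_append)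
    then have "\<iota> (elt w) \<cdot> D = elt q" using that elt_closed AG_cancel(1) by metis
    then show ?thesis using elt_in_MM that by simp
  qed
  let ?L = "{x \<in> carrier MR. left_le MR x D}"
  have L: "?L = {x \<in> MM. lle x D}" by (simp add: lle_iff[OF _ D_MM] cong: conj_cong)
  have "?L = {x \<in> carrier MR. right_le MR x D}"
    by (simp add: lle_iff[OF _ D_MM] rle_iff[OF _ D_MM] D_lle_rle cong: conj_cong)
  moreover have "mgenerate MR ?L = carrier MR"
  proof (rule MR_generated[OF _ M_generated])
    show "?L \<subseteq> MM" by auto
    fix x assume "x \<in> {x \<in> M. inv x \<otimes> h \<in> M}"
    then have x: "x \<in> M" "inv x \<otimes> h \<in> M" by auto
    then obtain q where "valid q" "mword x @ q \<approx> Delta" using mword_divides_Delta by blast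
    then show "\<eta> x \<in> ?L"
      unfolding L using lD[OF mon_letters[OF x(1)]] elt_in_MM[OF mon_letters[OF x(1)]] elt_mword[OF x(1)] by simp
  next
    fix i assume i: "i \<in> {1..<n}"
    then obtain q where q: "valid q" "[Sig i] @ q \<approx> Delta" using Sig_divides_Delta[of i] by auto
    have "elt [Sig i] = \<sigma> i" using elt_letter_closed[of "Sig i"] i by simp
    moreover have "lle (elt [Sig i]) D" using lD[OF _ q] i by simp
    moreover have "elt [Sig i] \<in> MM" using i by (intro elt_in_MM) simp
    ultimately show "\<sigma> i \<in> ?L" unfolding L by simp
  qed
  ultimately show ?thesis
    using D_MM by (simp add: garside_element_def flip: elt_Delta)
qed

text \<open>The free factors are reached one after the other: \<open>\<sigma> i\<close> takes the
  \<open>i\<close>-th factor to a conjugate of the next one by an element already in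
  \<open>K\<close>.\<close>

lemma MM_generates:
  assumes K: "subgroup K AG" and sub: "MM \<subseteq> K"
  shows "carrier AG \<subseteq> K"
proof -
  interpret K: subgroup K AG by fact
  interpret G: group GG by (rule group_free_power)
  interpret B: group BB by (rule group_braid_group)
  interpret fr: group_hom GG AG "of_free n"
    using base.of_free_hom by (simp add: group_hom_def group_hom_axioms_def G.is_group AG.is_group)
  have t: "\<sigma> i \<in> K" if "i \<in> {1..<n}" for i
    using elt_in_MM[of "[Sig i]"] that elt_letter_closed[of "Sig i"] sub by auto
  have one: "\<eta> y \<in> K" if "y \<in> carrier H" for y
  proof -
    \<comment> \<open>The preimage of \<open>K\<close> in \<open>H\<close> is a subgroup containing
      \<open>M\<close>, hence all of \<open>H\<close>.\<close>
    let ?S = "{y \<in> carrier H. \<eta> y \<in> K}"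
    interpret p: group_hom H AG "\<lambda>y. \<eta> y"
      using phi_hom by (simp add: group_hom_def group_hom_axioms_def is_group AG.is_group)
    have "subgroup ?S H"
      using p.hom_one p.hom_mult p.hom_inv by (intro subgroupI) auto
    moreover have "M \<subseteq> ?S" using elt_in_MM[OF mon_letters] elt_mword sub by fastforce
    ultimately show ?thesis using frac_generates[OF frac] that by blast
  qed
  have all: "of_free n (\<phi> i y) \<in> K" if "1 \<le> i" "i \<le> n" "y \<in> carrier H" for i y
    using that
  proof (induction i arbitrary: y rule: dec_induct)
    case base
    then show ?case using one by simp
  next
    case (step i)
    have i: "i \<in> {1..n}" "Suc i \<in> {1..n}" "i \<in> {1..<n}" using step by auto
    let ?t = "\<sigma> i" and ?h = "\<phi> i h" and ?y = "\<phi> i y" and ?z = "\<phi> (Suc i) y"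
    note c = free_power_inj_closed[OF i(1) h_carrier] free_power_inj_closed[OF i(1) step.prems(2)]
      free_power_inj_closed[OF i(2) step.prems(2)]
    have tc: "?t \<in> carrier AG" using base.braid_gen_closed[OF i(3)] by simp
    have "?t \<cdot> of_free n ?y = of_free n (inv\<^bsub>GG\<^esub> ?h \<otimes>\<^bsub>GG\<^esub> ?z \<otimes>\<^bsub>GG\<^esub> ?h) \<cdot> ?t"
      using base.of_braid_of_free[OF base.braid_gen_closed[OF i(3)] c(2)] base.rep_gen[OF i(3)]
        artin_tau_gen[OF is_group h_carrier i(3) i(1) step.prems(2)] by simp
    then have e: "?t \<cdot> of_free n ?y
        = \<iota> (of_free n ?h) \<cdot> of_free n ?z \<cdot> of_free n ?h \<cdot> ?t"
      using c by simp
    have "of_free n ?h \<cdot> (?t \<cdot> of_free n ?y) \<cdot> \<iota> ?t \<cdot> \<iota> (of_free n ?h)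
        = of_free n ?z"
      unfolding e using c tc by (simp add: AG.m_assoc)
    moreover have "of_free n ?h \<in> K" "of_free n ?y \<in> K" using step h_carrier by auto
    ultimately show ?case using t[OF i(3)] by (metis K.m_closed K.m_inv_closed)
  qed
  have free: "of_free n g \<in> K" if "g \<in> carrier GG" for g
  proof (rule presented_hom_into_subgroup[OF AG.is_group base.of_free_hom[unfolded free_power_def] K _
        that[unfolded free_power_def]])
    fix s assume "s \<in> free_power_gens n H"
    then show "of_free n (pres_gen (free_power_gens n H) (free_power_rels n H) s) \<in> K"
      using all[of "fst s" "snd s"] by (simp add: free_power_gens_def free_power_inj_def mem_Times_iff)
  qed
  have braid: "of_braid n H b \<in> K" if "b \<in> carrier BB" for b
    by (rule presented_hom_into_subgroup[OF AG.is_group base.of_braid_hom[unfolded braid_group_def] K _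
          that[unfolded braid_group_def]]) (rule t[unfolded braid_gen_def])
  show ?thesis
  proof
    fix x assume "x \<in> carrier AG"
    then obtain g b where x: "x = (g, b)" "g \<in> carrier GG" "b \<in> carrier BB"
      by (auto simp: artin_group_def semidirect_product_def)
    then have "x = of_free n g \<cdot> of_braid n H b" using base.of_free_of_braid by simp
    then show "x \<in> K" using free braid x K.m_closed by metis
  qed
qed

text \<open>The lcm of two elements provides the Ore condition.\<close>

lemma fractions_AG: "is_group_of_fractions_of AG MM"
proof (rule AG.is_group_of_fractions_ofI[OF MM_submonoid MM_generates])
  fix x y assume xy: "x \<in> MM" "y \<in> MM"
  then obtain z where "lle x z" "lle y z" "z \<in> MM" using MM_lub by blast
  then show "\<exists>u\<in>MM. \<exists>v\<in>MM. x \<cdot> u = y \<cdot> v"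
    using xy by (intro bexI[of _ "\<iota> x \<cdot> z"] bexI[of _ "\<iota> y \<cdot> z"]) simp_all
qed

lemma garside_MR:
  assumes "finite S" "mgenerate H S = M"
  shows "garside_monoid MR"
  unfolding garside_monoid_def
  using atomic_MR finitely_generated_MR[OF assms] monoid_cancel_MR lattice_left lattice_right
    garside_element_Delta by blast

end

text \<open>For a divisor \<open>x\<close> of \<open>h\<close>, taking complements twice on the same
  side gives its conjugate: \<open>h x^-1\<close> is again a divisor of \<open>h\<close>, and its
  own complement is \<open>h x h^-1\<close>. The divisors generate \<open>M\<close>.\<close>

lemma (in group) garside_conj_closed:
  assumes "submonoid M G" "garside_element (G\<lparr>carrier := M\<rparr>) h" "a \<in> M"
  shows "h \<otimes> a \<otimes> inv h \<in> M \<and> inv h \<otimes> a \<otimes> h \<in> M"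
proof -
  interpret M: submonoid M G by fact
  have sub: "x \<in> carrier G" if "x \<in> M" for x using that M.subset by blast
  have h: "h \<in> M" using assms(2) by (simp add: garside_element_def)
  note le = submonoid_le[OF M.subset]
  let ?L = "{x \<in> M. inv x \<otimes> h \<in> M}"
  have "{x \<in> M. left_le (G\<lparr>carrier := M\<rparr>) x h} = ?L" using le h by auto
  moreover have "{x \<in> M. right_le (G\<lparr>carrier := M\<rparr>) x h} = {x \<in> M. h \<otimes> inv x \<in> M}"
    using le h by auto
  ultimately have gen: "mgenerate G ?L = M" and LR: "\<And>x. x \<in> M \<Longrightarrow> inv x \<otimes> h \<in> M \<longleftrightarrow> h \<otimes> inv x \<in> M"
    using assms(2) by (auto simp: garside_element_def mgenerate_carrier_update)
  have cancel: "x \<otimes> (inv x \<otimes> y) = y" "inv x \<otimes> (x \<otimes> y) = y"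
    if "x \<in> carrier G" "y \<in> carrier G" for x y
    using that by (simp_all flip: m_assoc)
  have base: "h \<otimes> x \<otimes> inv h \<in> M \<and> inv h \<otimes> x \<otimes> h \<in> M" if x: "x \<in> M" "inv x \<otimes> h \<in> M" for x
  proof
    have y: "h \<otimes> inv x \<in> M" using LR x by blast
    have "inv (h \<otimes> inv x) \<otimes> h = x \<otimes> inv h \<otimes> h"
      using sub[OF x(1)] sub[OF h] by (simp add: inv_mult_group)
    also have "\<dots> = x" using sub[OF x(1)] sub[OF h] by (simp add: m_assoc)
    finally have "inv (h \<otimes> inv x) \<otimes> h \<in> M" using x by simp
    then have "h \<otimes> inv (h \<otimes> inv x) \<in> M" using LR[OF y] by blast
    then show "h \<otimes> x \<otimes> inv h \<in> M"
      using sub[OF x(1)] sub[OF h] by (simp add: inv_mult_group m_assoc)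
    have "h \<otimes> inv (inv x \<otimes> h) \<in> M"
      using sub[OF x(1)] sub[OF h] x by (simp add: inv_mult_group cancel)
    then have "inv (inv x \<otimes> h) \<otimes> h \<in> M" using LR[OF x(2)] by blast
    then show "inv h \<otimes> x \<otimes> h \<in> M"
      using sub[OF x(1)] sub[OF h] by (simp add: inv_mult_group)
  qed
  have "x \<in> mgenerate G ?L \<Longrightarrow>
    x \<in> M \<and> h \<otimes> x \<otimes> inv h \<in> M \<and> inv h \<otimes> x \<otimes> h \<in> M" for x
  proof (induction rule: mgenerate.induct)
    case one
    then show ?case using sub[OF h] by simp
  next
    case (incl x)
    then show ?case using base by blast
  next
    case (mult x y)
    note c = sub[of x] sub[of y] sub[OF h]
    have "(h \<otimes> x \<otimes> inv h) \<otimes> (h \<otimes> y \<otimes> inv h) \<in> M"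
      "(inv h \<otimes> x \<otimes> h) \<otimes> (inv h \<otimes> y \<otimes> h) \<in> M"
      using mult by auto
    then show ?case using mult c by (simp add: m_assoc cancel)
  qed
  then show ?thesis using assms(3) unfolding gen by blast
qed

text \<open>Factorization length is intrinsic to \<open>M\<close> and hence invariant under
  conjugation by \<open>h\<close>; a norm supplied by atomicity need not be.\<close>

lemma (in group) artin_datum_max_length:
  assumes "1 \<le> n" "h \<in> carrier G - {\<one>}" "garside_monoid (G\<lparr>carrier := M\<rparr>)"
    "is_group_of_fractions_of G M" "garside_element (G\<lparr>carrier := M\<rparr>) h"
  shows "artin_datum G M h (max_length (G\<lparr>carrier := M\<rparr>)) n"
proof -
  let ?N = "G\<lparr>carrier := M\<rparr>"
  have M: "submonoid M G" using assms(4) by (simp add: is_group_of_fractions_of_def)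
  interpret M: submonoid M G by fact
  interpret N: monoid ?N by (rule M.submonoid_is_monoid[OF is_monoid])
  have sub: "x \<in> carrier G" if "x \<in> M" for x using that M.subset by blast
  have h: "h \<in> M" using assms(5) by (simp add: garside_element_def)
  note le = submonoid_le[OF M.subset]
  note conj = garside_conj_closed[OF M assms(5)]
  have atomic: "atomic_monoid ?N" using assms(3) by (simp add: garside_monoid_def)
  obtain \<beta> :: "'a \<Rightarrow> nat" where \<beta>: "\<And>xs. set xs \<subseteq> carrier ?N - {\<one>\<^bsub>?N\<^esub>} \<Longrightarrow> length xs \<le> \<beta> (mprod ?N xs)"
    using atomic_monoid_bound[OF atomic] by blast
  have cancel: "x \<otimes> (inv x \<otimes> y) = y" "inv x \<otimes> (x \<otimes> y) = y"
    if "x \<in> carrier G" "y \<in> carrier G" for x y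
    using that by (simp_all flip: m_assoc)
  show ?thesis
  proof
    show "h \<in> M" "h \<noteq> \<one>" "1 \<le> n" "is_group_of_fractions_of G M"
      using M h assms by auto
    fix a assume a: "a \<in> M"
    show "h \<otimes> a \<otimes> inv h \<in> M" "inv h \<otimes> a \<otimes> h \<in> M" using conj[OF a] by auto
  next
    fix a assume a: "a \<in> M" and "a \<noteq> \<one>"
    then show "0 < max_length ?N a"
      using N.max_length_norm(1)[OF \<beta>, of a] by simp
  next
    fix a assume a: "a \<in> M"
    have h_M: "h \<in> carrier G" and a_M: "a \<in> carrier G" using sub h a by auto
    \<comment> \<open>Conjugating by \<open>h\<close> and back returns to \<open>a\<close>, so the
      two inclusions force equality.\<close>
    have "factor_lengths ?N a \<subseteq> factor_lengths ?N (h \<otimes> a \<otimes> inv h)"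
    proof (rule N.factor_lengths_hom)
      fix x assume "x \<in> carrier ?N" "h \<otimes> x \<otimes> inv h = \<one>\<^bsub>?N\<^esub>"
      then have "inv h \<otimes> (h \<otimes> x \<otimes> inv h) \<otimes> h = \<one>" "x \<in> carrier G" using h_M sub by auto
      then show "x = \<one>\<^bsub>?N\<^esub>" using h_M by (simp add: m_assoc cancel)
    qed (use conj sub h_M in \<open>auto simp: m_assoc cancel\<close>)
    moreover have "factor_lengths ?N (h \<otimes> a \<otimes> inv h) \<subseteq> factor_lengths ?N (inv h \<otimes> (h \<otimes> a \<otimes> inv h) \<otimes> h)"
    proof (rule N.factor_lengths_hom)
      fix x assume "x \<in> carrier ?N" "inv h \<otimes> x \<otimes> h = \<one>\<^bsub>?N\<^esub>"
      then have "h \<otimes> (inv h \<otimes> x \<otimes> h) \<otimes> inv h = \<one>" "x \<in> carrier G" using h_M sub by auto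
      then show "x = \<one>\<^bsub>?N\<^esub>" using h_M by (simp add: m_assoc cancel)
    qed (use conj sub h_M in \<open>auto simp: m_assoc cancel\<close>)
    ultimately show "max_length ?N (h \<otimes> a \<otimes> inv h) = max_length ?N a"
      using h_M a_M by (simp add: max_length_def m_assoc cancel)
  next
    fix a b assume a: "a \<in> M" and b: "b \<in> M"
    show "max_length ?N a + max_length ?N b \<le> max_length ?N (a \<otimes> b)"
      using N.max_length_norm(2)[OF \<beta>, of a b] a b by simp
    have "lattice (poset M (left_le ?N))" using assms(3) by (simp add: garside_monoid_def)
    from lattice_poset_lub[OF this a b]
    obtain s where s: "s \<in> M" "left_le ?N a s" "left_le ?N b s"
      "\<And>u. u \<in> M \<Longrightarrow> left_le ?N a u \<Longrightarrow> left_le ?N b u \<Longrightarrow> left_le ?N s u" by blast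
    then show "\<exists>c\<in>M. inv a \<otimes> c \<in> M \<and> inv b \<otimes> c \<in> M \<and>
        (\<forall>d\<in>M. inv a \<otimes> d \<in> M \<longrightarrow> inv b \<otimes> d \<in> M \<longrightarrow> inv c \<otimes> d \<in> M)"
      using le(1) a b by (intro bexI[of _ s]) simp_all
  next
    have L: "{x \<in> carrier ?N. left_le ?N x h} = {x \<in> M. inv x \<otimes> h \<in> M}" using le h by auto
    have "mgenerate ?N {x \<in> carrier ?N. left_le ?N x h} = carrier ?N"
      using assms(5) unfolding garside_element_def by blast
    then show "mgenerate G {x \<in> M. inv x \<otimes> h \<in> M} = M"
      unfolding L mgenerate_carrier_update by simp
  qed
qed

theorem theorem6p1:
  fixes H :: "('a, 'b) monoid_scheme" and h :: 'a and M :: "'a set" and n :: nat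
  assumes "n \<ge> 1"
    and "group H"
    and "h \<in> carrier H - {\<one>\<^bsub>H\<^esub>}"
    and "garside_monoid (H\<lparr>carrier := M\<rparr>)"
    and "is_group_of_fractions_of H M"
    and "garside_element (H\<lparr>carrier := M\<rparr>) h"
  shows "garside_monoid ((artin_group n H h)\<lparr>carrier := artin_submonoid n H h M\<rparr>) \<and>
    garside_element ((artin_group n H h)\<lparr>carrier := artin_submonoid n H h M\<rparr>)
      (artin_Delta n H h) \<and>
    is_group_of_fractions_of (artin_group n H h) (artin_submonoid n H h M)"
proof -
  interpret artin_datum H M h "max_length (H\<lparr>carrier := M\<rparr>)" n
    by (rule group.artin_datum_max_length[OF assms(2,1,3-)])
  obtain S where "finite S" "mgenerate (H\<lparr>carrier := M\<rparr>) S = M"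
    using assms(4) by (auto simp: garside_monoid_def finitely_generated_monoid_def)
  then show ?thesis
    using garside_MR garside_element_Delta fractions_AG by (simp add: mgenerate_carrier_update)
qed

end
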